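(* Let $\Bbbk$ be an algebraically closed field of characteristic $p>2$ and $n\ge2$. Let $\bar Y_n^>(\Bbbk):=\mathbf{Y}_n^>\otimes_{\mathbb{Z}[\frac12]}\Bbbk$ (via the natural map $\mathbb{Z}[\frac12]\to\Bbbk$), write $\bar a=a\otimes1$, and let $\bar y_n^>(\Bbbk)$ (the small Yangian) be the $\Bbbk$-subalgebra of $\bar Y_n^>(\Bbbk)$ generated by the elements $\overline{e_\beta(r)^t/t!}$ for $\beta\in\Delta^+$, $r\in\mathbb{N}$, $0\le t\le p-1$. Then the elements $\bar E_h=E_h\otimes1$, with $h$ ranging over $p$-restricted finitely supported functions $h:\Delta^+\times\mathbb{N}\to\mathbb{N}$, form a $\Bbbk$-basis of $\bar y_n^>(\Bbbk)$.
   Context: $\mathbb{N}=\{0,1,\dots\}$, $I=\{1,\dots,n-1\}$, $(c_{ij})$ the Cartan matrix of $\mathfrak{sl}_n$. $Y_n^>$ is the $\mathbb{C}$-algebra generated by $e_{i,r}$ ($i\in I,r\in\mathbb{N}$) with relations $[e_{i,r+1},e_{j,s}]-[e_{i,r},e_{j,s+1}]=\frac{c_{ij}}{2}(e_{i,r}e_{j,s}+e_{j,s}e_{i,r})$; $[e_{i,r},e_{j,s}]=0$ if $c_{ij}=0$; $[e_{i,r_1},[e_{i,r_2},e_{j,s}]]+[e_{i,r_2},[e_{i,r_1},e_{j,s}]]=0$ if $c_{ij}=-1$. $\mathbf{Y}_n^>$ is its $\mathbb{Z}[\frac12]$-subalgebra generated by $e_{i,r}^t/t!$ ($t\in\mathbb{N}$);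 the elements $e_\beta(r)^t/t!$ lie in $\mathbf{Y}_n^>$. $\Delta^+=\{[i,j]:1\le i\le j\le n-1\}$, $e_\beta(r)=[\cdots[e_{i,r},e_{i+1,0}],\dots,e_{j,0}]$ for $\beta=[i,j]$. Order: $[i,j]\le[i',j']$ iff $i<i'$ or ($i=i'$, $j\le j'$); $(\beta,r)\le(\beta',r')$ iff $\beta<\beta'$ or ($\beta=\beta'$, $r\ge r'$). $E_h=\prod^{\rightarrow}_{(\beta,r)}e_\beta(r)^{h(\beta,r)}\in\mathbf{Y}_n^>$, product in increasing order. $h$ is $p$-restricted if $h(\beta,r)<p$ for all $(\beta,r)$. *)

theory Defs
  imports "HOL-Computational_Algebra.Polynomial" "HOL-Library.Product_Lexorder"
begin

text \<open>Elements of the free algebra on generators e_{i,r}, indexed by (i,r) :: nat * nat,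
  are finitely supported functions from words (lists of generators) to complex numbers.\<close>

type_synonym word = "(nat \<times> nat) list"
type_synonym fa = "word \<Rightarrow> complex"

definition fin_supp :: "('a \<Rightarrow> 'b::zero) \<Rightarrow> bool" where
  "fin_supp f \<longleftrightarrow> finite {x. f x \<noteq> 0}"

definition fa_one :: fa where
  "fa_one = (\<lambda>w. if w = [] then 1 else 0)"

definition fa_gen :: "nat \<Rightarrow> nat \<Rightarrow> fa" where
  "fa_gen i r = (\<lambda>w. if w = [(i, r)] then 1 else 0)"

definition fa_add :: "fa \<Rightarrow> fa \<Rightarrow> fa" where
  "fa_add a b = (\<lambda>w. a w + b w)"

definition fa_smult :: "complex \<Rightarrow> fa \<Rightarrow> fa" where
  "fa_smult c a = (\<lambda>w. c * a w)"

definition fa_mult :: "fa \<Rightarrow> fa \<Rightarrow> fa" where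
  "fa_mult a b = (\<lambda>w. \<Sum>i\<le>length w. a (take i w) * b (drop i w))"

definition fa_diff :: "fa \<Rightarrow> fa \<Rightarrow> fa" where
  "fa_diff a b = (\<lambda>w. a w - b w)"

definition fa_comm :: "fa \<Rightarrow> fa \<Rightarrow> fa" where
  "fa_comm a b = fa_diff (fa_mult a b) (fa_mult b a)"

primrec fa_pow :: "fa \<Rightarrow> nat \<Rightarrow> fa" where
  "fa_pow a 0 = fa_one"
| "fa_pow a (Suc t) = fa_mult a (fa_pow a t)"

definition fa_prod_list :: "fa list \<Rightarrow> fa" where
  "fa_prod_list xs = foldr fa_mult xs fa_one"

definition fa_divpow :: "fa \<Rightarrow> nat \<Rightarrow> fa" where
  "fa_divpow a t = fa_smult (1 / of_nat (fact t)) (fa_pow a t)"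

definition cartan :: "nat \<Rightarrow> nat \<Rightarrow> int" where
  "cartan i j = (if i = j then 2 else if i = j + 1 \<or> j = i + 1 then -1 else 0)"

definition Iset :: "nat \<Rightarrow> nat set" where
  "Iset n = {1..n - 1}"

definition yangian_rels :: "nat \<Rightarrow> fa set" where
  "yangian_rels n =
     {fa_diff (fa_diff (fa_comm (fa_gen i (r+1)) (fa_gen j s)) (fa_comm (fa_gen i r) (fa_gen j (s+1))))
        (fa_smult (of_int (cartan i j) / 2)
           (fa_add (fa_mult (fa_gen i r) (fa_gen j s)) (fa_mult (fa_gen j s) (fa_gen i r))))
      | i j r s. i \<in> Iset n \<and> j \<in> Iset n}
   \<union> {fa_comm (fa_gen i r) (fa_gen j s) | i j r s. i \<in> Iset n \<and> j \<in> Iset n \<and> cartan i j = 0}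
   \<union> {fa_add (fa_comm (fa_gen i r1) (fa_comm (fa_gen i r2) (fa_gen j s)))
             (fa_comm (fa_gen i r2) (fa_comm (fa_gen i r1) (fa_gen j s)))
      | i j r1 r2 s. i \<in> Iset n \<and> j \<in> Iset n \<and> cartan i j = -1}"

inductive_set yangian_ideal :: "nat \<Rightarrow> fa set" for n where
  rel: "x \<in> yangian_rels n \<Longrightarrow> x \<in> yangian_ideal n"
| zero: "(\<lambda>w. 0) \<in> yangian_ideal n"
| add: "x \<in> yangian_ideal n \<Longrightarrow> y \<in> yangian_ideal n \<Longrightarrow> fa_add x y \<in> yangian_ideal n"
| lmult: "fin_supp a \<Longrightarrow> x \<in> yangian_ideal n \<Longrightarrow> fa_mult a x \<in> yangian_ideal n"
| rmult: "fin_supp a \<Longrightarrow> x \<in> yangian_ideal n \<Longrightarrow> fa_mult x a \<in> yangian_ideal n"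

text \<open>Z[1/2] as a subset of the complex numbers, and its image in a field 'k.\<close>
definition zhalf :: "int \<Rightarrow> nat \<Rightarrow> complex" where
  "zhalf z m = of_int z / 2 ^ m"

definition zhalf_k :: "int \<Rightarrow> nat \<Rightarrow> 'k::field" where
  "zhalf_k z m = of_int z / 2 ^ m"

text \<open>Preimage in the free algebra of the Z[1/2]-form bold Y_n^>: the Z[1/2]-subalgebra generated by
  the divided powers e_{i,r}^t/t!, plus the ideal.  Its image modulo the ideal is bold Y_n^>.\<close>
inductive_set Yform_pre :: "nat \<Rightarrow> fa set" for n where
  gen: "i \<in> Iset n \<Longrightarrow> fa_divpow (fa_gen i r) t \<in> Yform_pre n"
| one: "fa_one \<in> Yform_pre n"
| ideal: "x \<in> yangian_ideal n \<Longrightarrow> x \<in> Yform_pre n"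
| add: "x \<in> Yform_pre n \<Longrightarrow> y \<in> Yform_pre n \<Longrightarrow> fa_add x y \<in> Yform_pre n"
| mult: "x \<in> Yform_pre n \<Longrightarrow> y \<in> Yform_pre n \<Longrightarrow> fa_mult x y \<in> Yform_pre n"
| smult: "x \<in> Yform_pre n \<Longrightarrow> fa_smult (zhalf z m) x \<in> Yform_pre n"

definition pos_roots :: "nat \<Rightarrow> (nat \<times> nat) set" where
  "pos_roots n = {(i, j). 1 \<le> i \<and> i \<le> j \<and> j \<le> n - 1}"

definition root_vec :: "nat \<times> nat \<Rightarrow> nat \<Rightarrow> fa" where
  "root_vec \<beta> r = foldl (\<lambda>a k. fa_comm a (fa_gen k 0)) (fa_gen (fst \<beta>) r) [Suc (fst \<beta>)..<Suc (snd \<beta>)]"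

definition pbw_key :: "(nat \<times> nat) \<times> nat \<Rightarrow> nat \<times> nat \<times> int" where
  "pbw_key x = (fst (fst x), snd (fst x), - int (snd x))"

definition supp_list :: "((nat \<times> nat) \<times> nat \<Rightarrow> nat) \<Rightarrow> ((nat \<times> nat) \<times> nat) list" where
  "supp_list h = sort_key pbw_key (sorted_list_of_set {x. h x \<noteq> 0})"

definition E_mon :: "((nat \<times> nat) \<times> nat \<Rightarrow> nat) \<Rightarrow> fa" where
  "E_mon h = fa_prod_list (map (\<lambda>x. fa_pow (root_vec (fst x) (snd x)) (h x)) (supp_list h))"

definition admissible_h :: "nat \<Rightarrow> nat \<Rightarrow> ((nat \<times> nat) \<times> nat \<Rightarrow> nat) \<Rightarrow> bool" where
  "admissible_h n p h \<longleftrightarrow> finite {x. h x \<noteq> 0} \<and> (\<forall>x. h x \<noteq> 0 \<longrightarrow> fst x \<in> pos_roots n)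
     \<and> (\<forall>x. h x < p)"

text \<open>The tensor product is realised as the free k-module on the set Yform_pre n
  (k-valued finitely supported functions on it) modulo the k-span of
  delta_a - delta_b (a - b in the ideal), delta_{a+b} - delta_a - delta_b, and
  delta_{q a} - qbar delta_a for q in Z[1/2].  The class of delta_a is (a mod ideal) \<otimes> 1.\<close>

definition delta :: "fa \<Rightarrow> fa \<Rightarrow> 'k::field" where
  "delta a = (\<lambda>x. if x = a then 1 else 0)"

definition kfree :: "nat \<Rightarrow> (fa \<Rightarrow> 'k::field) set" where
  "kfree n = {\<phi>. fin_supp \<phi> \<and> (\<forall>x. \<phi> x \<noteq> 0 \<longrightarrow> x \<in> Yform_pre n)}"

inductive_set tensor_rels :: "nat \<Rightarrow> (fa \<Rightarrow> 'k::field) set" for n where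
  ideal: "a \<in> Yform_pre n \<Longrightarrow> b \<in> Yform_pre n \<Longrightarrow> fa_diff a b \<in> yangian_ideal n
          \<Longrightarrow> (\<lambda>x. delta a x - delta b x) \<in> tensor_rels n"
| additive: "a \<in> Yform_pre n \<Longrightarrow> b \<in> Yform_pre n
          \<Longrightarrow> (\<lambda>x. delta (fa_add a b) x - delta a x - delta b x) \<in> tensor_rels n"
| scalar: "a \<in> Yform_pre n
          \<Longrightarrow> (\<lambda>x. delta (fa_smult (zhalf z m) a) x - zhalf_k z m * delta a x) \<in> tensor_rels n"
| zero: "(\<lambda>x. 0) \<in> tensor_rels n"
| add: "u \<in> tensor_rels n \<Longrightarrow> v \<in> tensor_rels n \<Longrightarrow> (\<lambda>x. u x + v x) \<in> tensor_rels n"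
| smult: "u \<in> tensor_rels n \<Longrightarrow> (\<lambda>x. c * u x) \<in> tensor_rels n"

definition small_gens :: "nat \<Rightarrow> nat \<Rightarrow> fa set" where
  "small_gens n p = {fa_divpow (root_vec \<beta> r) t | \<beta> r t. \<beta> \<in> pos_roots n \<and> t < p}"

definition small_monomials :: "nat \<Rightarrow> nat \<Rightarrow> fa set" where
  "small_monomials n p = {fa_prod_list xs | xs. set xs \<subseteq> small_gens n p}"

text \<open>Representatives (in the free k-module) of the k-subalgebra generated by the
  small generators: the k-span of the deltas of their products.\<close>
definition small_span :: "nat \<Rightarrow> nat \<Rightarrow> (fa \<Rightarrow> 'k::field) set" where
  "small_span n p = {(\<lambda>x. \<Sum>w\<in>W. c w * delta w x) | W c. finite W \<and> W \<subseteq> small_monomials n p}"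

end

theory Submission
  imports Defs "HOL-Computational_Algebra.Formal_Laurent_Series"
begin

text \<open>Spanning: give \<open>e\<^sub>i\<^sub>,\<^sub>r\<close> loop degree \<open>r\<close>. Modulo lower loop degree the defining relations
  say that brackets depend only on the total loop degree, so a bracket of two root vectors is a
  \<open>\<int>[1/2]\<close>-combination of root vectors up to words of lower degree, and any product of root vectors
  can be sorted. A sorted product containing a \<open>p\<close>-th power is \<open>p!\<close> times an element of the integral form,
  because divided powers of root vectors are integral, so it dies in characteristic \<open>p\<close>.

  Independence: the shuffle realisation sends an element to functions \<open>\<psi>(S)\<close> on finite sets \<open>S\<close> of coloured
  points. It kills the relations, and sends \<open>e\<^sub>i\<^sub>,\<^sub>r\<^sup>t/t!\<close> to a product of \<open>r\<close>-th powers, so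
  it is integral on the integral form as soon as differences of points are units. At points in
  \<open>\<complex>((1/T))\<close> arranged in chains, one chain per root, with widely separated degrees in \<open>T\<close>, a suitable
  coefficient of \<open>\<psi>(E\<^sub>h)\<close> vanishes except for one \<open>h\<close>, where it is the product of the factorials
  \<open>h(\<beta>,r)!\<close>, prime to \<open>p\<close> when \<open>h\<close> is \<open>p\<close>-restricted.\<close>

section \<open>The free algebra and the Yangian ideal\<close>

text \<open>Independence in characteristic \<open>p\<close> does not follow from independence over
  the complex numbers: it needs functionals that are integral on the whole integral form, not only
  on the monomials, and whose values there are prime to \<open>p\<close>. This dictates the points.
  Only \<open>zeta x a b\<close> has to be integral, so only points of equal or neighbouring colour
  need a unit as difference; a chain has one point of each of its colours, and at the points
  \<open>T^(Q + B^c) + k T^t\<close> every such difference has leading coefficient 1 or -1. Moreover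
  each \<open>zeta x a b\<close> is 1 plus lower powers of \<open>T\<close>, so at top degree the
  order of the factors is invisible.

  No order on the functions \<open>h\<close> is constructed. Among all orderings of the finitely
  many monomials in a linear relation, one that reaches the highest degree in \<open>T\<close> when
  laid out along chains determines the point set, and its maximality alone makes the other monomials
  drop out. Series are written in the variable \<open>1/T\<close>, so high powers of
  \<open>T\<close> sit at low indices.\<close>

lemma fin_supp_fa_mult:
  assumes "fin_supp a" "fin_supp b" shows "fin_supp (fa_mult a b)"
proof -
  have "{w. fa_mult a b w \<noteq> 0} \<subseteq> (\<lambda>(u, v). u @ v) ` ({w. a w \<noteq> 0} \<times> {w. b w \<noteq> 0})"
  proof
    fix w assume "w \<in> {w. fa_mult a b w \<noteq> 0}"
    then obtain i where "a (take i w) * b (drop i w) \<noteq> 0"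
      unfolding fa_mult_def by (auto elim: sum.not_neutral_contains_not_neutral)
    then show "w \<in> (\<lambda>(u, v). u @ v) ` ({w. a w \<noteq> 0} \<times> {w. b w \<noteq> 0})"
      by (auto intro!: image_eqI[of _ _ "(take i w, drop i w)"])
  qed
  then show ?thesis using assms unfolding fin_supp_def by (auto intro: finite_subset)
qed

lemma fin_supp_fa_add: "fin_supp a \<Longrightarrow> fin_supp b \<Longrightarrow> fin_supp (fa_add a b)"
  unfolding fin_supp_def fa_add_def
  by (rule finite_subset[of _ "{w. a w \<noteq> 0} \<union> {w. b w \<noteq> 0}"]) auto

lemma fin_supp_fa_diff: "fin_supp a \<Longrightarrow> fin_supp b \<Longrightarrow> fin_supp (fa_diff a b)"
  unfolding fin_supp_def fa_diff_def
  by (rule finite_subset[of _ "{w. a w \<noteq> 0} \<union> {w. b w \<noteq> 0}"]) auto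

lemma fin_supp_fa_smult: "fin_supp a \<Longrightarrow> fin_supp (fa_smult c a)"
  unfolding fin_supp_def fa_smult_def
  by (rule finite_subset[of _ "{w. a w \<noteq> 0}"]) auto

lemma fa_mult_assoc: "fa_mult (fa_mult a b) c = fa_mult a (fa_mult b c)"
proof
  fix w :: word
  define f where "f j l = a (take j w) * b (take l (drop j w)) * c (drop (j + l) w)" for j l
  have "fa_mult (fa_mult a b) c w = (\<Sum>k\<le>length w. \<Sum>i\<le>k. f i (k - i))"
    unfolding fa_mult_def
    by (auto intro!: sum.cong simp: f_def sum_distrib_right min_def drop_take)
  also have "\<dots> = (\<Sum>(i, j)\<in>{(i, j). i + j \<le> length w}. f i j)"
    by (rule sum.triangle_reindex_eq[symmetric])
  also have "\<dots> = (\<Sum>(i, j)\<in>(SIGMA i:{..length w}. {..length w - i}). f i j)"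
    by (rule sum.cong) auto
  also have "\<dots> = (\<Sum>i\<le>length w. \<Sum>j\<le>length w - i. f i j)"
    by (subst sum.Sigma) auto
  also have "\<dots> = fa_mult a (fa_mult b c) w"
    unfolding fa_mult_def
    by (auto intro!: sum.cong simp: f_def sum_distrib_left mult.assoc add.commute)
  finally show "fa_mult (fa_mult a b) c w = fa_mult a (fa_mult b c) w" .
qed

lemma fa_mult_one_left: "fa_mult fa_one a = a"
proof
  fix w :: word
  have "fa_mult fa_one a w = (\<Sum>i\<in>{0}. fa_one (take i w) * a (drop i w))"
    unfolding fa_mult_def by (rule sum.mono_neutral_right) (auto simp: fa_one_def)
  then show "fa_mult fa_one a w = a w" by (simp add: fa_one_def)
qed

lemma fa_mult_one_right: "fa_mult a fa_one = a"
proof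
  fix w :: word
  have "fa_mult a fa_one w = (\<Sum>i\<in>{length w}. a (take i w) * fa_one (drop i w))"
    unfolding fa_mult_def by (rule sum.mono_neutral_right) (auto simp: fa_one_def)
  then show "fa_mult a fa_one w = a w" by (simp add: fa_one_def)
qed

lemma fin_supp_fa_one: "fin_supp fa_one"
  unfolding fin_supp_def fa_one_def by (rule finite_subset[of _ "{[]}"]) auto

lemma fin_supp_fa_gen: "fin_supp (fa_gen i r)"
  unfolding fin_supp_def fa_gen_def by (rule finite_subset[of _ "{[(i, r)]}"]) auto

text \<open>The given definitions live on raw functions on words. Packaged as a
  \<open>ring_1\<close>, the finitely supported ones let \<open>algebra_simps\<close> settle the
  noncommutative identities used throughout.\<close>

typedef ncpoly = "{f :: fa. fin_supp f}" morphisms fa_of Ncpoly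
  by (rule exI[of _ "\<lambda>_. 0"]) (simp add: fin_supp_def)

setup_lifting type_definition_ncpoly

instantiation ncpoly :: ring_1
begin

lift_definition zero_ncpoly :: ncpoly is "\<lambda>_. 0" by (simp add: fin_supp_def)
lift_definition one_ncpoly :: ncpoly is fa_one by (rule fin_supp_fa_one)
lift_definition plus_ncpoly :: "ncpoly \<Rightarrow> ncpoly \<Rightarrow> ncpoly" is fa_add by (rule fin_supp_fa_add)
lift_definition minus_ncpoly :: "ncpoly \<Rightarrow> ncpoly \<Rightarrow> ncpoly" is fa_diff by (rule fin_supp_fa_diff)
lift_definition uminus_ncpoly :: "ncpoly \<Rightarrow> ncpoly" is "fa_smult (-1)" by (rule fin_supp_fa_smult)
lift_definition times_ncpoly :: "ncpoly \<Rightarrow> ncpoly \<Rightarrow> ncpoly" is fa_mult by (rule fin_supp_fa_mult)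

instance
proof
  fix a b c :: ncpoly
  show "a * b * c = a * (b * c)" by transfer (rule fa_mult_assoc)
  show "1 * a = a" by transfer (rule fa_mult_one_left)
  show "a * 1 = a" by transfer (rule fa_mult_one_right)
  show "(a + b) * c = a * c + b * c"
    by transfer (simp add: fa_mult_def fa_add_def fun_eq_iff distrib_right sum.distrib)
  show "a * (b + c) = a * b + a * c"
    by transfer (simp add: fa_mult_def fa_add_def fun_eq_iff distrib_left sum.distrib)
  show "a + b + c = a + (b + c)" by transfer (simp add: fa_add_def fun_eq_iff)
  show "a + b = b + a" by transfer (simp add: fa_add_def fun_eq_iff)
  show "0 + a = a" by transfer (simp add: fa_add_def fun_eq_iff)
  show "- a + a = 0" by transfer (simp add: fa_add_def fa_smult_def fun_eq_iff)
  show "a - b = a + - b" by transfer (simp add: fa_add_def fa_diff_def fa_smult_def fun_eq_iff)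
  show "(0::ncpoly) \<noteq> 1" by transfer (auto simp: fa_one_def fun_eq_iff)
qed

end

lift_definition scale :: "complex \<Rightarrow> ncpoly \<Rightarrow> ncpoly" is fa_smult by (rule fin_supp_fa_smult)
lift_definition egen :: "nat \<Rightarrow> nat \<Rightarrow> ncpoly" is fa_gen by (rule fin_supp_fa_gen)

lemma scale_mult_left: "scale c x * y = scale c (x * y)"
  by transfer (simp add: fa_smult_def fa_mult_def sum_distrib_left mult.assoc fun_eq_iff)
lemma scale_mult_right: "x * scale c y = scale c (x * y)"
  by transfer (simp add: fa_smult_def fa_mult_def sum_distrib_left mult.left_commute fun_eq_iff)
lemma scale_scale [simp]: "scale c (scale d x) = scale (c * d) x"
  by transfer (simp add: fa_smult_def mult.assoc fun_eq_iff)
lemma scale_add_right: "scale c (x + y) = scale c x + scale c y"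
  by transfer (simp add: fa_smult_def fa_add_def distrib_left fun_eq_iff)
lemma scale_diff_right: "scale c (x - y) = scale c x - scale c y"
  by transfer (simp add: fa_smult_def fa_diff_def right_diff_distrib fun_eq_iff)
lemma scale_add_left: "scale (c + d) x = scale c x + scale d x"
  by transfer (simp add: fa_smult_def fa_add_def distrib_right fun_eq_iff)
lemma scale_1 [simp]: "scale 1 x = x"
  by transfer (simp add: fa_smult_def fun_eq_iff)
lemma scale_0_right [simp]: "scale c 0 = 0"
  by transfer (simp add: fa_smult_def fun_eq_iff)
lemma scale_0_left [simp]: "scale 0 x = 0"
  by transfer (simp add: fa_smult_def fun_eq_iff)
lemma scale_minus_left: "scale (- c) x = - scale c x"
  by transfer (simp add: fa_smult_def fun_eq_iff)
lemma scale_sum_right: "scale c (sum f A) = (\<Sum>a\<in>A. scale c (f a))"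
  by (induction A rule: infinite_finite_induct) (auto simp: scale_add_right)

lemma fa_of_Ncpoly: "fin_supp a \<Longrightarrow> fa_of (Ncpoly a) = a"
  by (simp add: Ncpoly_inverse)

lemma fa_of_eq_iff: "fa_of x = fa_of y \<longleftrightarrow> x = y"
  by (simp add: fa_of_inject)

definition br :: "'a::ring_1 \<Rightarrow> 'a \<Rightarrow> 'a" where "br x y = x * y - y * x"

lemma fa_comm_fa_of: "fa_comm (fa_of x) (fa_of y) = fa_of (br x y)"
  by (simp add: br_def fa_comm_def minus_ncpoly.rep_eq times_ncpoly.rep_eq)

lemma fa_pow_fa_of: "fa_pow (fa_of x) t = fa_of (x ^ t)"
  by (induction t) (simp_all add: one_ncpoly.rep_eq times_ncpoly.rep_eq)

definition divpow :: "ncpoly \<Rightarrow> nat \<Rightarrow> ncpoly" where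
  "divpow x t = scale (1 / fact t) (x ^ t)"

lemma fa_divpow_fa_of: "fa_divpow (fa_of x) t = fa_of (divpow x t)"
  by (simp add: divpow_def fa_divpow_def fa_pow_fa_of scale.rep_eq)

lemma fa_prod_list_fa_of: "fa_prod_list (map fa_of xs) = fa_of (prod_list xs)"
  by (induction xs) (simp_all add: fa_prod_list_def one_ncpoly.rep_eq times_ncpoly.rep_eq)

definition rootv :: "(nat \<times> nat) \<times> nat \<Rightarrow> ncpoly" where
  "rootv x = foldl (\<lambda>a k. br a (egen k 0)) (egen (fst (fst x)) (snd x)) [Suc (fst (fst x))..<Suc (snd (fst x))]"

lemma root_vec_fa_of: "root_vec \<beta> r = fa_of (rootv (\<beta>, r))"
proof -
  have "foldl (\<lambda>a k. fa_comm a (fa_gen k 0)) (fa_of x) ks = fa_of (foldl (\<lambda>a k. br a (egen k 0)) x ks)" for x ks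
    by (induction ks arbitrary: x) (simp_all add: egen.rep_eq[symmetric] fa_comm_fa_of)
  then show ?thesis by (simp add: root_vec_def rootv_def egen.rep_eq[symmetric])
qed

lemma rootv_simple: "rootv ((i, i), r) = egen i r"
  by (simp add: rootv_def)

lemma rootv_Suc: "i \<le> j \<Longrightarrow> rootv ((i, Suc j), r) = br (rootv ((i, j), r)) (egen (Suc j) 0)"
  by (simp add: rootv_def)

section \<open>The Yangian ideal inside the ring \<open>ncpoly\<close>, and Z[1/2]-spans\<close>

definition yideal :: "nat \<Rightarrow> ncpoly set" where "yideal n = {x. fa_of x \<in> yangian_ideal n}"

lemma yideal_0: "0 \<in> yideal n"
  by (simp add: yideal_def zero_ncpoly.rep_eq yangian_ideal.zero)
lemma yideal_add: "x \<in> yideal n \<Longrightarrow> y \<in> yideal n \<Longrightarrow> x + y \<in> yideal n"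
  by (simp add: yideal_def plus_ncpoly.rep_eq yangian_ideal.add)
lemma yideal_lmult: "x \<in> yideal n \<Longrightarrow> a * x \<in> yideal n"
  using fa_of[of a] by (simp add: yideal_def times_ncpoly.rep_eq yangian_ideal.lmult)
lemma yideal_rmult: "x \<in> yideal n \<Longrightarrow> x * a \<in> yideal n"
  using fa_of[of a] by (simp add: yideal_def times_ncpoly.rep_eq yangian_ideal.rmult)
lemma yideal_scale: "x \<in> yideal n \<Longrightarrow> scale c x \<in> yideal n"
  using yideal_lmult[of x n "scale c 1"] by (simp add: scale_mult_left)
lemma yideal_uminus: "x \<in> yideal n \<Longrightarrow> - x \<in> yideal n"
  using yideal_scale[of x n "-1"] by (simp add: scale_minus_left)
lemma yideal_diff: "x \<in> yideal n \<Longrightarrow> y \<in> yideal n \<Longrightarrow> x - y \<in> yideal n"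
  using yideal_add[of x n "- y"] by (simp add: yideal_uminus)
lemma yideal_half: "x + x \<in> yideal n \<Longrightarrow> x \<in> yideal n"
  using yideal_scale[of "x + x" n "1/2"] scale_add_left[of "1/2" "1/2" x] by (simp add: scale_add_right)
lemma yideal_br1: "x \<in> yideal n \<Longrightarrow> br x y \<in> yideal n"
  by (simp add: br_def yideal_diff yideal_lmult yideal_rmult)
lemma yideal_br2: "x \<in> yideal n \<Longrightarrow> br y x \<in> yideal n"
  by (simp add: br_def yideal_diff yideal_lmult yideal_rmult)

lemma br_minus: "br x y = - br y x" by (simp add: br_def)

lemma yideal_br_swap: "br x y \<in> yideal n \<Longrightarrow> br y x \<in> yideal n"
  using yideal_uminus[of "br x y" n] by (simp add: br_minus[of y x])

lemma yrel_quad: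
  assumes "i \<in> Iset n" "j \<in> Iset n"
  shows "br (egen i (Suc r)) (egen j s) - br (egen i r) (egen j (Suc s))
    - scale (of_int (cartan i j) / 2) (egen i r * egen j s + egen j s * egen i r) \<in> yideal n"
proof -
  have "fa_of (br (egen i (Suc r)) (egen j s) - br (egen i r) (egen j (Suc s))
    - scale (of_int (cartan i j) / 2) (egen i r * egen j s + egen j s * egen i r)) \<in> yangian_rels n"
    unfolding yangian_rels_def minus_ncpoly.rep_eq plus_ncpoly.rep_eq times_ncpoly.rep_eq scale.rep_eq
        fa_comm_fa_of[symmetric] egen.rep_eq Suc_eq_plus1 using assms by blast
  then show ?thesis by (simp add: yideal_def yangian_ideal.rel)
qed

lemma yrel_comm:
  assumes "i \<in> Iset n" "j \<in> Iset n" "cartan i j = 0"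
  shows "br (egen i r) (egen j s) \<in> yideal n"
proof -
  have "fa_of (br (egen i r) (egen j s)) \<in> yangian_rels n"
    unfolding yangian_rels_def fa_comm_fa_of[symmetric] egen.rep_eq using assms by blast
  then show ?thesis by (simp add: yideal_def yangian_ideal.rel)
qed

lemma yrel_serre:
  assumes "i \<in> Iset n" "j \<in> Iset n" "cartan i j = -1"
  shows "br (egen i r) (br (egen i r') (egen j s)) + br (egen i r') (br (egen i r) (egen j s)) \<in> yideal n"
proof -
  have "fa_of (br (egen i r) (br (egen i r') (egen j s)) + br (egen i r') (br (egen i r) (egen j s)))
     \<in> yangian_rels n"
    unfolding yangian_rels_def plus_ncpoly.rep_eq fa_comm_fa_of[symmetric] egen.rep_eq using assms by blast
  then show ?thesis by (simp add: yideal_def yangian_ideal.rel)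
qed

text \<open>Coefficients are kept in Z[1/2], since general complex scalars do not pass through the
  tensor product. Halving stays possible, which the antisymmetry arguments below rely on.\<close>

inductive_set zspan :: "ncpoly set \<Rightarrow> ncpoly set" for B where
  zero: "0 \<in> zspan B"
| base: "x \<in> B \<Longrightarrow> x \<in> zspan B"
| add: "x \<in> zspan B \<Longrightarrow> y \<in> zspan B \<Longrightarrow> x + y \<in> zspan B"
| scale: "x \<in> zspan B \<Longrightarrow> scale (zhalf z m) x \<in> zspan B"

lemma zspan_uminus: "x \<in> zspan B \<Longrightarrow> - x \<in> zspan B"
  using zspan.scale[of x B "-1" 0] by (simp add: zhalf_def scale_minus_left)
lemma zspan_diff: "x \<in> zspan B \<Longrightarrow> y \<in> zspan B \<Longrightarrow> x - y \<in> zspan B"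
  using zspan.add[of x B "- y"] by (simp add: zspan_uminus)
lemma zspan_half: "x + x \<in> zspan B \<Longrightarrow> x \<in> zspan B"
  using zspan.scale[of "x + x" B 1 1] scale_add_left[of "1/2" "1/2" x]
  by (simp add: zhalf_def scale_add_right)

lemma zspan_mult:
  assumes "x \<in> zspan A" "y \<in> zspan B" "\<And>a b. a \<in> A \<Longrightarrow> b \<in> B \<Longrightarrow> a * b \<in> zspan C"
  shows "x * y \<in> zspan C"
  using assms(1)
proof (induction x rule: zspan.induct)
  case (base x)
  show ?case using assms(2)
    by (induction y rule: zspan.induct)
      (auto intro: zspan.intros assms(3) base simp: distrib_left scale_mult_right)
qed (auto intro: zspan.intros simp: distrib_right scale_mult_left)

section \<open>Straightening\<close>

lemma br_add_left: "br (x + y) z = br x z + br y z" by (simp add: br_def algebra_simps)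
lemma br_scale_left: "br (scale c x) z = scale c (br x z)"
  by (simp add: br_def scale_mult_left scale_mult_right scale_diff_right)

definition wprod :: "word \<Rightarrow> ncpoly" where "wprod w = prod_list (map (\<lambda>(i, r). egen i r) w)"

text \<open>The bound is strict: \<open>filt n 0\<close> is just the ideal.\<close>

definition filt :: "nat \<Rightarrow> nat \<Rightarrow> ncpoly set" where
  "filt n d = zspan (yideal n \<union>
     {wprod w | w. set w \<subseteq> Iset n \<times> UNIV \<and> sum_list (map snd w) < d})"

lemma filt_ideal: "x \<in> yideal n \<Longrightarrow> x \<in> filt n d"
  unfolding filt_def by (auto intro: zspan.base)

lemma filt_word:
  "set w \<subseteq> Iset n \<times> UNIV \<Longrightarrow> sum_list (map snd w) < d \<Longrightarrow> wprod w \<in> filt n d"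
  unfolding filt_def by (rule zspan.base) blast

lemma filt_add: "x \<in> filt n d \<Longrightarrow> y \<in> filt n d \<Longrightarrow> x + y \<in> filt n d"
  unfolding filt_def by (rule zspan.add)
lemma filt_diff: "x \<in> filt n d \<Longrightarrow> y \<in> filt n d \<Longrightarrow> x - y \<in> filt n d"
  unfolding filt_def by (rule zspan_diff)
lemma filt_uminus: "x \<in> filt n d \<Longrightarrow> - x \<in> filt n d"
  unfolding filt_def by (rule zspan_uminus)
lemma filt_half: "x + x \<in> filt n d \<Longrightarrow> x \<in> filt n d"
  unfolding filt_def by (rule zspan_half)

text \<open>Strict bounds mean degrees at most \<open>a - 1\<close> and \<open>b - 1\<close>, hence
  the shift by one. Truncated subtraction does no harm: if \<open>a\<close> or \<open>b\<close> is
  0, that factor lies in the ideal.\<close>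

lemma filt_mult: "x \<in> filt n a \<Longrightarrow> y \<in> filt n b \<Longrightarrow> x * y \<in> filt n (a + b - 1)"
proof -
  assume x: "x \<in> filt n a" and y: "y \<in> filt n b"
  show ?thesis
    unfolding filt_def[of n "a + b - 1"]
  proof (rule zspan_mult[OF x[unfolded filt_def] y[unfolded filt_def]], fold filt_def)
    let ?W = "\<lambda>d. yideal n \<union> {wprod w | w. set w \<subseteq> Iset n \<times> UNIV \<and> sum_list (map snd w) < d}"
    fix u v assume u: "u \<in> ?W a" and v: "v \<in> ?W b"
    show "u * v \<in> filt n (a + b - 1)"
    proof (cases "u \<in> yideal n \<or> v \<in> yideal n")
      case True
      then show ?thesis by (auto intro: filt_ideal yideal_lmult yideal_rmult)
    next
      case False
      then obtain w w' where "u = wprod w" "set w \<subseteq> Iset n \<times> UNIV" "sum_list (map snd w) < a"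
        "v = wprod w'" "set w' \<subseteq> Iset n \<times> UNIV" "sum_list (map snd w') < b"
        using u v by blast
      then show ?thesis using filt_word[of "w @ w'" n "a + b - 1"] by (auto simp: wprod_def)
    qed
  qed
qed

lemma filt_br_left: "x \<in> filt n a \<Longrightarrow> y \<in> filt n (Suc b) \<Longrightarrow> br x y \<in> filt n (a + b)"
  using filt_mult[of x n a y "Suc b"] filt_mult[of y n "Suc b" x a]
  by (simp add: br_def filt_diff add.commute)

lemma filt_br_right: "x \<in> filt n (Suc a) \<Longrightarrow> y \<in> filt n b \<Longrightarrow> br x y \<in> filt n (a + b)"
  using filt_br_left[of y n b x a] filt_uminus by (simp add: br_minus[of x y] add.commute)

lemma filt_egen: "i \<in> Iset n \<Longrightarrow> egen i r \<in> filt n (Suc r)"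
  using filt_word[of "[(i, r)]" n "Suc r"] by (simp add: wprod_def)

text \<open>Both brackets have loop degree \<open>r + s + 1\<close>, the anticommutator in the
  defining relation only \<open>r + s\<close>, and its coefficient \<open>c_ij / 2\<close> lies in
  Z[1/2].\<close>

lemma filt_quad:
  assumes "i \<in> Iset n" "j \<in> Iset n"
  shows "br (egen i (Suc r)) (egen j s) - br (egen i r) (egen j (Suc s)) \<in> filt n (Suc (r + s))"
proof -
  let ?c = "egen i r * egen j s + egen j s * egen i r"
  have "?c \<in> filt n (Suc (r + s))"
    using filt_mult[OF filt_egen[OF assms(1)] filt_egen[OF assms(2)], of r s]
      filt_mult[OF filt_egen[OF assms(2)] filt_egen[OF assms(1)], of s r]
    by (simp add: filt_add add.commute)
  then have "scale (zhalf (cartan i j) 1) ?c \<in> filt n (Suc (r + s))"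
    unfolding filt_def by (rule zspan.scale)
  from filt_add[OF filt_ideal[OF yrel_quad[OF assms, of r s], of "Suc (r + s)"] this]
  show ?thesis by (simp add: zhalf_def)
qed

lemma filt_shift:
  assumes "i \<in> Iset n" "j \<in> Iset n"
  shows "br (egen i r) (egen j s) - br (egen i (r + s)) (egen j 0) \<in> filt n (r + s)"
proof (induction s arbitrary: r)
  case 0
  show ?case by (simp add: filt_ideal yideal_0)
next
  case (Suc s)
  have "(br (egen i (Suc r)) (egen j s) - br (egen i (Suc r + s)) (egen j 0)) -
     (br (egen i (Suc r)) (egen j s) - br (egen i r) (egen j (Suc s))) \<in> filt n (Suc (r + s))"
    by (rule filt_diff[OF _ filt_quad[OF assms]]) (use Suc[of "Suc r"] in simp)
  then show ?case by simp
qed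

text \<open>Both \<open>[e_ir, e_is]\<close> and \<open>[e_is, e_ir]\<close> agree with
  \<open>[e_i(r+s), e_i0]\<close> modulo lower degree; by antisymmetry twice the bracket is of lower
  degree.\<close>

lemma filt_same:
  assumes "i \<in> Iset n"
  shows "br (egen i r) (egen i s) \<in> filt n (r + s)"
proof (rule filt_half)
  have "(br (egen i r) (egen i s) - br (egen i (r + s)) (egen i 0)) -
    (br (egen i s) (egen i r) - br (egen i (s + r)) (egen i 0)) \<in> filt n (r + s)"
    by (rule filt_diff[OF filt_shift[OF assms assms, of r s]])
      (use filt_shift[OF assms assms, of s r] in \<open>simp add: add.commute\<close>)
  then show "br (egen i r) (egen i s) + br (egen i r) (egen i s) \<in> filt n (r + s)"
    by (simp add: br_minus[of "egen i s" "egen i r"] add.commute)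
qed

section \<open>Brackets of root vectors with generators modulo lower loop degree\<close>

lemma rootv_filt: "i \<le> j \<Longrightarrow> (i, j) \<in> pos_roots n \<Longrightarrow> rootv ((i, j), r) \<in> filt n (Suc r)"
proof (induction j rule: dec_induct)
  case base
  then show ?case by (auto simp: rootv_simple pos_roots_def Iset_def intro: filt_egen)
next
  case (step m)
  then have "rootv ((i, m), r) \<in> filt n (Suc r)" "egen (Suc m) 0 \<in> filt n (Suc 0)"
    by (auto simp: pos_roots_def Iset_def intro: filt_egen)
  from filt_br_left[OF this] step show ?case by (simp add: rootv_Suc)
qed

text \<open>Exact, without lower terms, because \<open>egen k s\<close> commutes with every
  generator occurring in the root vector.\<close>

lemma rootv_far:
  "i \<le> j \<Longrightarrow> (i, j) \<in> pos_roots n \<Longrightarrow> k \<in> Iset n \<Longrightarrow> k > Suc j \<or> Suc k < i \<Longrightarrow>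
    br (rootv ((i, j), r)) (egen k s) \<in> yideal n"
proof (induction j rule: dec_induct)
  case base
  then show ?case by (auto simp: rootv_simple pos_roots_def Iset_def cartan_def intro!: yrel_comm)
next
  case (step m)
  let ?A = "rootv ((i, m), r)" and ?b = "egen (Suc m) 0" and ?c = "egen k s"
  have "br ?A ?c \<in> yideal n" using step by (auto simp: pos_roots_def)
  moreover have "br ?b ?c \<in> yideal n" using step by (auto simp: pos_roots_def Iset_def cartan_def intro!: yrel_comm)
  moreover have "br (br ?A ?b) ?c = br (br ?A ?c) ?b + br ?A (br ?b ?c)" by (simp add: br_def algebra_simps)
  ultimately show ?case using step by (simp add: rootv_Suc yideal_add yideal_br1 yideal_br2)
qed

text \<open>The loop index of a root vector sits on its first generator. An index on the appended
  generator is passed one place to the left by \<open>filt_shift\<close>, while the part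
  \<open>rootv ((i, m), r)\<close> commutes with that generator; the induction hypothesis passes it
  on.\<close>

lemma rootv_next:
  "i \<le> j \<Longrightarrow> (i, Suc j) \<in> pos_roots n \<Longrightarrow>
    br (rootv ((i, j), r)) (egen (Suc j) s) - rootv ((i, Suc j), r + s) \<in> filt n (r + s)"
proof (induction j rule: dec_induct)
  case base
  then show ?case by (simp add: rootv_simple rootv_Suc pos_roots_def Iset_def filt_shift)
next
  case (step m)
  let ?A = "rootv ((i, m), r)" and ?b = "egen (Suc m) 0" and ?bs = "egen (Suc m) s"
    and ?c = "egen (Suc (Suc m)) 0" and ?cs = "egen (Suc (Suc m)) s" and ?R = "rootv ((i, Suc m), r + s)"
  have i: "(i, Suc m) \<in> pos_roots n" "(i, m) \<in> pos_roots n" "Suc (Suc m) \<in> Iset n" "Suc m \<in> Iset n"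
    using step by (auto simp: pos_roots_def Iset_def)
  have 1: "br ?A ?cs \<in> yideal n" "br ?A ?c \<in> yideal n"
    using i step(1) by (auto intro: rootv_far)
  have 2: "br ?b ?cs - br ?bs ?c \<in> filt n s"
    using filt_shift[OF i(4,3), of 0 s] by simp
  have 3: "br ?A (br ?b ?cs - br ?bs ?c) \<in> filt n (r + s)"
    using filt_br_right[OF rootv_filt[OF step(1) i(2)] 2] .
  have 4: "br (br ?A ?bs - ?R) ?c \<in> filt n (r + s)"
    using filt_br_left[OF step.IH[OF i(1)] filt_egen[OF i(3), of 0]] by simp
  have "br (br ?A ?b) ?cs - br ?R ?c = br (br ?A ?cs) ?b + br ?A (br ?b ?cs - br ?bs ?c)
      + br ?bs (br ?A ?c) + br (br ?A ?bs - ?R) ?c"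
    by (simp add: br_def algebra_simps)
  also have "\<dots> \<in> filt n (r + s)"
    by (intro filt_add 3 4 filt_ideal yideal_br1 yideal_br2 1)
  finally show ?case using step(1) by (simp add: rootv_Suc)
qed

lemma rootv_prev:
  "Suc i \<le> j \<Longrightarrow> (i, j) \<in> pos_roots n \<Longrightarrow>
    br (egen i s) (rootv ((Suc i, j), r)) - rootv ((i, j), r + s) \<in> filt n (r + s)"
proof (induction j rule: dec_induct)
  case base
  then show ?case using filt_shift[of i n "Suc i" s r]
    by (simp add: rootv_simple rootv_Suc pos_roots_def Iset_def add.commute)
next
  case (step m)
  let ?A = "rootv ((Suc i, m), r)" and ?e = "egen i s" and ?c = "egen (Suc m) 0" and ?R = "rootv ((i, m), r + s)"
  have i: "(i, m) \<in> pos_roots n" "i \<in> Iset n" "Suc m \<in> Iset n"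
    using step by (auto simp: pos_roots_def Iset_def)
  have 1: "br ?e ?c \<in> yideal n"
    using i step(1) by (auto intro!: yrel_comm simp: cartan_def)
  have 2: "br (br ?e ?A - ?R) ?c \<in> filt n (r + s)"
    using filt_br_left[OF step.IH[OF i(1)] filt_egen[OF i(3), of 0]] by simp
  have "br ?e (br ?A ?c) - br ?R ?c = br (br ?e ?A - ?R) ?c + br ?A (br ?e ?c)"
    by (simp add: br_def algebra_simps)
  also have "\<dots> \<in> filt n (r + s)"
    by (intro filt_add 2 filt_ideal yideal_br2 1)
  finally show ?case using step(1) by (simp add: rootv_Suc)
qed

text \<open>Bracketing with a generator of colour \<open>Suc m\<close> is a derivation that kills
  the part of the root vector ending before \<open>m\<close>, so the Serre relation between the
  neighbours \<open>m\<close> and \<open>Suc m\<close> carries over.\<close>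

lemma rootv_serre:
  assumes "i \<le> m" "(i, Suc m) \<in> pos_roots n"
  shows "br (egen (Suc m) s) (br (egen (Suc m) s') (rootv ((i, m), r)))
    + br (egen (Suc m) s') (br (egen (Suc m) s) (rootv ((i, m), r))) \<in> yideal n"
proof (cases "i = m")
  case True
  then show ?thesis using assms
    by (auto simp: rootv_simple pos_roots_def Iset_def cartan_def intro!: yrel_serre)
next
  case False
  then obtain m' where m': "m = Suc m'" "i \<le> m'" using assms(1) by (cases m) auto
  let ?A = "rootv ((i, m'), r)" and ?a = "egen m 0" and ?B = "egen (Suc m) s" and ?B' = "egen (Suc m) s'"
  have i: "(i, m') \<in> pos_roots n" "m \<in> Iset n" "Suc m \<in> Iset n"
    using assms m' by (auto simp: pos_roots_def Iset_def)
  have 1: "br ?B ?A \<in> yideal n" "br ?B' ?A \<in> yideal n"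
    using i m' by (auto intro!: yideal_br_swap[OF rootv_far])
  have 2: "br ?B (br ?B' ?a) + br ?B' (br ?B ?a) \<in> yideal n"
    using i by (auto intro!: yrel_serre simp: cartan_def)
  have "br ?B (br ?B' (br ?A ?a)) + br ?B' (br ?B (br ?A ?a)) =
    br ?B (br (br ?B' ?A) ?a) + br (br ?B ?A) (br ?B' ?a) +
    br ?B' (br (br ?B ?A) ?a) + br (br ?B' ?A) (br ?B ?a) +
    br ?A (br ?B (br ?B' ?a) + br ?B' (br ?B ?a))"
    by (simp add: br_def algebra_simps)
  also have "\<dots> \<in> yideal n"
    by (intro yideal_add yideal_br2[OF yideal_br1[OF 1(1)]] yideal_br2[OF yideal_br1[OF 1(2)]]
        yideal_br1[OF 1(1)] yideal_br1[OF 1(2)] yideal_br2[OF 2])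
  finally show ?thesis using m' by (simp add: rootv_Suc)
qed

text \<open>With \<open>A\<close> the shorter root vector, Serre kills the sum of
  \<open>[bs, [b, A]]\<close> and \<open>[b, [bs, A]]\<close>, while their difference is
  \<open>[[b, bs], A]\<close> up to sign and of lower degree by \<open>filt_same\<close>. Hence each
  of them is of lower degree, and the first is the bracket in question.\<close>

lemma rootv_last:
  assumes "i \<le> m" "(i, Suc m) \<in> pos_roots n"
  shows "br (rootv ((i, Suc m), r)) (egen (Suc m) s) \<in> filt n (r + s)"
proof (rule filt_half)
  let ?A = "rootv ((i, m), r)" and ?b = "egen (Suc m) 0" and ?bs = "egen (Suc m) s"
  have i: "(i, m) \<in> pos_roots n" "Suc m \<in> Iset n"
    using assms by (auto simp: pos_roots_def Iset_def)
  have 1: "br (br ?b ?bs) ?A \<in> filt n (r + s)"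
    using filt_br_left[OF filt_same[OF i(2), of 0 s] rootv_filt[OF assms(1) i(1)]] by (simp add: add.commute)
  have 2: "br ?bs (br ?b ?A) + br ?b (br ?bs ?A) \<in> filt n (r + s)"
    by (rule filt_ideal[OF rootv_serre[OF assms]])
  have "br (br ?A ?b) ?bs + br (br ?A ?b) ?bs = (br ?bs (br ?b ?A) + br ?b (br ?bs ?A)) - br (br ?b ?bs) ?A"
    by (simp add: br_def algebra_simps)
  also have "\<dots> \<in> filt n (r + s)" by (intro filt_diff 1 2)
  finally show "br (rootv ((i, Suc m), r)) ?bs + br (rootv ((i, Suc m), r)) ?bs \<in> filt n (r + s)"
    using assms by (simp add: rootv_Suc)
qed

text \<open>Mirror image of \<open>rootv_last\<close> for roots with two colours; longer roots
  follow because the further generators commute with colour \<open>i\<close>.\<close>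

lemma rootv_first:
  "Suc i \<le> j \<Longrightarrow> (i, j) \<in> pos_roots n \<Longrightarrow> br (rootv ((i, j), r)) (egen i s) \<in> filt n (r + s)"
proof (induction j rule: dec_induct)
  case base
  show ?case
  proof (rule filt_half)
    let ?a = "egen i r" and ?as = "egen i s" and ?c = "egen (Suc i) 0"
    have i: "i \<in> Iset n" "Suc i \<in> Iset n" using base by (auto simp: pos_roots_def Iset_def)
    have 1: "br (br ?a ?as) ?c \<in> filt n (r + s)"
      using filt_br_left[OF filt_same[OF i(1), of r s] filt_egen[OF i(2), of 0]] by simp
    have 2: "br ?a (br ?as ?c) + br ?as (br ?a ?c) \<in> filt n (r + s)"
      using i by (auto intro!: filt_ideal yrel_serre simp: cartan_def)
    have "br (br ?a ?c) ?as + br (br ?a ?c) ?as = br (br ?a ?as) ?c - (br ?a (br ?as ?c) + br ?as (br ?a ?c))"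
      by (simp add: br_def algebra_simps)
    also have "\<dots> \<in> filt n (r + s)" by (intro filt_diff 1 2)
    finally show "br (rootv ((i, Suc i), r)) ?as + br (rootv ((i, Suc i), r)) ?as \<in> filt n (r + s)"
      by (simp add: rootv_Suc rootv_simple)
  qed
next
  case (step m)
  let ?A = "rootv ((i, m), r)" and ?e = "egen i s" and ?c = "egen (Suc m) 0"
  have i: "(i, m) \<in> pos_roots n" "i \<in> Iset n" "Suc m \<in> Iset n"
    using step by (auto simp: pos_roots_def Iset_def)
  have 1: "br ?c ?e \<in> yideal n"
    using i step(1) by (auto intro!: yrel_comm simp: cartan_def)
  have 2: "br (br ?A ?e) ?c \<in> filt n (r + s)"
    using filt_br_left[OF step.IH[OF i(1)] filt_egen[OF i(3), of 0]] by simp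
  have "br (br ?A ?c) ?e = br (br ?A ?e) ?c + br ?A (br ?c ?e)"
    by (simp add: br_def algebra_simps)
  also have "\<dots> \<in> filt n (r + s)"
    by (intro filt_add 2 filt_ideal yideal_br2 1)
  finally show ?case using step(1) by (simp add: rootv_Suc)
qed

text \<open>The vanishing of \<open>[E\<^sub>1\<^sub>3, E\<^sub>2\<^sub>4]\<close> as a consequence of the Serre relations.\<close>

lemma serre_chain_comm:
  assumes "br a c \<in> yideal n" "br b (br b c) \<in> yideal n" "br b (br b a) \<in> yideal n"
  shows "br (br a b) (br b c) \<in> yideal n"
proof (rule yideal_half)
  have "br (br a b) (br b c) + br (br a b) (br b c) =
    br a (br b (br b c)) + br (br b (br b a)) c - br b (br b (br a c))"
    by (simp add: br_def algebra_simps)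
  also have "\<dots> \<in> yideal n"
    by (intro yideal_add yideal_diff yideal_br2[OF assms(2)] yideal_br1[OF assms(3)]
        yideal_br2[OF yideal_br2[OF assms(1)]])
  finally show "br (br a b) (br b c) + br (br a b) (br b c) \<in> yideal n" .
qed

text \<open>With \<open>a\<close>, \<open>b\<close>, \<open>c\<close> as the matrix units
  \<open>E_12\<close>, \<open>E_23\<close>, \<open>E_34\<close>, this is
  \<open>[E_13, E_14] = 0\<close>, obtained from \<open>[E_13, E_24] = 0\<close> by bracketing with
  \<open>a\<close>.\<close>

lemma serre_chain_last:
  assumes "br a c \<in> yideal n" "br b (br b c) \<in> yideal n" "br b (br b a) \<in> yideal n" "br a (br a b) \<in> yideal n"
  shows "br (br a b) (br (br a b) c) \<in> yideal n"
proof -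
  have "br (br a b) (br (br a b) c) = br a (br (br a b) (br b c)) - br (br a (br a b)) (br b c)
     - br (br a b) (br b (br a c))"
    by (simp add: br_def algebra_simps)
  also have "\<dots> \<in> yideal n"
    by (intro yideal_diff yideal_br2[OF serre_chain_comm[OF assms(1-3)]] yideal_br1[OF assms(4)]
        yideal_br2[OF yideal_br2[OF assms(1)]])
  finally show ?thesis .
qed

lemma rootv_mid:
  "Suc (Suc k) \<le> j \<Longrightarrow> i \<le> k \<Longrightarrow> (i, j) \<in> pos_roots n \<Longrightarrow> br (rootv ((i, j), r)) (egen (Suc k) s) \<in> filt n (r + s)"
proof (induction j rule: dec_induct)
  case base
  let ?A = "rootv ((i, k), r)" and ?b = "egen (Suc k) 0" and ?bs = "egen (Suc k) s"
    and ?c = "egen (Suc (Suc k)) 0" and ?cs = "egen (Suc (Suc k)) s"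
  have i: "(i, Suc k) \<in> pos_roots n" "Suc k \<in> Iset n" "Suc (Suc k) \<in> Iset n" "(i, k) \<in> pos_roots n"
    using base by (auto simp: pos_roots_def Iset_def)
  have 1: "br (br (br ?A ?b) ?bs) ?c \<in> filt n (r + s)"
    using filt_br_left[OF rootv_last[OF base(1) i(1), of r s] filt_egen[OF i(3), of 0]] base(1)
    by (simp add: rootv_Suc)
  have 2: "br ?b ?cs - br ?bs ?c \<in> filt n s"
    using filt_shift[OF i(2,3), of 0 s] by simp
  have "br ?A ?b \<in> filt n (Suc r)"
    using rootv_filt[OF _ i(1)] base(1) by (simp add: rootv_Suc)
  from filt_br_right[OF this 2]
  have 3: "br (br ?A ?b) (br ?b ?cs - br ?bs ?c) \<in> filt n (r + s)" .
  \<comment> \<open>The loop index has been moved from \<open>?bs\<close> to \<open>?cs\<close>, so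
    both brackets contain the same \<open>?b\<close> and the relation
    \<open>[E_13, E_24] = 0\<close> applies exactly.\<close>
  have 4: "br (br ?A ?b) (br ?b ?cs) \<in> yideal n"
  proof (rule serre_chain_comm)
    show "br ?A ?cs \<in> yideal n" using base i by (intro rootv_far) auto
    show "br ?b (br ?b ?cs) \<in> yideal n"
      by (rule yideal_half, rule yrel_serre) (auto simp: i cartan_def)
    show "br ?b (br ?b ?A) \<in> yideal n"
      by (rule yideal_half, rule rootv_serre[OF base(1) i(1)])
  qed
  have "br (br (br ?A ?b) ?c) ?bs = br (br (br ?A ?b) ?bs) ?c + br (br ?A ?b) (br ?b ?cs - br ?bs ?c)
     - br (br ?A ?b) (br ?b ?cs)"
    by (simp add: br_def algebra_simps)
  also have "\<dots> \<in> filt n (r + s)" by (intro filt_add filt_diff 1 3 filt_ideal[OF 4])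
  finally show ?case using base(1) by (simp add: rootv_Suc)
next
  case (step m)
  let ?A = "rootv ((i, m), r)" and ?e = "egen (Suc k) s" and ?c = "egen (Suc m) 0"
  have i: "(i, m) \<in> pos_roots n" "Suc k \<in> Iset n" "Suc m \<in> Iset n"
    using step by (auto simp: pos_roots_def Iset_def)
  have 1: "br ?c ?e \<in> yideal n"
    using i step(1) by (auto intro!: yrel_comm simp: cartan_def)
  have 2: "br (br ?A ?e) ?c \<in> filt n (r + s)"
    using filt_br_left[OF step.IH[OF step.prems(1) i(1)] filt_egen[OF i(3), of 0]] by simp
  have "br (br ?A ?c) ?e = br (br ?A ?e) ?c + br ?A (br ?c ?e)"
    by (simp add: br_def algebra_simps)
  also have "\<dots> \<in> filt n (r + s)"
    by (intro filt_add 2 filt_ideal yideal_br2 1)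
  finally show ?case using step(1) step.prems by (simp add: rootv_Suc)
qed

text \<open>The target for brackets of total loop degree \<open>d\<close>: root vectors of that
  degree as leading part, everything of smaller degree as error.\<close>

definition lroot :: "nat \<Rightarrow> nat \<Rightarrow> ncpoly set" where
  "lroot n d = zspan (filt n d \<union> {rootv (\<beta>, d) | \<beta>. \<beta> \<in> pos_roots n})"

lemma lroot_filt: "x \<in> filt n d \<Longrightarrow> x \<in> lroot n d"
  unfolding lroot_def by (auto intro: zspan.base)
lemma lroot_rootv: "\<beta> \<in> pos_roots n \<Longrightarrow> rootv (\<beta>, d) \<in> lroot n d"
  unfolding lroot_def by (rule zspan.base) blast
lemma lroot_add: "x \<in> lroot n d \<Longrightarrow> y \<in> lroot n d \<Longrightarrow> x + y \<in> lroot n d"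
  unfolding lroot_def by (rule zspan.add)
lemma lroot_diff: "x \<in> lroot n d \<Longrightarrow> y \<in> lroot n d \<Longrightarrow> x - y \<in> lroot n d"
  unfolding lroot_def by (rule zspan_diff)

text \<open>At leading order this is the bracket table of the positive part of
  \<open>sl_n[t]\<close>: a root vector appears when \<open>k\<close> extends the interval at one
  end, and nothing in the other five positions of \<open>k\<close>.\<close>

lemma br_rootv_egen:
  assumes "(i, j) \<in> pos_roots n" "k \<in> Iset n"
  shows "br (rootv ((i, j), r)) (egen k s) \<in> lroot n (r + s)"
proof -
  have ij: "i \<le> j" using assms by (auto simp: pos_roots_def)
  consider "k > Suc j \<or> Suc k < i" | "k = Suc j" | "Suc k = i" | "k = i" "i = j" | "k = j" "i < j" | "k = i" "i < j"
    | "i < k" "k < j" using ij by linarith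
  then show ?thesis
  proof cases
    case 1
    then show ?thesis using rootv_far[OF ij assms] by (auto intro: lroot_filt filt_ideal)
  next
    case 2
    then have p: "(i, Suc j) \<in> pos_roots n" using assms by (auto simp: pos_roots_def Iset_def)
    from lroot_add[OF lroot_filt[OF rootv_next[OF ij p]] lroot_rootv[OF p]] 2
    show ?thesis by simp
  next
    case 3
    then have p: "(k, j) \<in> pos_roots n" "Suc k \<le> j" using assms ij by (auto simp: pos_roots_def Iset_def)
    from lroot_add[OF lroot_filt[OF rootv_prev[OF p(2,1)]] lroot_rootv[OF p(1)]] 3
    have "br (egen k s) (rootv ((i, j), r)) \<in> lroot n (r + s)" by simp
    from lroot_diff[OF lroot_filt[OF filt_ideal[OF yideal_0]] this]
    show ?thesis by (simp add: br_minus[of "rootv _"])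
  next
    case 4
    then show ?thesis using assms(2) by (auto simp: rootv_simple intro: lroot_filt filt_same)
  next
    case 5
    then obtain m where "j = Suc m" "i \<le> m" by (cases j) auto
    then show ?thesis using lroot_filt[OF rootv_last] assms 5 by simp
  next
    case 6
    then show ?thesis using lroot_filt[OF rootv_first] assms by simp
  next
    case 7
    then obtain m where "k = Suc m" "i \<le> m" by (cases k) auto
    then show ?thesis using lroot_filt[OF rootv_mid] assms 7 by simp
  qed
qed

lemma br_lroot_egen:
  assumes "x \<in> lroot n d" "k \<in> Iset n"
  shows "br x (egen k s) \<in> lroot n (d + s)"
  using assms(1) unfolding lroot_def[of n d]
proof (induction x rule: zspan.induct)
  case zero
  then show ?case by (simp add: br_def lroot_filt filt_ideal yideal_0)
next
  case (base x)
  then show ?case using br_rootv_egen[OF _ assms(2)] filt_br_left[OF _ filt_egen[OF assms(2)]]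
    by (auto intro: lroot_filt)
next
  case (add x y)
  then show ?case by (simp add: br_add_left lroot_add)
next
  case (scale x z m)
  then show ?case unfolding br_scale_left lroot_def by (auto intro: zspan.scale)
qed

text \<open>A root vector is an iterated bracket of generators and \<open>lroot\<close> is stable
  under bracketing with generators, so Jacobi gives an induction on the length of the second root.
  It needs \<open>x\<close> general, since \<open>br x ?e\<close> takes its place.\<close>

lemma br_lroot_rootv:
  "i \<le> j \<Longrightarrow> x \<in> lroot n d \<Longrightarrow> (i, j) \<in> pos_roots n \<Longrightarrow> br x (rootv ((i, j), s)) \<in> lroot n (d + s)"
proof (induction j arbitrary: x d rule: dec_induct)
  case base
  then show ?case by (auto simp: rootv_simple pos_roots_def Iset_def intro!: br_lroot_egen)
next
  case (step m)
  let ?A = "rootv ((i, m), s)" and ?e = "egen (Suc m) 0"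
  have i: "(i, m) \<in> pos_roots n" "Suc m \<in> Iset n" using step by (auto simp: pos_roots_def Iset_def)
  have "br (br x ?A) ?e \<in> lroot n (d + s)"
    using br_lroot_egen[OF step.IH[OF step.prems(1) i(1)] i(2), of 0] by simp
  moreover have "br (br x ?e) ?A \<in> lroot n (d + s)"
    using step.IH[OF br_lroot_egen[OF step.prems(1) i(2), of 0] i(1)] by simp
  moreover have "br x (br ?A ?e) = br (br x ?A) ?e - br (br x ?e) ?A" by (simp add: br_def algebra_simps)
  ultimately show ?case using step(1) by (simp add: rootv_Suc lroot_diff)
qed

section \<open>Straightening products of root vectors\<close>

definition rprod :: "((nat \<times> nat) \<times> nat) list \<Rightarrow> ncpoly" where "rprod xs = prod_list (map rootv xs)"

lemma rprod_append: "rprod (xs @ ys) = rprod xs * rprod ys" by (simp add: rprod_def)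
lemma rprod_Cons: "rprod (x # ys) = rootv x * rprod ys" by (simp add: rprod_def)

definition pbw_span :: "nat \<Rightarrow> ncpoly set" where
  "pbw_span n = zspan (yideal n \<union> {rprod ys | ys. fst ` set ys \<subseteq> pos_roots n \<and> sorted (map pbw_key ys)})"

lemma pbw_span_add: "x \<in> pbw_span n \<Longrightarrow> y \<in> pbw_span n \<Longrightarrow> x + y \<in> pbw_span n"
  unfolding pbw_span_def by (rule zspan.add)
lemma pbw_span_uminus: "x \<in> pbw_span n \<Longrightarrow> - x \<in> pbw_span n"
  unfolding pbw_span_def by (rule zspan_uminus)

lemma rprod_filt: "fst ` set xs \<subseteq> pos_roots n \<Longrightarrow> rprod xs \<in> filt n (Suc (sum_list (map snd xs)))"
proof (induction xs)
  case Nil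
  show ?case using filt_word[of "[]" n 1] by (simp add: rprod_def wprod_def)
next
  case (Cons x xs)
  obtain i j r where x: "x = ((i, j), r)" by (metis surj_pair)
  then have "rootv x \<in> filt n (Suc r)" using Cons.prems
    by (auto intro: rootv_filt simp: pos_roots_def)
  from filt_mult[OF this Cons.IH] Cons.prems x show ?case by (simp add: rprod_Cons)
qed

text \<open>The induction is on loop degree first, then on the number of factors. Exchanging
  neighbours costs a bracket: its leading part has the same degree and one factor fewer, its error
  has smaller degree but may consist of long words in the generators, which is why the degree must
  come first.\<close>

theorem rprod_in_pbw_span:
  "fst ` set xs \<subseteq> pos_roots n \<Longrightarrow> rprod xs \<in> pbw_span n"
proof (induction "(sum_list (map snd xs), length xs)" arbitrary: xs rule: less_induct)
  case less
  define d where "d = sum_list (map snd xs)"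
  have IH: "rprod ys \<in> pbw_span n"
    if "fst ` set ys \<subseteq> pos_roots n" "sum_list (map snd ys) < d \<or> sum_list (map snd ys) = d \<and> length ys < length xs" for ys
    using less.hyps[of ys] that by (auto simp: d_def)
  \<comment> \<open>A generator is the root vector of a simple root, so words of smaller degree are
    products of root vectors again and fall under the induction hypothesis.\<close>
  have low: "y \<in> pbw_span n" if "y \<in> filt n d" for y
    using that unfolding filt_def
  proof (induction y rule: zspan.induct)
    case (base x)
    show ?case
    proof (cases "x \<in> yideal n")
      case True
      then show ?thesis unfolding pbw_span_def by (auto intro: zspan.base)
    next
      case False
      then obtain w where w: "x = wprod w" "set w \<subseteq> Iset n \<times> UNIV" "sum_list (map snd w) < d"
        using base by blast
      let ?ys = "map (\<lambda>(i, r). ((i, i), r)) w"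
      have "rprod ?ys = x" unfolding w(1) rprod_def wprod_def
        by (auto intro!: arg_cong[of _ _ prod_list] simp: rootv_simple)
      moreover have "map snd ?ys = map snd w" by auto
      moreover have "fst ` set ?ys \<subseteq> pos_roots n" using w(2) by (force simp: Iset_def pos_roots_def)
      ultimately show ?thesis using IH[of ?ys] w(3) by metis
    qed
  qed (auto simp: pbw_span_def intro: zspan.intros)
  have mid: "rprod us * y * rprod vs \<in> pbw_span n"
    if y: "y \<in> lroot n e" and us: "fst ` set us \<subseteq> pos_roots n" "fst ` set vs \<subseteq> pos_roots n"
      and d: "d = sum_list (map snd us) + e + sum_list (map snd vs)" and l: "length us + length vs + 1 < length xs"
    for us vs y e
    using y unfolding lroot_def
  proof (induction y rule: zspan.induct)
    case (base x)
    show ?case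
    proof (cases "x \<in> filt n e")
      case True
      have "rprod us * x * rprod vs \<in> filt n d"
        using filt_mult[OF filt_mult[OF rprod_filt[OF us(1)] True] rprod_filt[OF us(2)]] by (simp add: d)
      then show ?thesis by (rule low)
    next
      case False
      then obtain \<beta> where "x = rootv (\<beta>, e)" "\<beta> \<in> pos_roots n" using base by auto
      moreover from this have "rprod (us @ (\<beta>, e) # vs) \<in> pbw_span n"
        using us d l by (intro IH) auto
      ultimately show ?thesis by (simp add: rprod_append rprod_Cons mult.assoc)
    qed
  qed (auto simp: pbw_span_def distrib_left distrib_right scale_mult_left scale_mult_right intro: zspan.intros)
  have swap: "rprod (us @ a # b # vs) - rprod (us @ b # a # vs) \<in> pbw_span n"
    if m: "mset (us @ a # b # vs) = mset xs" for us vs a b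
  proof -
    obtain i j s where b: "b = ((i, j), s)" by (metis surj_pair)
    obtain \<alpha> t where a: "a = (\<alpha>, t)" by (metis surj_pair)
    have s: "set xs = set (us @ a # b # vs)" using m by (metis set_mset_mset)
    have "sum_list (map snd xs) = sum_list (map snd (us @ a # b # vs))"
      using m by (metis mset_map sum_mset_sum_list)
    then have d: "d = sum_list (map snd us) + (t + s) + sum_list (map snd vs)"
      by (simp add: d_def a b)
    have l: "length xs = length (us @ a # b # vs)" using m by (metis size_mset)
    have p: "\<alpha> \<in> pos_roots n" "(i, j) \<in> pos_roots n" using less.prems s a b by auto
    have "br (rootv a) (rootv b) \<in> lroot n (t + s)"
      unfolding a b using p by (intro br_lroot_rootv lroot_rootv) (auto simp: pos_roots_def)
    from mid[OF this _ _ d] s l less.prems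
    have "rprod us * br (rootv a) (rootv b) * rprod vs \<in> pbw_span n" by auto
    then show ?thesis by (simp add: rprod_append rprod_Cons br_def algebra_simps)
  qed
  have move: "rprod (us @ ws @ a # vs) - rprod (us @ a # ws @ vs) \<in> pbw_span n"
    if "mset (us @ ws @ a # vs) = mset xs" for us ws vs a
    using that
  proof (induction ws arbitrary: us)
    case Nil
    then show ?case by (simp add: pbw_span_def zspan.zero)
  next
    case (Cons w ws)
    have "rprod ((us @ [w]) @ ws @ a # vs) - rprod ((us @ [w]) @ a # ws @ vs) \<in> pbw_span n"
      using Cons.prems by (intro Cons.IH) simp
    moreover have "rprod (us @ w # a # (ws @ vs)) - rprod (us @ a # w # (ws @ vs)) \<in> pbw_span n"
      using Cons.prems by (intro swap) simp
    ultimately show ?case using pbw_span_add by fastforce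
  qed
  have perm: "rprod (us @ ys) - rprod (us @ zs) \<in> pbw_span n"
    if "mset ys = mset zs" "mset (us @ ys) = mset xs" for us ys zs
    using that
  proof (induction ys arbitrary: us zs)
    case Nil
    then show ?case by (simp add: pbw_span_def zspan.zero)
  next
    case (Cons a ys)
    then have "a \<in> set zs" by (metis list.set_intros(1) set_mset_mset)
    then obtain z1 z2 where z: "zs = z1 @ a # z2" by (meson split_list)
    have 1: "rprod ((us @ [a]) @ ys) - rprod ((us @ [a]) @ z1 @ z2) \<in> pbw_span n"
      using Cons.prems z by (intro Cons.IH) auto
    have 2: "rprod (us @ z1 @ a # z2) - rprod (us @ a # z1 @ z2) \<in> pbw_span n"
      using Cons.prems z by (intro move) auto
    from pbw_span_add[OF 1 pbw_span_uminus[OF 2]] show ?case by (simp add: z)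
  qed
  let ?ys = "sort_key pbw_key xs"
  have "rprod ([] @ xs) - rprod ([] @ ?ys) \<in> pbw_span n" by (rule perm) auto
  moreover have "rprod ?ys \<in> pbw_span n"
    unfolding pbw_span_def using less.prems
    by (intro zspan.base UnI2 CollectI exI[of _ ?ys]) auto
  ultimately show ?case using pbw_span_add by fastforce
qed

section \<open>Divided powers of root vectors\<close>

definition yform :: "nat \<Rightarrow> ncpoly set" where "yform n = {x. fa_of x \<in> Yform_pre n}"

lemma yform_gen: "i \<in> Iset n \<Longrightarrow> divpow (egen i r) t \<in> yform n"
  using Yform_pre.gen[of i n r t] by (simp add: yform_def fa_divpow_fa_of[symmetric] egen.rep_eq)
lemma yform_1: "1 \<in> yform n"
  by (simp add: yform_def one_ncpoly.rep_eq Yform_pre.one)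
lemma yform_ideal: "x \<in> yideal n \<Longrightarrow> x \<in> yform n"
  by (simp add: yform_def yideal_def Yform_pre.ideal)
lemma yform_add: "x \<in> yform n \<Longrightarrow> y \<in> yform n \<Longrightarrow> x + y \<in> yform n"
  by (simp add: yform_def plus_ncpoly.rep_eq Yform_pre.add)
lemma yform_mult: "x \<in> yform n \<Longrightarrow> y \<in> yform n \<Longrightarrow> x * y \<in> yform n"
  by (simp add: yform_def times_ncpoly.rep_eq Yform_pre.mult)
lemma yform_scale: "x \<in> yform n \<Longrightarrow> scale (zhalf z m) x \<in> yform n"
  by (simp add: yform_def scale.rep_eq Yform_pre.smult)
lemma yform_0: "0 \<in> yform n" by (simp add: yform_ideal yideal_0)
lemma yform_sum: "(\<And>a. a \<in> A \<Longrightarrow> f a \<in> yform n) \<Longrightarrow> sum f A \<in> yform n"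
  by (induction A rule: infinite_finite_induct) (auto simp: yform_0 yform_add)
lemma yform_power: "x \<in> yform n \<Longrightarrow> x ^ t \<in> yform n"
  by (induction t) (auto simp: yform_1 yform_mult)
lemma yform_prod_list: "(\<And>x. x \<in> set xs \<Longrightarrow> x \<in> yform n) \<Longrightarrow> prod_list xs \<in> yform n"
  by (induction xs) (auto simp: yform_1 yform_mult)

lemma inverse_fact_Suc: "of_nat (Suc m) * (1 / fact (Suc m)) = (1 / fact m :: complex)"
  by (simp add: field_simps del: of_nat_Suc)

lemma divpow_Suc_left: "a * divpow a m = scale (of_nat (Suc m)) (divpow a (Suc m))"
  by (simp only: divpow_def scale_mult_right scale_scale inverse_fact_Suc power_Suc)

lemma divpow_Suc_right: "divpow a m * a = scale (of_nat (Suc m)) (divpow a (Suc m))"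
  by (simp only: divpow_def scale_mult_left scale_scale inverse_fact_Suc power_Suc power_commutes)

text \<open>The binomial expansion of \<open>ad(a)\<^sup>t / t!\<close> involves only divided powers of \<open>a\<close>.\<close>

lemma br_power_divpow:
  "(br a ^^ t) x = scale (fact t) (\<Sum>k\<le>t. scale ((-1) ^ k) (divpow a (t - k) * x * divpow a k))"
proof (induction t)
  case 0
  show ?case by (simp add: divpow_def)
next
  case (Suc t)
  define S where "S = (\<Sum>k\<le>t. scale ((-1) ^ k) (divpow a (t - k) * x * divpow a k))"
  define u where "u k = scale ((-1) ^ k) (divpow a (Suc t - k) * x * divpow a k)" for k
  have "a * S = (\<Sum>k\<le>t. scale (of_nat (Suc t - k)) (u k))"
    unfolding S_def sum_distrib_left
  proof (rule sum.cong[OF refl])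
    fix k assume "k \<in> {..t}"
    then have k: "Suc (t - k) = Suc t - k" by auto
    have "a * scale ((-1) ^ k) (divpow a (t - k) * x * divpow a k)
      = scale ((-1) ^ k) ((a * divpow a (t - k)) * x * divpow a k)"
      by (simp add: scale_mult_right mult.assoc)
    then show "a * scale ((-1) ^ k) (divpow a (t - k) * x * divpow a k) = scale (of_nat (Suc t - k)) (u k)"
      by (simp add: u_def divpow_Suc_left k scale_mult_left mult.commute del: of_nat_Suc)
  qed
  then have 1: "a * S = (\<Sum>k\<le>Suc t. scale (of_nat (Suc t - k)) (u k))" by simp
  have "S * a = (\<Sum>k\<le>t. - scale (of_nat (Suc k)) (u (Suc k)))"
    unfolding S_def sum_distrib_right
  proof (rule sum.cong[OF refl])
    fix k assume "k \<in> {..t}"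
    have "scale ((-1) ^ k) (divpow a (t - k) * x * divpow a k) * a
      = scale ((-1) ^ k) (divpow a (t - k) * x * (divpow a k * a))"
      by (simp add: scale_mult_left mult.assoc)
    then show "scale ((-1) ^ k) (divpow a (t - k) * x * divpow a k) * a = - scale (of_nat (Suc k)) (u (Suc k))"
      by (simp add: u_def divpow_Suc_right scale_mult_right scale_minus_left[symmetric] mult.commute del: of_nat_Suc)
  qed
  then have 2: "S * a = - (\<Sum>k\<le>Suc t. scale (of_nat k) (u k))"
    unfolding sum.atMost_Suc_shift by (simp add: sum_negf)
  have "br a S = (\<Sum>k\<le>Suc t. scale (of_nat (Suc t)) (u k))"
    unfolding br_def 1 2 diff_minus_eq_add sum.distrib[symmetric]
    by (rule sum.cong[OF refl]) (simp add: scale_add_left[symmetric] of_nat_diff)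
  then have "br a S = scale (of_nat (Suc t)) (\<Sum>k\<le>Suc t. u k)" by (simp only: scale_sum_right)
  moreover have "br a (scale (fact t) S) = scale (fact t) (br a S)"
    by (simp add: br_def scale_mult_left scale_mult_right scale_diff_right)
  ultimately have "(br a ^^ Suc t) x = scale (fact t) (scale (of_nat (Suc t)) (\<Sum>k\<le>Suc t. u k))"
    using Suc.IH by (simp only: funpow.simps o_apply S_def[symmetric])
  also have "\<dots> = scale (fact (Suc t)) (\<Sum>k\<le>Suc t. u k)"
    by (simp only: scale_scale fact_Suc mult.commute)
  finally show ?case by (simp only: u_def)
qed

text \<open>The Leibniz step behind \<open>[a, b^(m+1)] = (m+1) b^m c\<close> modulo the ideal, with
  \<open>B\<close> for \<open>b^m\<close> and \<open>q\<close> for \<open>m + 1\<close>; each of the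
  three terms on the right will lie in the ideal by itself.\<close>

lemma br_power_step1:
  assumes "B * b = b * B"
  shows "br a (b * B * b) - scale (1 + q) (b * B * c) =
    (br a (b * B) - scale q (B * c)) * b + b * B * (br a b - c) - scale q (B * br b c)"
proof -
  have "B * (b * z) = b * (B * z)" for z using assms by (simp add: mult.assoc[symmetric])
  then show ?thesis
    by (simp add: br_def algebra_simps scale_mult_left scale_mult_right scale_add_left scale_diff_right)
qed

lemma br_power_step2:
  "br a x - scale (q * s) (B * (c * C)) =
    br a (x - scale q (B' * C)) + scale q ((br a B' - scale s (B * c)) * C) + scale q (B' * br a C)"
  by (simp add: br_def algebra_simps scale_mult_left scale_mult_right scale_diff_right scale_add_right)

text \<open>Bracketing with \<open>a\<close> is a derivation that turns a factor \<open>b\<close>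
  into \<open>c\<close> and kills \<open>c\<close>, and \<open>c\<close> commutes with
  \<open>b\<close>. So \<open>k\<close> applications give
  \<open>t (t-1) ... (t-k+1) b^(t-k) c^k\<close>, and \<open>k = t\<close> leaves
  \<open>t! c^t\<close>.\<close>

lemma br_power_of_commuting:
  assumes bc: "br b c \<in> yideal n" and ac: "br a c \<in> yideal n" and ab: "br a b - c \<in> yideal n"
  shows "(br a ^^ t) (b ^ t) - scale (fact t) (c ^ t) \<in> yideal n"
proof -
  have c: "br a (c ^ k) \<in> yideal n" for k
  proof (induction k)
    case (Suc k)
    have "br a (c ^ Suc k) = br a c * c ^ k + c * br a (c ^ k)" by (simp add: br_def algebra_simps)
    then show ?case using Suc ac by (simp add: yideal_add yideal_lmult yideal_rmult)
  qed (simp add: br_def yideal_0)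
  have b: "br a (b ^ Suc m) - scale (of_nat (Suc m)) (b ^ m * c) \<in> yideal n" for m
  proof (induction m)
    case 0
    then show ?case using ab by simp
  next
    case (Suc m)
    have "br a (b ^ Suc (Suc m)) - scale (of_nat (Suc (Suc m))) (b ^ Suc m * c) =
      (br a (b ^ Suc m) - scale (of_nat (Suc m)) (b ^ m * c)) * b + b ^ Suc m * (br a b - c)
       - scale (of_nat (Suc m)) (b ^ m * br b c)"
      using br_power_step1[of "b ^ m" b a "of_nat (Suc m)" c] by (simp add: power_commutes mult.assoc)
    then show ?case using Suc ab bc
      by (simp only:) (intro yideal_add yideal_diff yideal_rmult[OF Suc] yideal_lmult[OF ab] yideal_scale yideal_lmult[OF bc])
  qed
  have "(br a ^^ k) (b ^ t) - scale (fact t / fact (t - k)) (b ^ (t - k) * c ^ k) \<in> yideal n" if "k \<le> t" for k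
    using that
  proof (induction k)
    case 0
    then show ?case by (simp add: yideal_0)
  next
    case (Suc k)
    define m where "m = t - Suc k"
    have m: "t - k = Suc m" using Suc.prems by (simp add: m_def)
    let ?x = "(br a ^^ k) (b ^ t)" and ?q = "fact t / fact (Suc m) :: complex"
    have IH: "?x - scale ?q (b ^ Suc m * c ^ k) \<in> yideal n" using Suc m by simp
    have "fact t / fact m = ?q * of_nat (Suc m)" by (simp del: of_nat_Suc)
    then have "br a ?x - scale (fact t / fact m) (b ^ m * c ^ Suc k) =
      br a (?x - scale ?q (b ^ Suc m * c ^ k)) + scale ?q ((br a (b ^ Suc m) - scale (of_nat (Suc m)) (b ^ m * c)) * c ^ k)
      + scale ?q (b ^ Suc m * br a (c ^ k))"
      using br_power_step2[of a ?x ?q "of_nat (Suc m)" "b ^ m" c "c ^ k" "b ^ Suc m"]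
      by (simp only: power_Suc)
    also have "\<dots> \<in> yideal n"
      by (intro yideal_add yideal_br2[OF IH] yideal_scale yideal_rmult[OF b] yideal_lmult[OF c])
    finally show ?case by (simp add: m_def)
  qed
  from this[of t] show ?thesis by simp
qed

text \<open>Computing \<open>ad(a)^t (b^t)\<close> in two ways, as \<open>t! t!\<close> times an
  alternating sum and as \<open>t! c^t\<close>, expresses \<open>c^t / t!\<close> for
  \<open>c = [a, b]\<close> as the sum of \<open>(-1)^k a^(t-k) b^(t) a^(k)\<close> in divided
  powers, modulo the ideal. This is a commutation formula of Kostant type.\<close>

lemma divpow_br_yform:
  assumes "br b (br a b) \<in> yideal n" "br a (br a b) \<in> yideal n"
    and a: "\<And>t. divpow a t \<in> yform n" and b: "\<And>t. divpow b t \<in> yform n"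
  shows "divpow (br a b) t \<in> yform n"
proof -
  let ?c = "br a b"
  let ?S = "\<Sum>k\<le>t. scale ((-1) ^ k) (divpow a (t - k) * divpow b t * divpow a k)"
  have "(br a ^^ t) (b ^ t) = scale (fact t) (scale (fact t) ?S)"
    unfolding br_power_divpow
    by (auto intro!: arg_cong[of _ _ "scale (fact t)"] sum.cong
        simp: divpow_def[of b] scale_sum_right scale_mult_right scale_mult_left mult.commute)
  moreover have "(br a ^^ t) (b ^ t) - scale (fact t) (?c ^ t) \<in> yideal n"
    by (rule br_power_of_commuting) (use assms yideal_0 in auto)
  ultimately have "scale (- 1 / (fact t * fact t)) (scale (fact t) (scale (fact t) ?S) - scale (fact t) (?c ^ t)) \<in> yideal n"
    by (simp only: yideal_scale)
  then have "divpow ?c t - ?S \<in> yideal n"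
    by (simp add: scale_diff_right divpow_def scale_minus_left field_simps)
  moreover have "?S \<in> yform n"
  proof (rule yform_sum)
    fix k
    have "scale (zhalf ((-1) ^ k) 0) (divpow a (t - k) * divpow b t * divpow a k) \<in> yform n"
      by (intro yform_scale yform_mult a b)
    then show "scale ((-1) ^ k) (divpow a (t - k) * divpow b t * divpow a k) \<in> yform n"
      by (simp add: zhalf_def)
  qed
  ultimately show ?thesis using yform_add[OF yform_ideal] by fastforce
qed

text \<open>Supplies the hypothesis of \<open>divpow_br_yform\<close> that \<open>a\<close> commutes
  with \<open>[a, b]\<close>. Equal loop indices make the commutation exact, as that formula
  requires.\<close>

lemma rootv_succ_comm:
  "i \<le> j \<Longrightarrow> (i, Suc j) \<in> pos_roots n \<Longrightarrow> br (rootv ((i, j), r)) (rootv ((i, Suc j), r)) \<in> yideal n"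
proof (induction j rule: dec_induct)
  case base
  have "br (egen i r) (br (egen i r) (egen (Suc i) 0)) \<in> yideal n"
    by (rule yideal_half, rule yrel_serre) (use base in \<open>auto simp: pos_roots_def Iset_def cartan_def\<close>)
  then show ?case by (simp add: rootv_simple rootv_Suc)
next
  case (step m)
  have i: "(i, Suc m) \<in> pos_roots n" "(i, m) \<in> pos_roots n" "Suc (Suc m) \<in> Iset n" "Suc m \<in> Iset n"
    using step by (auto simp: pos_roots_def Iset_def)
  let ?a = "rootv ((i, m), r)" and ?b = "egen (Suc m) 0" and ?c = "egen (Suc (Suc m)) 0"
  have "br (br ?a ?b) (br (br ?a ?b) ?c) \<in> yideal n"
  proof (rule serre_chain_last)
    show "br ?a ?c \<in> yideal n" using i step(1) by (intro rootv_far) auto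
    show "br ?b (br ?b ?c) \<in> yideal n" 
      by (rule yideal_half, rule yrel_serre) (use i in \<open>auto simp: cartan_def\<close>)
    show "br ?b (br ?b ?a) \<in> yideal n" 
      by (rule yideal_half, rule rootv_serre[OF step(1) i(1)])
    show "br ?a (br ?a ?b) \<in> yideal n" using step.IH[OF i(1)] step(1) by (simp add: rootv_Suc)
  qed
  then show ?case using step(1) by (simp add: rootv_Suc)
qed

lemma divpow_rootv_yform:
  "i \<le> j \<Longrightarrow> (i, j) \<in> pos_roots n \<Longrightarrow> divpow (rootv ((i, j), r)) t \<in> yform n"
proof (induction j arbitrary: t rule: dec_induct)
  case base
  then show ?case by (auto simp: rootv_simple pos_roots_def Iset_def intro: yform_gen)
next
  case (step m)
  have i: "(i, m) \<in> pos_roots n" "Suc m \<in> Iset n"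
    using step by (auto simp: pos_roots_def Iset_def)
  let ?a = "rootv ((i, m), r)" and ?b = "egen (Suc m) 0"
  have "br ?b (br ?a ?b) = - br ?b (br ?b ?a)" by (simp add: br_def algebra_simps)
  moreover have "br ?b (br ?b ?a) \<in> yideal n"

    by (rule yideal_half, rule rootv_serre[OF step(1) step.prems])
  ultimately have "br ?b (br ?a ?b) \<in> yideal n" by (simp add: yideal_uminus)
  moreover have "br ?a (br ?a ?b) \<in> yideal n"
    using rootv_succ_comm[OF step(1) step.prems] step(1) by (simp add: rootv_Suc)
  ultimately have "divpow (br ?a ?b) t \<in> yform n"
    by (rule divpow_br_yform) (use step.IH[OF i(1)] yform_gen[OF i(2)] in auto)
  then show ?case using step(1) by (simp add: rootv_Suc)
qed

lemma divpow_rootv_yform': "fst x \<in> pos_roots n \<Longrightarrow> divpow (rootv x) t \<in> yform n"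
  by (cases x) (auto simp: pos_roots_def intro!: divpow_rootv_yform)

lemma rootv_yform: "fst x \<in> pos_roots n \<Longrightarrow> rootv x \<in> yform n"
  using divpow_rootv_yform'[of x n 1] by (simp add: divpow_def)

lemma rprod_yform: "fst ` set xs \<subseteq> pos_roots n \<Longrightarrow> rprod xs \<in> yform n"
  unfolding rprod_def by (auto intro!: yform_prod_list rootv_yform dest!: subsetD simp: image_subset_iff)

section \<open>Multiplicity functions and sorted lists\<close>

definition hlist :: "((nat \<times> nat) \<times> nat \<Rightarrow> nat) \<Rightarrow> ((nat \<times> nat) \<times> nat) list" where
  "hlist h = concat (map (\<lambda>x. replicate (h x) x) (supp_list h))"

lemma prod_list_power_rprod:
  "prod_list (map (\<lambda>x. rootv x ^ h x) xs) = rprod (concat (map (\<lambda>x. replicate (h x) x) xs))"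
  by (induction xs) (simp_all add: rprod_def)

lemma E_mon_rprod: "E_mon h = fa_of (rprod (hlist h))"
proof -
  have "E_mon h = fa_prod_list (map fa_of (map (\<lambda>x. rootv x ^ h x) (supp_list h)))"
    by (simp add: E_mon_def root_vec_fa_of fa_pow_fa_of o_def)
  then show ?thesis by (simp only: fa_prod_list_fa_of prod_list_power_rprod hlist_def)
qed

lemma supp_list_props:
  assumes "finite {x. h x \<noteq> 0}"
  shows "set (supp_list h) = {x. h x \<noteq> 0}" "distinct (supp_list h)" "sorted (map pbw_key (supp_list h))"
  using assms by (auto simp: supp_list_def)

lemma count_concat_replicate:
  "distinct xs \<Longrightarrow> count (mset (concat (map (\<lambda>x. replicate (h x) x) xs))) y = (if y \<in> set xs then h y else 0)"
  by (induction xs) auto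

lemma sorted_concat_replicate:
  "sorted (map f xs) \<Longrightarrow> sorted (map f (concat (map (\<lambda>x. replicate (h x) x) xs)))"
  by (induction xs) (auto simp: sorted_append)

lemma count_hlist: "finite {x. h x \<noteq> 0} \<Longrightarrow> count (mset (hlist h)) = h"
  by (rule ext) (simp add: hlist_def count_concat_replicate supp_list_props)

lemma set_hlist: "finite {x. h x \<noteq> 0} \<Longrightarrow> set (hlist h) = {x. h x \<noteq> 0}"
  by (auto simp: hlist_def supp_list_props)

lemma inj_pbw_key: "inj pbw_key"
  by (auto simp: inj_def pbw_key_def prod_eq_iff)

text \<open>Since \<open>pbw_key\<close> is injective, a multiset has only one sorted listing; hence
  the sorted products left by straightening are monomials \<open>E_mon h\<close>.\<close>

lemma hlist_count:
  assumes "sorted (map pbw_key ys)"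
  shows "hlist (count (mset ys)) = ys"
proof -
  let ?h = "count (mset ys)"
  have fin: "finite {x. ?h x \<noteq> 0}" by (rule finite_subset[of _ "set ys"]) (auto simp: count_eq_zero_iff)
  have m: "mset (hlist ?h) = mset ys" using count_hlist[OF fin] by (simp add: multiset_eq_iff)
  have s: "sorted (map pbw_key (hlist ?h))"
    unfolding hlist_def by (rule sorted_concat_replicate) (simp add: supp_list_props fin)
  have i: "inj_on pbw_key (set (hlist ?h))" using inj_pbw_key by (rule inj_on_subset) simp
  from sort_key_inj_key_eq[OF m i assms] sort_key_inj_key_eq[OF refl i s] show ?thesis by simp
qed

section \<open>Spanning in the tensor product\<close>

text \<open>Worded like the last conjunct of the theorem, so that spanning becomes membership in
  this set. The next lemmas show that it is a subspace containing the relations.\<close>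

definition espan :: "nat \<Rightarrow> nat \<Rightarrow> (fa \<Rightarrow> 'k::field) set" where
  "espan n p = {u. \<exists>H (c :: ((nat \<times> nat) \<times> nat \<Rightarrow> nat) \<Rightarrow> 'k).
          finite H \<and> (\<forall>h\<in>H. admissible_h n p h) \<and>
          (\<lambda>x. u x - (\<Sum>h\<in>H. c h * delta (E_mon h) x)) \<in> tensor_rels n}"

lemma espan_tensor: "u \<in> tensor_rels n \<Longrightarrow> u \<in> espan n p"
  unfolding espan_def by (auto intro!: exI[of _ "{}"])

lemma espan_E: "admissible_h n p h \<Longrightarrow> delta (E_mon h) \<in> espan n p"
  unfolding espan_def using tensor_rels.zero by (auto intro!: exI[of _ "{h}"] exI[of _ "\<lambda>_. 1"])

lemma espan_add:
  assumes "u \<in> espan n p" "v \<in> espan n p"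
  shows "(\<lambda>x. u x + v x) \<in> espan n p"
proof -
  from assms obtain H1 H2 c1 c2 where H: "finite H1" "finite H2" "\<forall>h\<in>H1. admissible_h n p h" "\<forall>h\<in>H2. admissible_h n p h"
    and 1: "(\<lambda>x. u x - (\<Sum>h\<in>H1. c1 h * delta (E_mon h) x)) \<in> tensor_rels n"
    and 2: "(\<lambda>x. v x - (\<Sum>h\<in>H2. c2 h * delta (E_mon h) x)) \<in> tensor_rels n"
    unfolding espan_def by blast
  define c where "c h = (if h \<in> H1 then c1 h else 0) + (if h \<in> H2 then c2 h else 0)" for h
  have "(\<Sum>h\<in>H1 \<union> H2. c h * delta (E_mon h) x) =
    (\<Sum>h\<in>H1. c1 h * delta (E_mon h) x) + (\<Sum>h\<in>H2. c2 h * delta (E_mon h) x)" for x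
  proof -
    have "(\<Sum>h\<in>H1 \<union> H2. (if h \<in> H1 then c1 h else 0) * delta (E_mon h) x) = (\<Sum>h\<in>H1. c1 h * delta (E_mon h) x)"
      using H by (intro sum.mono_neutral_cong_right) auto
    moreover have "(\<Sum>h\<in>H1 \<union> H2. (if h \<in> H2 then c2 h else 0) * delta (E_mon h) x) = (\<Sum>h\<in>H2. c2 h * delta (E_mon h) x)"
      using H by (intro sum.mono_neutral_cong_right) auto
    ultimately show ?thesis by (simp add: c_def distrib_right sum.distrib)
  qed
  then have "(\<lambda>x. u x + v x - (\<Sum>h\<in>H1 \<union> H2. c h * delta (E_mon h) x)) \<in> tensor_rels n"
    using tensor_rels.add[OF 1 2] by (simp add: algebra_simps)
  then show ?thesis unfolding espan_def using H by (auto intro!: exI[of _ "H1 \<union> H2"] exI[of _ c])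
qed

lemma espan_smult:
  assumes "u \<in> espan n p" shows "(\<lambda>x. a * u x) \<in> espan n p"
proof -
  from assms obtain H c where H: "finite H" "\<forall>h\<in>H. admissible_h n p h"
    and 1: "(\<lambda>x. u x - (\<Sum>h\<in>H. c h * delta (E_mon h) x)) \<in> tensor_rels n"
    unfolding espan_def by blast
  from tensor_rels.smult[OF 1, of a]
  have "(\<lambda>x. a * u x - (\<Sum>h\<in>H. (a * c h) * delta (E_mon h) x)) \<in> tensor_rels n"
    by (simp add: algebra_simps sum_distrib_left)
  then show ?thesis unfolding espan_def using H by (auto intro!: exI[of _ H] exI[of _ "\<lambda>h. a * c h"])
qed

lemma espan_sum:
  "finite W \<Longrightarrow> (\<And>w. w \<in> W \<Longrightarrow> f w \<in> espan n p) \<Longrightarrow> (\<lambda>x. \<Sum>w\<in>W. f w x) \<in> espan n p"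
  by (induction W rule: finite_induct) (auto intro: espan_add espan_tensor[OF tensor_rels.zero])

lemma delta_add_tensor:
  assumes "x \<in> yform n" "y \<in> yform n"
  shows "(\<lambda>w. delta (fa_of (x + y)) w - delta (fa_of x) w - delta (fa_of y) w) \<in> tensor_rels n"
  using tensor_rels.additive assms by (simp add: yform_def plus_ncpoly.rep_eq)

lemma delta_scale_tensor:
  assumes "x \<in> yform n"
  shows "(\<lambda>w. delta (fa_of (scale (zhalf z m) x)) w - zhalf_k z m * delta (fa_of x) w) \<in> tensor_rels n"
  using tensor_rels.scalar assms by (simp add: yform_def scale.rep_eq)

lemma delta_zero_tensor: "delta (fa_of 0) \<in> tensor_rels n"
  using delta_scale_tensor[OF yform_1, of 0 0 n] by (simp add: zhalf_def zhalf_k_def)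

lemma delta_ideal_tensor:
  assumes "x \<in> yideal n" shows "delta (fa_of x) \<in> tensor_rels n"
proof -
  have "fa_diff (fa_of x) (fa_of 0) = fa_of (x - 0)" by (simp only: minus_ncpoly.rep_eq)
  then have "(\<lambda>w. delta (fa_of x) w - delta (fa_of 0) w) \<in> tensor_rels n"
    using assms yform_ideal[OF assms] yform_0[of n] by (intro tensor_rels.ideal) (auto simp: yideal_def yform_def)
  from tensor_rels.add[OF this delta_zero_tensor] show ?thesis by simp
qed

text \<open>The integer \<open>p!\<close> may be moved through the tensor product into the field,
  where it is zero.\<close>

lemma delta_scale_fact_tensor:
  assumes "x \<in> yform n" "CHAR('k::field) = p" "p > 0"
  shows "(delta (fa_of (scale (fact p) x)) :: fa \<Rightarrow> 'k) \<in> tensor_rels n"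
proof -
  have "p dvd fact p" using assms(3) by (simp add: dvd_fact)
  then have "(of_nat (fact p) :: 'k) = 0" using assms(2) by (simp only: of_nat_eq_0_iff_char_dvd)
  then have "(zhalf_k (int (fact p)) 0 :: 'k) = 0" unfolding zhalf_k_def by (simp only: of_int_of_nat_eq div_0)
  moreover have "zhalf (int (fact p)) 0 = fact p" by (simp add: zhalf_def)
  ultimately have "(\<lambda>w. delta (fa_of (scale (fact p) x)) w - 0 * delta (fa_of x) w :: 'k) \<in> tensor_rels n"
    using delta_scale_tensor[OF assms(1), of "int (fact p)" 0] by metis
  then show ?thesis by simp
qed

lemma power_eq_scale_divpow: "x ^ t = scale (fact t) (divpow x t)"
  by (simp add: divpow_def)

lemma delta_E_not_restricted:
  assumes h: "finite {x. h x \<noteq> 0}" "\<forall>x. h x \<noteq> 0 \<longrightarrow> fst x \<in> pos_roots n" and y: "h y \<ge> p" and p: "CHAR('k::field) = p" "p > 0"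
  shows "(delta (E_mon h) :: fa \<Rightarrow> 'k) \<in> tensor_rels n"
proof -
  have "y \<in> set (supp_list h)" using y p(2) supp_list_props(1)[OF h(1)] by auto
  then obtain us vs where s: "supp_list h = us @ y # vs" by (meson split_list)
  have rt: "fst ` set (supp_list h) \<subseteq> pos_roots n" using h supp_list_props(1)[OF h(1)] by blast
  define A where "A = prod_list (map (\<lambda>x. rootv x ^ h x) us)"
  define B where "B = rootv y ^ (h y - p) * prod_list (map (\<lambda>x. rootv x ^ h x) vs)"
  have "rprod (hlist h) = A * (rootv y ^ h y * prod_list (map (\<lambda>x. rootv x ^ h x) vs))"
    unfolding hlist_def prod_list_power_rprod[symmetric] s A_def by simp
  also have "rootv y ^ h y = rootv y ^ p * rootv y ^ (h y - p)" using y by (simp add: power_add[symmetric])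
  finally have "rprod (hlist h) = scale (fact p) (A * (divpow (rootv y) p * B))"
    by (simp add: B_def power_eq_scale_divpow[of _ p] scale_mult_left scale_mult_right mult.assoc)
  moreover have "A * (divpow (rootv y) p * B) \<in> yform n"
    unfolding A_def B_def using rt s
    by (intro yform_mult yform_prod_list divpow_rootv_yform' yform_power rootv_yform)
      (auto intro!: yform_power rootv_yform simp: image_subset_iff)
  ultimately show ?thesis using delta_scale_fact_tensor[OF _ p] by (simp add: E_mon_rprod)
qed

text \<open>The relations of the tensor product concern only elements of the integral form, so
  membership in \<open>yform\<close> is carried through the induction together with the
  claim.\<close>

lemma delta_pbw_span:
  assumes "x \<in> pbw_span n" and p: "CHAR('k::field) = p" "p > 0"
  shows "x \<in> yform n \<and> (delta (fa_of x) :: fa \<Rightarrow> 'k) \<in> espan n p"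
  using assms(1) unfolding pbw_span_def
proof (induction x rule: zspan.induct)
  case zero
  show ?case by (simp add: yform_0 espan_tensor delta_zero_tensor)
next
  case (base x)
  show ?case
  proof (cases "x \<in> yideal n")
    case True
    then show ?thesis by (simp add: yform_ideal espan_tensor delta_ideal_tensor)
  next
    case False
    then obtain ys where ys: "x = rprod ys" "fst ` set ys \<subseteq> pos_roots n" "sorted (map pbw_key ys)" using base by blast
    define h where "h = count (mset ys)"
    have x: "fa_of x = E_mon h" using hlist_count[OF ys(3)] by (simp add: ys(1) h_def E_mon_rprod)
    have h: "finite {x. h x \<noteq> 0}" "\<forall>x. h x \<noteq> 0 \<longrightarrow> fst x \<in> pos_roots n"
      using ys(2) finite_subset[of "{x. h x \<noteq> 0}" "set ys"] by (auto simp: h_def count_eq_zero_iff image_subset_iff)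
    have "delta (E_mon h) \<in> (espan n p :: (fa \<Rightarrow> 'k) set)"
    proof (cases "\<forall>y. h y < p")
      case True
      then show ?thesis using h by (intro espan_E) (simp add: admissible_h_def)
    next
      case False
      then show ?thesis using delta_E_not_restricted[OF h _ p] by (auto simp: not_less intro: espan_tensor)
    qed
    then show ?thesis using rprod_yform[OF ys(2)] x ys(1) by simp
  qed
next
  case (add x y)
  then have x: "x \<in> yform n" "y \<in> yform n" and e: "(\<lambda>w. delta (fa_of x) w + delta (fa_of y) w) \<in> (espan n p :: (fa \<Rightarrow> 'k) set)"
    by (auto intro: espan_add)
  from espan_add[OF espan_tensor[OF delta_add_tensor[OF x]] e]
  show ?case by (simp add: yform_add x)
next
  case (scale x z m)
  then have x: "x \<in> yform n" and e: "(\<lambda>w. zhalf_k z m * delta (fa_of x) w) \<in> (espan n p :: (fa \<Rightarrow> 'k) set)"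
    by (auto intro: espan_smult)
  from espan_add[OF espan_tensor[OF delta_scale_tensor[OF x, of z m]] e]
  show ?case by (simp add: yform_scale x)
qed

lemma prod_list_divpow:
  "scale (\<Prod>(x, t)\<leftarrow>zs. fact t) (prod_list (map (\<lambda>(x, t). divpow (rootv x) t) zs))
    = rprod (concat (map (\<lambda>(x, t). replicate t x) zs))"
proof (induction zs)
  case (Cons z zs)
  obtain x t where z: "z = (x, t)" by (metis surj_pair)
  have "scale (fact t * c) (divpow (rootv x) t * y) = rootv x ^ t * scale c y" for c y
    by (simp add: divpow_def scale_mult_left scale_mult_right)
  then show ?case using Cons by (simp add: z rprod_append) (simp add: rprod_def)
qed (simp add: rprod_def)

text \<open>Denominators are cleared first: with \<open>q\<close> the product of the factorials
  \<open>t!\<close>, the multiple \<open>q x\<close> is a product of root vectors, which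
  straightening handles. Since every \<open>t < p\<close>, the integer \<open>q\<close> is prime to
  \<open>p\<close> and can be divided out again in the field.\<close>

lemma small_monomial_espan:
  assumes w: "w \<in> small_monomials n p" and p: "CHAR('k::field) = p" "prime p"
  shows "(delta w :: fa \<Rightarrow> 'k) \<in> espan n p"
proof -
  obtain gs where gs: "w = fa_prod_list gs" "set gs \<subseteq> small_gens n p"
    using w unfolding small_monomials_def by blast
  have "\<exists>z. g = fa_of (divpow (rootv (fst z)) (snd z)) \<and> fst (fst z) \<in> pos_roots n \<and> snd z < p" if "g \<in> set gs" for g
  proof -
    from that gs obtain \<beta> r t where "g = fa_divpow (root_vec \<beta> r) t" "\<beta> \<in> pos_roots n" "t < p"
      unfolding small_gens_def by blast
    then show ?thesis by (intro exI[of _ "((\<beta>, r), t)"]) (simp add: root_vec_fa_of fa_divpow_fa_of)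
  qed
  then obtain f where f: "\<And>g. g \<in> set gs \<Longrightarrow> g = fa_of (divpow (rootv (fst (f g))) (snd (f g)))
     \<and> fst (fst (f g)) \<in> pos_roots n \<and> snd (f g) < p" by metis
  define zs where "zs = map f gs"
  define x where "x = prod_list (map (\<lambda>(x, t). divpow (rootv x) t) zs)"
  define q where "q = (\<Prod>(x, t)\<leftarrow>zs. fact t :: nat)"
  have "gs = map fa_of (map (\<lambda>(x, t). divpow (rootv x) t) zs)"
    using f by (auto simp: zs_def case_prod_beta intro!: map_idI[symmetric])
  then have w: "w = fa_of x" unfolding gs(1) x_def by (metis fa_prod_list_fa_of)
  have zs: "\<And>z. z \<in> set zs \<Longrightarrow> fst (fst z) \<in> pos_roots n \<and> snd z < p" using f by (auto simp: zs_def)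
  have xf: "x \<in> yform n" unfolding x_def using zs by (auto intro!: yform_prod_list divpow_rootv_yform' dest: zs)
  have qc: "(\<Prod>(x, t)\<leftarrow>zs. fact t) = (of_nat q :: complex)"
    unfolding q_def by (induction zs) auto
  have "fst ` set (concat (map (\<lambda>(x, t). replicate t x) zs)) \<subseteq> pos_roots n"
    using zs by fastforce
  from rprod_in_pbw_span[OF this] have "scale (of_nat q) x \<in> pbw_span n"
    unfolding prod_list_divpow[symmetric] qc x_def .
  then have "(delta (fa_of (scale (zhalf (int q) 0) x)) :: fa \<Rightarrow> 'k) \<in> espan n p"
    using delta_pbw_span[OF _ p(1)] p(2) by (simp add: prime_gt_0_nat zhalf_def)
  from espan_add[OF this espan_smult[OF espan_tensor[OF delta_scale_tensor[OF xf, of "int q" 0]], of "-1"]]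
  have e: "(\<lambda>w. of_nat q * (delta (fa_of x) w :: 'k)) \<in> espan n p" by (simp add: zhalf_k_def)
  have "\<not> p dvd q"
    unfolding q_def using zs
  proof (induction zs)
    case (Cons z zs)
    have z: "snd z < p" using Cons.prems[of z] by simp
    have "\<not> p dvd (\<Prod>(x, t)\<leftarrow>zs. fact t)" using Cons.prems by (intro Cons.IH) auto
    then show ?case using p(2) z
      by (cases z) (simp add: prime_dvd_mult_iff prime_dvd_fact_iff not_le)
  qed (use p(2) in \<open>auto simp: prime_nat_iff\<close>)
  then have "of_nat q \<noteq> (0::'k)" using p(1) by (simp add: of_nat_eq_0_iff_char_dvd)
  then show ?thesis using espan_smult[OF e, of "1 / of_nat q"] by (simp add: w)
qed

lemma small_span_espan:
  assumes "s \<in> small_span n p" and p: "CHAR('k::field) = p" "prime p"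
  shows "(s :: fa \<Rightarrow> 'k) \<in> espan n p"
proof -
  obtain W c where "s = (\<lambda>x. \<Sum>w\<in>W. c w * delta w x)" "finite W" "W \<subseteq> small_monomials n p"
    using assms(1) unfolding small_span_def by blast
  then show ?thesis by (auto intro!: espan_sum espan_smult small_monomial_espan p)
qed

lemma E_mon_small_monomial:
  assumes "admissible_h n p h" "p > 1"
  shows "E_mon h \<in> small_monomials n p"
proof -
  have "rprod (hlist h) = prod_list (map (\<lambda>x. divpow (rootv x) 1) (hlist h))"
    by (simp add: rprod_def divpow_def)
  then have E: "E_mon h = fa_prod_list (map (\<lambda>x. fa_divpow (root_vec (fst x) (snd x)) 1) (hlist h))"
    using fa_prod_list_fa_of[of "map (\<lambda>x. divpow (rootv x) 1) (hlist h)"]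
    by (simp add: E_mon_rprod root_vec_fa_of fa_divpow_fa_of o_def)
  have "fa_divpow (root_vec (fst x) (snd x)) 1 \<in> small_gens n p" if "x \<in> set (hlist h)" for x
  proof -
    have "fst x \<in> pos_roots n" using that assms(1) set_hlist[of h] unfolding admissible_h_def by blast
    then show ?thesis unfolding small_gens_def using assms(2) by blast
  qed
  then have "set (map (\<lambda>x. fa_divpow (root_vec (fst x) (snd x)) 1) (hlist h)) \<subseteq> small_gens n p"
    unfolding set_map by (rule image_subsetI)
  then show ?thesis unfolding small_monomials_def E by blast
qed

section \<open>Shuffle functionals\<close>

text \<open>A point is a pair of tag and colour. The tag tells points of equal colour apart and will
  later name a chain; the coordinate of a point is given separately by \<open>x\<close>.\<close>

type_synonym label = "nat \<times> nat"
type_synonym kfld = "complex fls"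

text \<open>The structure function \<open>(u + c_ij / 2) / u\<close> of the rational shuffle
  algebra, at \<open>u = x a - x b\<close> for distinct coordinates.\<close>

definition zeta :: "(label \<Rightarrow> kfld) \<Rightarrow> label \<Rightarrow> label \<Rightarrow> kfld" where
  "zeta x a b = 1 + fls_const (of_int (cartan (snd a) (snd b)) / 2) / (x a - x b)"

definition zprod :: "(label \<Rightarrow> kfld) \<Rightarrow> label set \<Rightarrow> label set \<Rightarrow> kfld" where
  "zprod x A B = (\<Prod>a\<in>A. \<Prod>b\<in>B. zeta x a b)"

text \<open>Unfolded, this is a sum over all orderings of \<open>S\<close> whose colours spell the
  word, with a factor \<open>zeta x a b\<close> for every pair in which \<open>a\<close> precedes
  \<open>b\<close>.\<close>

primrec shw :: "(label \<Rightarrow> kfld) \<Rightarrow> word \<Rightarrow> label set \<Rightarrow> kfld" where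
  "shw x [] S = (if S = {} then 1 else 0)"
| "shw x (l # w) S = (\<Sum>a\<in>{a \<in> S. snd a = fst l}. x a ^ snd l * zprod x {a} (S - {a}) * shw x w (S - {a}))"

text \<open>Cutting an ordering of \<open>S\<close> after the letters of \<open>u\<close> selects
  the set \<open>A\<close> of points used so far; the pairs across the cut contribute
  \<open>zprod x A (S - A)\<close>. This is the shuffle product.\<close>

lemma shw_append:
  assumes "finite S"
  shows "shw x (u @ v) S = (\<Sum>A\<in>Pow S. shw x u A * shw x v (S - A) * zprod x A (S - A))"
  using assms
proof (induction u arbitrary: S)
  case Nil
  have "(\<Sum>A\<in>Pow S. shw x [] A * shw x v (S - A) * zprod x A (S - A))
      = (\<Sum>A\<in>{{}}. shw x [] A * shw x v (S - A) * zprod x A (S - A))"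
    using Nil by (intro sum.mono_neutral_right) auto
  then show ?case by (simp add: zprod_def)
next
  case (Cons l u)
  define t where "t a A = x a ^ snd l * zprod x {a} (S - {a}) * (shw x u A * shw x v (S - {a} - A) * zprod x A (S - {a} - A))" for a A
  define t' where "t' A a = x a ^ snd l * zprod x {a} (A - {a}) * shw x u (A - {a}) * shw x v (S - A) * zprod x A (S - A)" for A a
  have eq: "t' (insert a A) a = t a A" if a: "a \<in> S" "A \<subseteq> S - {a}" for a A
  proof -
    have f: "finite A" "finite S" using a Cons.prems by (auto intro: finite_subset)
    have na: "a \<notin> A" using a by auto
    have 1: "S - insert a A = S - {a} - A" by auto
    have 2: "insert a A - {a} = A" using na by auto
    have 3: "S - {a} = A \<union> (S - {a} - A)" using a by auto
    have z1: "zprod x {a} (S - {a}) = zprod x {a} A * zprod x {a} (S - {a} - A)"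
      unfolding zprod_def using f by (subst 3, subst prod.union_disjoint) auto
    have z2: "zprod x (insert a A) (S - {a} - A) = zprod x {a} (S - {a} - A) * zprod x A (S - {a} - A)"
      unfolding zprod_def using f na by simp
    show ?thesis unfolding t_def t'_def 1 2 z1 z2 by (simp only: mult_ac)
  qed
  have "shw x ((l # u) @ v) S = (\<Sum>a\<in>{a \<in> S. snd a = fst l}. \<Sum>A\<in>Pow (S - {a}). t a A)"
    using Cons by (simp add: sum_distrib_left t_def)
  also have "\<dots> = (\<Sum>(a, A)\<in>(SIGMA a:{a \<in> S. snd a = fst l}. Pow (S - {a})). t a A)"
    using Cons.prems by (subst sum.Sigma) auto
  also have "\<dots> = (\<Sum>(A, a)\<in>(SIGMA A:Pow S. {a \<in> A. snd a = fst l}). t' A a)"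
    by (rule sum.reindex_bij_witness[of _ "\<lambda>(A, a). (a, A - {a})" "\<lambda>(a, A). (insert a A, a)"])
      (auto simp: eq)
  also have "\<dots> = (\<Sum>A\<in>Pow S. \<Sum>a\<in>{a \<in> A. snd a = fst l}. t' A a)"
    using Cons.prems by (subst sum.Sigma) (auto intro: finite_subset)
  also have "\<dots> = (\<Sum>A\<in>Pow S. shw x (l # u) A * shw x v (S - A) * zprod x A (S - A))"
    by (simp add: sum_distrib_right t'_def)
  finally show ?case .
qed

definition psi :: "(label \<Rightarrow> kfld) \<Rightarrow> ncpoly \<Rightarrow> label set \<Rightarrow> kfld" where
  "psi x f S = (\<Sum>w\<in>{w. fa_of f w \<noteq> 0}. fls_const (fa_of f w) * shw x w S)"

lemma finite_supp_fa_of: "finite {w. fa_of f w \<noteq> 0}"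
  using fa_of[of f] by (simp add: fin_supp_def)

lemma psi_superset:
  assumes "finite W" "{w. fa_of f w \<noteq> 0} \<subseteq> W"
  shows "psi x f S = (\<Sum>w\<in>W. fls_const (fa_of f w) * shw x w S)"
  unfolding psi_def using assms by (intro sum.mono_neutral_left) auto

lemma psi_scale: "psi x (scale c f) S = fls_const c * psi x f S"
proof -
  have "psi x (scale c f) S = (\<Sum>w\<in>{w. fa_of f w \<noteq> 0}. fls_const (fa_of (scale c f) w) * shw x w S)"
    by (rule psi_superset) (auto simp: finite_supp_fa_of scale.rep_eq fa_smult_def)
  then show ?thesis
    by (simp add: psi_def sum_distrib_left scale.rep_eq fa_smult_def fls_const_mult_const[symmetric] mult.assoc
        del: fls_const_mult_const)
qed

lemma psi_add: "psi x (f + g) S = psi x f S + psi x g S"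
proof -
  let ?W = "{w. fa_of f w \<noteq> 0} \<union> {w. fa_of g w \<noteq> 0}"
  have W: "finite ?W" by (simp add: finite_supp_fa_of)
  have "psi x (f + g) S = (\<Sum>w\<in>?W. fls_const (fa_of (f + g) w) * shw x w S)"
    by (rule psi_superset[OF W]) (auto simp: plus_ncpoly.rep_eq fa_add_def)
  moreover have "psi x f S = (\<Sum>w\<in>?W. fls_const (fa_of f w) * shw x w S)"
    by (rule psi_superset[OF W]) auto
  moreover have "psi x g S = (\<Sum>w\<in>?W. fls_const (fa_of g w) * shw x w S)"
    by (rule psi_superset[OF W]) auto
  ultimately show ?thesis
    by (simp add: plus_ncpoly.rep_eq fa_add_def fls_plus_const[symmetric] distrib_right sum.distrib)
qed

lemma psi_uminus: "psi x (- f) S = - psi x f S"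
  using psi_scale[of x "-1" f S] by (simp add: scale_minus_left)

lemma psi_diff: "psi x (f - g) S = psi x f S - psi x g S"
  using psi_add[of x f "- g" S] by (simp add: psi_uminus)

lemma psi_0: "psi x 0 S = 0" by (simp add: psi_def zero_ncpoly.rep_eq)

lemma psi_1: "psi x 1 S = (if S = {} then 1 else 0)"
proof -
  have "psi x 1 S = (\<Sum>w\<in>{[]}. fls_const (fa_of 1 w) * shw x w S)"
    by (rule psi_superset) (auto simp: one_ncpoly.rep_eq fa_one_def)
  then show ?thesis by (simp add: one_ncpoly.rep_eq fa_one_def)
qed

lemma psi_mult:
  assumes S: "finite S"
  shows "psi x (f * g) S = (\<Sum>A\<in>Pow S. psi x f A * psi x g (S - A) * zprod x A (S - A))"
proof -
  define U where "U = {w. fa_of f w \<noteq> 0}"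
  define V where "V = {w. fa_of g w \<noteq> 0}"
  have fin: "finite U" "finite V" by (auto simp: U_def V_def finite_supp_fa_of)
  define W where "W = (\<lambda>(u, v). u @ v) ` (U \<times> V)"
  have W: "finite W" using fin by (simp add: W_def)
  have WI: "u @ v \<in> W" if "u \<in> U" "v \<in> V" for u v using that by (auto simp: W_def)
  have supp: "{w. fa_of (f * g) w \<noteq> 0} \<subseteq> W"
  proof
    fix w assume "w \<in> {w. fa_of (f * g) w \<noteq> 0}"
    then obtain i where "fa_of f (take i w) * fa_of g (drop i w) \<noteq> 0"
      unfolding times_ncpoly.rep_eq fa_mult_def by (auto elim: sum.not_neutral_contains_not_neutral)
    then show "w \<in> W"
      unfolding W_def U_def V_def by (auto intro!: image_eqI[of _ _ "(take i w, drop i w)"])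
  qed
  let ?c = "\<lambda>u v. fls_const (fa_of f u) * fls_const (fa_of g v)"
  have cst: "fls_const (\<Sum>i\<in>I. h i) = (\<Sum>i\<in>I. fls_const (h i :: complex))" for h and I :: "nat set"
    by (induction I rule: infinite_finite_induct) (auto simp: fls_plus_const[symmetric])
  have "psi x (f * g) S = (\<Sum>w\<in>W. fls_const (fa_of (f * g) w) * shw x w S)"
    by (rule psi_superset[OF W supp])
  also have "\<dots> = (\<Sum>w\<in>W. \<Sum>i\<le>length w. ?c (take i w) (drop i w) * shw x w S)"
    by (simp add: times_ncpoly.rep_eq fa_mult_def cst sum_distrib_right)
  also have "\<dots> = (\<Sum>(w, i)\<in>(SIGMA w:W. {..length w}). ?c (take i w) (drop i w) * shw x w S)"
    using W by (subst sum.Sigma) auto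
  also have "\<dots> = (\<Sum>(w, i)\<in>{(w, i) \<in> (SIGMA w:W. {..length w}). take i w \<in> U \<and> drop i w \<in> V}.
      ?c (take i w) (drop i w) * shw x w S)"
    using W by (intro sum.mono_neutral_right) (auto simp: U_def V_def)
  also have "\<dots> = (\<Sum>(u, v)\<in>U \<times> V. ?c u v * shw x (u @ v) S)"
    by (rule sum.reindex_bij_witness[of _ "\<lambda>(u, v). (u @ v, length u)" "\<lambda>(w, i). (take i w, drop i w)"])
      (auto simp: WI)
  also have "\<dots> = (\<Sum>(u, v)\<in>U \<times> V. \<Sum>A\<in>Pow S. ?c u v * (shw x u A * shw x v (S - A) * zprod x A (S - A)))"
    by (simp only: shw_append[OF S] sum_distrib_left)
  also have "\<dots> = (\<Sum>A\<in>Pow S. \<Sum>(u, v)\<in>U \<times> V. ?c u v * (shw x u A * shw x v (S - A) * zprod x A (S - A)))"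
    unfolding case_prod_beta by (rule sum.swap)
  also have "\<dots> = (\<Sum>A\<in>Pow S. psi x f A * psi x g (S - A) * zprod x A (S - A))"
  proof (rule sum.cong[OF refl])
    fix A
    show "(\<Sum>(u, v)\<in>U \<times> V. ?c u v * (shw x u A * shw x v (S - A) * zprod x A (S - A)))
      = psi x f A * psi x g (S - A) * zprod x A (S - A)"
      unfolding psi_def U_def[symmetric] V_def[symmetric] sum_product sum.cartesian_product
      by (subst sum_distrib_right, rule sum.cong) (auto simp del: fls_const_mult_const simp: mult_ac)
  qed
  finally show ?thesis .
qed

lemma psi_egen: "psi x (egen i r) S = (if \<exists>a. S = {a} \<and> snd a = i then x (the_elem S) ^ r else 0)"
proof -
  have "psi x (egen i r) S = (\<Sum>w\<in>{[(i, r)]}. fls_const (fa_of (egen i r) w) * shw x w S)"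
    by (rule psi_superset) (auto simp: egen.rep_eq fa_gen_def)
  also have "\<dots> = (\<Sum>a\<in>{a \<in> S. snd a = i}. x a ^ r * zprod x {a} (S - {a}) * (if S - {a} = {} then 1 else 0))"
    by (simp add: egen.rep_eq fa_gen_def)
  also have "\<dots> = (if \<exists>a. S = {a} \<and> snd a = i then x (the_elem S) ^ r else 0)"
  proof (cases "\<exists>a. S = {a} \<and> snd a = i")
    case True
    then obtain a where a: "S = {a}" "snd a = i" by blast
    then have "{a \<in> S. snd a = i} = {a}" by auto
    then show ?thesis using a by (auto simp: zprod_def)
  next
    case False
    then have "\<not> (S - {a} = {})" if "a \<in> S" "snd a = i" for a using that by blast
    then show ?thesis using False by (auto intro!: sum.neutral)
  qed
  finally show ?thesis .
qed

lemma psi_egen_single: "psi x (egen i r) {a} = (if snd a = i then x a ^ r else 0)"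
  by (auto simp: psi_egen)

lemma psi_egen_mult:
  assumes "finite S"
  shows "psi x (egen i r * g) S = (\<Sum>a\<in>S. if snd a = i then x a ^ r * psi x g (S - {a}) * zprod x {a} (S - {a}) else 0)"
proof -
  have "psi x (egen i r * g) S = (\<Sum>A\<in>(\<lambda>a. {a}) ` S. psi x (egen i r) A * psi x g (S - A) * zprod x A (S - A))"
    unfolding psi_mult[OF assms] using assms by (intro sum.mono_neutral_right) (auto simp: psi_egen)
  also have "\<dots> = (\<Sum>a\<in>S. if snd a = i then x a ^ r * psi x g (S - {a}) * zprod x {a} (S - {a}) else 0)"
    by (subst sum.reindex) (auto simp: inj_on_def psi_egen intro!: sum.cong)
  finally show ?thesis .
qed

section \<open>The shuffle functionals kill the defining relations\<close>

definition colors :: "label set \<Rightarrow> nat multiset" where "colors S = image_mset snd (mset_set S)"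

text \<open>The grading by colour content reduces each relation to point sets with exactly the
  colours of its generators, hence to two or three points.\<close>

definition homog :: "(label \<Rightarrow> kfld) \<Rightarrow> nat multiset \<Rightarrow> ncpoly \<Rightarrow> bool" where
  "homog x M f \<longleftrightarrow> (\<forall>S. finite S \<longrightarrow> colors S \<noteq> M \<longrightarrow> psi x f S = 0)"

lemma homogD: "homog x M f \<Longrightarrow> finite S \<Longrightarrow> colors S \<noteq> M \<Longrightarrow> psi x f S = 0"
  by (simp add: homog_def)

lemma homog_egen: "homog x {#i#} (egen i r)"
  by (auto simp: homog_def psi_egen colors_def)

lemma homog_mult: "homog x M f \<Longrightarrow> homog x N g \<Longrightarrow> homog x (M + N) (f * g)"
  unfolding homog_def
proof (intro allI impI)
  fix S assume f: "\<forall>S. finite S \<longrightarrow> colors S \<noteq> M \<longrightarrow> psi x f S = 0" and g: "\<forall>S. finite S \<longrightarrow> colors S \<noteq> N \<longrightarrow> psi x g S = 0"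
    and S: "finite S" "colors S \<noteq> M + N"
  show "psi x (f * g) S = 0" unfolding psi_mult[OF S(1)]
  proof (rule sum.neutral, rule ballI)
    fix A assume A: "A \<in> Pow S"
    then have fin: "finite A" "finite (S - A)" using S by (auto intro: finite_subset)
    have "mset_set S = mset_set A + mset_set (S - A)"
      using A S(1) fin mset_set_Union[of A "S - A"] by (simp add: Un_absorb1)
    then have "colors S = colors A + colors (S - A)" by (simp add: colors_def)
    then have "colors A \<noteq> M \<or> colors (S - A) \<noteq> N" using S(2) by auto
    then show "psi x f A * psi x g (S - A) * zprod x A (S - A) = 0" using f g fin by auto
  qed
qed

lemma homog_add: "homog x M f \<Longrightarrow> homog x M g \<Longrightarrow> homog x M (f + g)" by (simp add: homog_def psi_add)
lemma homog_diff: "homog x M f \<Longrightarrow> homog x M g \<Longrightarrow> homog x M (f - g)" by (simp add: homog_def psi_diff)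
lemma homog_scale: "homog x M f \<Longrightarrow> homog x M (scale c f)" by (simp add: homog_def psi_scale)
lemma homog_br: "homog x M f \<Longrightarrow> homog x N g \<Longrightarrow> homog x (M + N) (br f g)"
  using homog_mult[of x M f N g] homog_mult[of x N g M f] by (simp add: br_def homog_diff add.commute)

lemma colors_add_mset:
  assumes "finite S" "colors S = add_mset i M"
  obtains a where "a \<in> S" "snd a = i" "colors (S - {a}) = M"
proof -
  have "i \<in># colors S" using assms by simp
  then obtain a where a: "a \<in> S" "snd a = i" using assms(1) by (auto simp: colors_def)
  have "mset_set S = add_mset a (mset_set (S - {a}))" by (rule mset_set.remove[OF assms(1) a(1)])
  then have "colors S = add_mset i (colors (S - {a}))" using a by (simp add: colors_def)
  with a that assms show ?thesis by simp
qed

lemma colors_2: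
  assumes "finite S" "colors S = {#i, j#}"
  obtains a b where "S = {a, b}" "a \<noteq> b" "snd a = i" "snd b = j"
proof -
  from colors_add_mset[OF assms] obtain a where a: "a \<in> S" "snd a = i" "colors (S - {a}) = {#j#}" .
  from colors_add_mset[OF _ a(3)] assms(1) obtain b where b: "b \<in> S - {a}" "snd b = j" "colors (S - {a} - {b}) = {#}"
    by auto
  then have "S - {a} - {b} = {}" using assms(1) by (auto simp: colors_def mset_set_empty_iff)
  then have "S = {a, b}" using a b by auto
  with that a b show ?thesis by blast
qed

lemma colors_3:
  assumes "finite S" "colors S = {#i, j, k#}"
  obtains a b c where "S = {a, b, c}" "distinct [a, b, c]" "snd a = i" "snd b = j" "snd c = k"
proof -
  from colors_add_mset[OF assms] obtain a where a: "a \<in> S" "snd a = i" "colors (S - {a}) = {#j, k#}" .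
  have "finite (S - {a})" using assms(1) by simp
  from colors_2[OF this a(3)] obtain b c where b: "S - {a} = {b, c}" "b \<noteq> c" "snd b = j" "snd c = k" .
  then have "S = {a, b, c}" "distinct [a, b, c]" using a by auto
  with that a b show ?thesis by blast
qed

lemma psi_two:
  assumes "a \<noteq> b"
  shows "psi x (egen i r * egen j s) {a, b} =
    (if snd a = i \<and> snd b = j then x a ^ r * x b ^ s * zeta x a b else 0) +
    (if snd b = i \<and> snd a = j then x b ^ r * x a ^ s * zeta x b a else 0)"
proof -
  have "{a, b} - {a} = {b}" "{a, b} - {b} = {a}" using assms by auto
  then have "psi x (egen i r * egen j s) {a, b} =
      (if snd a = i then x a ^ r * psi x (egen j s) {b} * zeta x a b else 0)
    + (if snd b = i then x b ^ r * psi x (egen j s) {a} * zeta x b a else 0)"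
    using assms by (subst psi_egen_mult) (simp_all add: zprod_def)
  moreover have "(if C then u * (if C' then v else 0) * w else 0) = (if C \<and> C' then u * v * w else (0::kfld))" for C C' u v w
    by simp
  ultimately show ?thesis unfolding psi_egen_single by (simp only:)
qed

lemma cartan_sym: "cartan i j = cartan j i" by (auto simp: cartan_def)

text \<open>The quadratic relation on two points: the two values of \<open>zeta\<close> are
  \<open>1 + w\<close> and \<open>1 - w\<close> with \<open>(x a - x b) w = g\<close>, so both sides
  equal \<open>2 g\<close>.\<close>

lemma zeta_quad:
  assumes "x a \<noteq> x b" "g = fls_const (of_int (cartan (snd a) (snd b)) / 2)"
  shows "(x a - x b) * (zeta x a b - zeta x b a) = g * (zeta x a b + zeta x b a)"
proof -
  have "x a - x b \<noteq> 0" "x b - x a \<noteq> 0" using assms by auto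
  define w where "w = g / (x a - x b)"
  have w: "(x a - x b) * w = g" using \<open>x a - x b \<noteq> 0\<close> by (simp add: w_def)
  have z: "zeta x a b = 1 + w" "zeta x b a = 1 - w"
    using assms(2) minus_divide_right[of g "x a - x b"] by (simp_all add: zeta_def w_def cartan_sym[of "snd b"])
  have "(x a - x b) * (zeta x a b - zeta x b a) = 2 * ((x a - x b) * w)" unfolding z by (simp add: algebra_simps)
  also have "\<dots> = g * (zeta x a b + zeta x b a)" unfolding z w by (simp add: algebra_simps)
  finally show ?thesis .
qed

text \<open>For equal colours either generator can sit at either point. With \<open>A\<close>,
  \<open>B\<close>, \<open>A'\<close>, \<open>B'\<close> for \<open>x a^r\<close>,
  \<open>x b^r\<close>, \<open>x a^s\<close>, \<open>x b^s\<close>, the relation splits into two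
  instances of \<open>zeta_quad\<close>, one for each placement.\<close>

lemma quad_same:
  fixes X Y A B A' B' g z z' :: "'a::comm_ring_1"
  shows "(X * A * B' * z + Y * B * A' * z') - (A' * (Y * B) * z + B' * (X * A) * z')
    - ((A * (Y * B') * z + B * (X * A') * z') - (X * A' * B * z + Y * B' * A * z'))
    - g * ((A * B' * z + B * A' * z') + (A' * B * z + B' * A * z'))
    = A * B' * ((X - Y) * (z - z') - g * (z + z')) + B * A' * ((X - Y) * (z - z') - g * (z + z'))"
  by (simp add: algebra_simps)

lemma quad_diff:
  fixes X Y A B g z z' :: "'a::comm_ring_1"
  shows "X * A * B * z - B * (X * A) * z' - (A * (Y * B) * z - Y * B * A * z') - g * (A * B * z + B * A * z')
    = A * B * ((X - Y) * (z - z') - g * (z + z'))"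
  by (simp add: algebra_simps)

lemma psi_quad:
  assumes S: "finite S" "inj_on x S"
  shows "psi x (br (egen i (Suc r)) (egen j s) - br (egen i r) (egen j (Suc s))
    - scale (of_int (cartan i j) / 2) (egen i r * egen j s + egen j s * egen i r)) S = 0" (is "psi x ?f S = 0")
proof (cases "colors S = {#i, j#}")
  case False
  have "homog x ({#i#} + {#j#}) (egen j s * egen i r)"
    using homog_mult[OF homog_egen[of x j s] homog_egen[of x i r]] by (simp add: add_mset_commute)
  then have "homog x ({#i#} + {#j#}) ?f"
    by (intro homog_diff homog_br homog_egen homog_scale homog_add homog_mult[OF homog_egen homog_egen])
  then show ?thesis by (rule homogD) (use False S in \<open>simp_all add: add_mset_commute\<close>)
next
  case True
  then obtain a b where ab: "S = {a, b}" "a \<noteq> b" "snd a = i" "snd b = j" using colors_2[OF S(1) True] by metis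
  have x: "x a \<noteq> x b" using S ab by (auto simp: inj_on_def)
  define g where "g = fls_const (complex_of_int (cartan i j) / 2)"
  define z where "z = zeta x a b"
  define z' where "z' = zeta x b a"
  have q: "(x a - x b) * (z - z') = g * (z + z')"
    unfolding z_def z'_def by (rule zeta_quad[OF x]) (simp add: g_def ab)
  have two: "psi x (egen i u * egen j v) {a, b} = x a ^ u * x b ^ v * z + x b ^ u * x a ^ v * z'"
    "psi x (egen j u * egen i v) {a, b} = x a ^ u * x b ^ v * z + x b ^ u * x a ^ v * z'" if "i = j" for u v
    unfolding psi_two[OF ab(2)] using that ab(3,4) by (simp_all add: z_def z'_def)
  have two': "psi x (egen i u * egen j v) {a, b} = x a ^ u * x b ^ v * z" if "i \<noteq> j" for u v
    unfolding psi_two[OF ab(2)] using that ab(3,4) by (simp add: z_def)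
  have two'': "psi x (egen j u * egen i v) {a, b} = x b ^ u * x a ^ v * z'" if "i \<noteq> j" for u v
    unfolding psi_two[OF ab(2)] using that ab(3,4) by (simp add: z'_def)
  show ?thesis
  proof (cases "i = j")
    case True
    have "psi x ?f S = x a ^ r * x b ^ s * ((x a - x b) * (z - z') - g * (z + z')) +
       x b ^ r * x a ^ s * ((x a - x b) * (z - z') - g * (z + z'))"
      unfolding ab(1) br_def psi_diff psi_scale psi_add g_def[symmetric] two[OF True] power_Suc quad_same[symmetric]
      by (simp only: mult_ac True)
    then show ?thesis using q by simp
  next
    case False
    have "psi x ?f S = x a ^ r * x b ^ s * ((x a - x b) * (z - z') - g * (z + z'))"
      unfolding ab(1) br_def psi_diff psi_scale psi_add g_def[symmetric] two'[OF False] two''[OF False] power_Suc quad_diff[symmetric]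
      by (simp only: mult_ac)
    then show ?thesis using q by simp
  qed
qed

lemma psi_comm:
  assumes S: "finite S" and c: "cartan i j = 0"
  shows "psi x (br (egen i r) (egen j s)) S = 0" (is "psi x ?f S = 0")
proof (cases "colors S = {#i, j#}")
  case False
  have "homog x ({#i#} + {#j#}) ?f" by (intro homog_br homog_egen)
  then show ?thesis by (rule homogD) (use False S in \<open>simp_all add: add_mset_commute\<close>)
next
  case True
  then obtain a b where ab: "S = {a, b}" "a \<noteq> b" "snd a = i" "snd b = j" using colors_2[OF S True] by metis
  have "i \<noteq> j" using c by (auto simp: cartan_def)
  moreover have "zeta x a b = 1" "zeta x b a = 1" using ab c by (simp_all add: zeta_def cartan_sym[of j])
  ultimately show ?thesis using ab unfolding ab(1) br_def psi_diff psi_two[OF ab(2)] by simp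
qed

text \<open>For points \<open>a\<close>, \<open>b\<close> of colour \<open>i\<close> and
  \<open>c\<close> of colour \<open>j\<close>, the quantities \<open>D\<close>, \<open>P\<close>,
  \<open>Q\<close> belong to the pairs \<open>a b\<close>, \<open>a c\<close>, \<open>b c\<close>.
  The coefficients 1, -2, 1 go with \<open>c\<close> in the last, middle and first place. The right
  side will vanish by partial fractions for \<open>P\<close> and \<open>Q\<close>.\<close>

lemma serre_factor:
  fixes D P Q :: "'a::comm_ring_1"
  shows "(1 + D) * ((1 - P) * (1 - Q) - 2 * ((1 - P) * (1 + Q)) + (1 + P) * (1 + Q))
    + (1 - D) * ((1 - P) * (1 - Q) - 2 * ((1 + P) * (1 - Q)) + (1 + P) * (1 + Q)) = 4 * (2 * P * Q + D * (P - Q))"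
  by (simp add: algebra_simps)

lemma serre_collect:
  fixes M M' a b c d a' b' c' d' :: "'a::comm_ring_1"
  shows "(M * d * a + M' * d' * a) - (M * d * b + M' * d' * b') - (M' * d * b + M * d' * b') + (M' * d * c + M * d' * c)
    + ((M' * d * a + M * d' * a) - (M' * d * b + M * d' * b') - (M * d * b + M' * d' * b') + (M * d * c + M' * d' * c))
    = (M + M') * (d * (a - 2 * b + c) + d' * (a - 2 * b' + c))"
  by (simp add: algebra_simps)

lemma psi_serre:
  assumes S: "finite S" "inj_on x S" and c: "cartan i j = -1"
  shows "psi x (br (egen i r) (br (egen i r') (egen j s)) + br (egen i r') (br (egen i r) (egen j s))) S = 0"
    (is "psi x ?f S = 0")
proof (cases "colors S = {#i, i, j#}")
  case False
  have "homog x ({#i#} + ({#i#} + {#j#})) ?f" by (intro homog_add homog_br homog_egen)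
  then show ?thesis by (rule homogD) (use False S in \<open>simp_all add: add_mset_commute\<close>)
next
  case True
  then obtain a b c where abc: "S = {a, b, c}" "distinct [a, b, c]" "snd a = i" "snd b = i" "snd c = j"
    using colors_3[OF S(1) True] by metis
  have ij: "i \<noteq> j" "j \<noteq> i" using c by (auto simp: cartan_def)
  define X where "X = x a" define Y where "Y = x b" define Z where "Z = x c"
  have ne: "X - Y \<noteq> 0" "X - Z \<noteq> 0" "Y - Z \<noteq> 0"
    using S abc by (auto simp: inj_on_def X_def Y_def Z_def)
  define h where "h = fls_const (1 / 2 :: complex)"
  have h: "2 * h = 1" using fls_const_mult_const[of "2::complex" "1/2"] by (simp add: h_def)
  define P where "P = h / (X - Z)" define Q where "Q = h / (Y - Z)" define D where "D = 1 / (X - Y)"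
  have D: "D * (P - Q) = - 2 * P * Q"
  proof -
    have e: "(X - Z) * P = h" "(Y - Z) * Q = h" "(X - Y) * D = 1" using ne by (simp_all add: P_def Q_def D_def)
    have "P - Q = 2 * h * P - 2 * h * Q" unfolding h by simp
    also have "2 * h * P = 2 * ((Y - Z) * Q) * P" unfolding e ..
    also have "2 * h * Q = 2 * ((X - Z) * P) * Q" unfolding e ..
    finally have "P - Q = - 2 * P * Q * (X - Y)" by (simp add: algebra_simps)
    then have "D * (P - Q) = - 2 * P * Q * ((X - Y) * D)" by (simp only: mult_ac)
    then show ?thesis unfolding e by simp
  qed
  have neg: "h / (Z - X) = - P" "h / (Z - Y) = - Q" "1 / (Y - X) = - D"
    using minus_divide_right[of h "X - Z"] minus_divide_right[of h "Y - Z"] minus_divide_right[of 1 "X - Y"]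
    by (simp_all add: P_def Q_def D_def)
  have cij: "cartan j i = -1" "cartan i i = 2" using c by (simp_all add: cartan_sym[of j]) (simp add: cartan_def)
  have z: "zeta x a b = 1 + D" "zeta x b a = 1 - D" "zeta x a c = 1 - P" "zeta x c a = 1 + P"
    "zeta x b c = 1 - Q" "zeta x c b = 1 + Q"
    using abc c cij neg
    by (simp_all add: zeta_def X_def[symmetric] Y_def[symmetric] Z_def[symmetric] h_def[symmetric] P_def[symmetric]
        Q_def[symmetric] D_def[symmetric])
  have sets: "{a, b, c} - {a} = {b, c}" "{a, b, c} - {b} = {a, c}" "{a, b, c} - {c} = {a, b}"
     "{b, c} - {b} = {c}" "{b, c} - {c} = {b}" "{a, c} - {a} = {c}" "{a, c} - {c} = {a}"
     "{a, b} - {a} = {b}" "{a, b} - {b} = {a}" and d: "a \<noteq> b" "a \<noteq> c" "b \<noteq> c" "b \<noteq> a" "c \<noteq> a" "c \<noteq> b" using abc(2) by auto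
  have iij: "psi x (egen i u * (egen i v * egen j w)) {a, b, c} =
     X ^ u * Y ^ v * Z ^ w * (1 + D) * (1 - P) * (1 - Q) + Y ^ u * X ^ v * Z ^ w * (1 - D) * (1 - P) * (1 - Q)" for u v w
    using d abc(3-5) ij
    by (simp add: psi_egen_mult psi_egen_single zprod_def sets z X_def Y_def Z_def mult_ac)
  have iji: "psi x (egen i u * (egen j w * egen i v)) {a, b, c} =
     X ^ u * Y ^ v * Z ^ w * (1 + D) * (1 - P) * (1 + Q) + Y ^ u * X ^ v * Z ^ w * (1 - D) * (1 + P) * (1 - Q)" for u v w
    using d abc(3-5) ij
    by (simp add: psi_egen_mult psi_egen_single zprod_def sets z X_def Y_def Z_def mult_ac)
  have jii: "psi x (egen j w * (egen i u * egen i v)) {a, b, c} =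
     X ^ u * Y ^ v * Z ^ w * (1 + D) * (1 + P) * (1 + Q) + Y ^ u * X ^ v * Z ^ w * (1 - D) * (1 + P) * (1 + Q)" for u v w
    using d abc(3-5) ij
    by (simp add: psi_egen_mult psi_egen_single zprod_def sets z X_def Y_def Z_def algebra_simps)
  have br2: "br e1 (br e2 f) = e1 * (e2 * f) - e1 * (f * e2) - e2 * (f * e1) + f * (e2 * e1)" for e1 e2 f :: ncpoly
    by (simp add: br_def algebra_simps)
  have "psi x ?f S = (X ^ r * Y ^ r' * Z ^ s + Y ^ r * X ^ r' * Z ^ s) * 4 * (2 * P * Q + D * (P - Q))"
    unfolding abc(1) psi_add psi_diff br2 iij iji jii mult.assoc[of "(_ + _)" "4"] serre_factor[symmetric] serre_collect[symmetric]
    by (simp only: mult_ac)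
  then show ?thesis unfolding D by simp
qed

lemma yangian_rels_psi:
  assumes "a \<in> yangian_rels n" "finite S" "inj_on x S"
  shows "\<exists>f. a = fa_of f \<and> psi x f S = 0"
proof -
  from assms(1) consider i j r s where "a = fa_of (br (egen i (Suc r)) (egen j s) - br (egen i r) (egen j (Suc s))
    - scale (of_int (cartan i j) / 2) (egen i r * egen j s + egen j s * egen i r))"
    | i j r s where "a = fa_of (br (egen i r) (egen j s))" "cartan i j = 0"
    | i j r r' s where "a = fa_of (br (egen i r) (br (egen i r') (egen j s)) + br (egen i r') (br (egen i r) (egen j s)))"
      "cartan i j = -1"
    unfolding yangian_rels_def minus_ncpoly.rep_eq plus_ncpoly.rep_eq times_ncpoly.rep_eq scale.rep_eq
        fa_comm_fa_of[symmetric] egen.rep_eq Suc_eq_plus1 by blast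
  then show ?thesis using psi_quad psi_comm psi_serre assms(2,3) by metis
qed

text \<open>The value of a product at \<open>S\<close> involves all subsets of \<open>S\<close>, so
  vanishing is proved for all \<open>S\<close> at once. The form \<open>fa_of f\<close> is carried
  along because the ideal is defined on raw functions.\<close>

lemma psi_yangian_ideal:
  assumes "a \<in> yangian_ideal n"
  shows "\<exists>f. a = fa_of f \<and> (\<forall>S. finite S \<longrightarrow> inj_on x S \<longrightarrow> psi x f S = 0)"
  using assms
proof (induction rule: yangian_ideal.induct)
  case (rel a)
  then obtain f where f: "a = fa_of f" using yangian_rels_psi[of a n "{}" x] by auto
  then show ?case using yangian_rels_psi[OF rel] fa_of_eq_iff by (intro exI[of _ f]) fastforce
next
  case zero
  show ?case by (intro exI[of _ 0]) (simp add: zero_ncpoly.rep_eq psi_0)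
next
  case (add a b)
  then obtain f g where "a = fa_of f" "\<forall>S. finite S \<longrightarrow> inj_on x S \<longrightarrow> psi x f S = 0"
    "b = fa_of g" "\<forall>S. finite S \<longrightarrow> inj_on x S \<longrightarrow> psi x g S = 0" by auto
  then show ?case by (intro exI[of _ "f + g"]) (simp add: plus_ncpoly.rep_eq psi_add)
next
  case (lmult a b)
  then obtain g where "b = fa_of g" "\<forall>S. finite S \<longrightarrow> inj_on x S \<longrightarrow> psi x g S = 0" by auto
  then show ?case using lmult(1)
    by (intro exI[of _ "Ncpoly a * g"])
      (auto simp: times_ncpoly.rep_eq fa_of_Ncpoly psi_mult intro!: sum.neutral intro: inj_on_subset)
next
  case (rmult a b)
  then obtain g where "b = fa_of g" "\<forall>S. finite S \<longrightarrow> inj_on x S \<longrightarrow> psi x g S = 0" by auto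
  moreover from this have "psi x (g * Ncpoly a) S = 0" if "finite S" "inj_on x S" for S
    unfolding psi_mult[OF that(1)]
    using that by (intro sum.neutral ballI) (metis PowD finite_subset inj_on_subset mult_zero_left)
  ultimately show ?case using rmult(1)
    by (intro exI[of _ "g * Ncpoly a"]) (auto simp: times_ncpoly.rep_eq fa_of_Ncpoly)
qed

lemma psi_yideal: "f \<in> yideal n \<Longrightarrow> finite S \<Longrightarrow> inj_on x S \<Longrightarrow> psi x f S = 0"
  using psi_yangian_ideal[of "fa_of f" n x] by (auto simp: yideal_def fa_of_eq_iff)

section \<open>Integrality and root vectors\<close>

lemma prod_linear_coeffs:
  fixes c :: "'a \<Rightarrow> 'b::field"
  assumes "finite T"
  shows "degree (\<Prod>b\<in>T. [:c b, 1:]) \<le> card T \<and> coeff (\<Prod>b\<in>T. [:c b, 1:]) (card T) = 1 \<and>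
    (\<forall>k. Suc k = card T \<longrightarrow> coeff (\<Prod>b\<in>T. [:c b, 1:]) k = (\<Sum>b\<in>T. c b))"
  using assms
proof (induction T rule: finite_induct)
  case (insert a T)
  let ?p = "\<Prod>b\<in>T. [:c b, 1:]"
  have eq: "(\<Prod>b\<in>insert a T. [:c b, 1:]) = smult (c a) ?p + pCons 0 ?p"
    using insert by simp
  have d: "degree ?p \<le> card T" using insert by simp
  have "degree (smult (c a) ?p) \<le> Suc (card T)" using d degree_smult_le[of "c a" ?p] by linarith
  moreover have "degree (pCons 0 ?p) \<le> Suc (card T)" using d degree_pCons_le[of 0 ?p] by linarith
  ultimately have 1: "degree (smult (c a) ?p + pCons 0 ?p) \<le> Suc (card T)" by (rule degree_add_le)
  have 2: "coeff ?p (Suc (card T)) = 0" using d by (intro coeff_eq_0) simp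
  have 3: "coeff (pCons 0 ?p) (card T) = (\<Sum>b\<in>T. c b)"
  proof (cases "card T")
    case 0
    then show ?thesis using insert by simp
  next
    case (Suc k)
    then show ?thesis using insert by simp
  qed
  show ?case using insert 1 2 3 unfolding eq by simp
qed simp

text \<open>The interpolation polynomial through the values of \<open>g\<close> at the nodes is
  \<open>g\<close> itself; the claim compares the coefficients at exponent
  \<open>card S - 1\<close>.\<close>

lemma lagrange_lead_coeff:
  fixes x :: "'a \<Rightarrow> 'b::field"
  assumes S: "finite S" "inj_on x S" and g: "degree g < card S"
  shows "(\<Sum>a\<in>S. poly g (x a) / (\<Prod>b\<in>S - {a}. x a - x b)) = coeff g (card S - 1)"
proof -
  define q where "q a = (\<Prod>b\<in>S - {a}. [:- x b, 1:])" for a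
  define d where "d a = (\<Prod>b\<in>S - {a}. x a - x b)" for a
  define L where "L = (\<Sum>a\<in>S. smult (poly g (x a) / d a) (q a))"
  have pq: "poly (q a) (x c) = (if c = a then d a else 0)" if "a \<in> S" "c \<in> S" for a c
    using that S by (auto simp: q_def d_def poly_prod intro!: prod.cong)
  have d0: "d a \<noteq> 0" if "a \<in> S" for a using that S by (auto simp: d_def inj_on_def)
  have L: "poly L (x c) = poly g (x c)" if "c \<in> S" for c
  proof -
    have "poly L (x c) = (\<Sum>a\<in>S. if c = a then poly g (x a) else 0)"
      using that by (auto simp: L_def poly_sum pq d0 intro!: sum.cong)
    then show ?thesis using that S by simp
  qed
  have q: "degree (q a) \<le> card S - 1" "coeff (q a) (card S - 1) = 1" if "a \<in> S" for a
    using prod_linear_coeffs[of "S - {a}" "\<lambda>b. - x b"] S that by (simp_all add: q_def)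
  have "degree L \<le> card S - 1"
    unfolding L_def
    by (rule degree_sum_le) (use S q degree_smult_le order_trans in \<open>blast+\<close>)
  then have "degree L < card S" using g by simp
  then have "L = g"
    using poly_eqI_degree[of "x ` S" L g] L g card_image[OF S(2)] by auto
  moreover have "coeff L (card S - 1) = (\<Sum>a\<in>S. poly g (x a) / d a * coeff (q a) (card S - 1))"
    by (simp add: L_def coeff_sum)
  ultimately have "coeff g (card S - 1) = (\<Sum>a\<in>S. poly g (x a) / d a * coeff (q a) (card S - 1))" by simp
  also have "\<dots> = (\<Sum>a\<in>S. poly g (x a) / d a)" using q(2) by simp
  finally show ?thesis by (simp add: d_def)
qed

lemma sum_prod_one_plus_inverse:
  fixes x :: "'a \<Rightarrow> 'b::field"
  assumes S: "finite S" "inj_on x S"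
  shows "(\<Sum>a\<in>S. \<Prod>b\<in>S - {a}. 1 + 1 / (x a - x b)) = of_nat (card S)"
proof (cases "S = {}")
  case False
  then have c: "card S > 0" using S by (simp add: card_gt_0_iff)
  \<comment> \<open>The second product vanishes at the nodes and cancels the leading term of the
    first. The next coefficient is the sum of the \<open>1 - x b\<close> minus the sum of the
    \<open>- x b\<close>, which is \<open>card S\<close>.\<close>
  define g where "g = (\<Prod>b\<in>S. [:1 - x b, 1:]) - (\<Prod>b\<in>S. [:- x b, 1:])"
  have 1: "degree g \<le> card S" unfolding g_def
    using prod_linear_coeffs[OF S(1), of "\<lambda>b. 1 - x b"] prod_linear_coeffs[OF S(1), of "\<lambda>b. - x b"]
    by (intro degree_diff_le) auto
  have 2: "coeff g (card S) = 0" unfolding g_def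
    using prod_linear_coeffs[OF S(1), of "\<lambda>b. 1 - x b"] prod_linear_coeffs[OF S(1), of "\<lambda>b. - x b"] by simp
  have "Suc (card S - 1) = card S" using c by simp
  then have 3: "coeff g (card S - 1) = of_nat (card S)" unfolding g_def
    using prod_linear_coeffs[OF S(1), of "\<lambda>b. 1 - x b"] prod_linear_coeffs[OF S(1), of "\<lambda>b. - x b"]
    by (simp add: sum_subtractf sum_negf)
  have "degree g < card S" using eq_zero_or_degree_less[OF 1 2] c by auto
  from lagrange_lead_coeff[OF S this]
  have "(\<Sum>a\<in>S. poly g (x a) / (\<Prod>b\<in>S - {a}. x a - x b)) = of_nat (card S)" using 3 by simp
  moreover have "poly g (x a) / (\<Prod>b\<in>S - {a}. x a - x b) = (\<Prod>b\<in>S - {a}. 1 + 1 / (x a - x b))" if a: "a \<in> S" for a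
  proof -
    have "(\<Prod>b\<in>S. x a - x b) = 0" using S a by auto
    then have "poly g (x a) = (\<Prod>b\<in>S. 1 + (x a - x b))"
      by (simp add: g_def poly_prod algebra_simps)
    also have "\<dots> = (\<Prod>b\<in>S - {a}. 1 + (x a - x b))" using prod.remove[OF S(1) a, of "\<lambda>b. 1 + (x a - x b)"] by simp
    finally have "poly g (x a) / (\<Prod>b\<in>S - {a}. x a - x b) = (\<Prod>b\<in>S - {a}. (1 + (x a - x b)) / (x a - x b))"
      by (simp add: prod_dividef)
    also have "\<dots> = (\<Prod>b\<in>S - {a}. 1 + 1 / (x a - x b))"
      using S a by (intro prod.cong refl) (auto simp: inj_on_def add_divide_distrib)
    finally show ?thesis .
  qed
  ultimately show ?thesis by simp
qed simp

text \<open>Equal colours give \<open>zeta x a b = 1 + 1 / (x a - x b)\<close>, so the choice of the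
  first point contributes the sum evaluated in \<open>sum_prod_one_plus_inverse\<close>, a factor
  \<open>Suc t\<close>. The resulting \<open>t!\<close> is exactly what the divided power
  removes.\<close>

lemma psi_egen_power:
  assumes "finite S" "inj_on x S"
  shows "psi x (egen i r ^ t) S = (if card S = t \<and> (\<forall>a\<in>S. snd a = i) then of_nat (fact t) * (\<Prod>a\<in>S. x a ^ r) else 0)"
  using assms
proof (induction t arbitrary: S)
  case 0
  then show ?case by (auto simp: psi_1)
next
  case (Suc t)
  let ?b = "\<lambda>a. if snd a = i then x a ^ r * (if card (S - {a}) = t \<and> (\<forall>a\<in>S - {a}. snd a = i)
      then of_nat (fact t) * (\<Prod>a\<in>S - {a}. x a ^ r) else 0) * zprod x {a} (S - {a}) else 0"
  have "psi x (egen i r ^ Suc t) S =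
    (\<Sum>a\<in>S. if snd a = i then x a ^ r * psi x (egen i r ^ t) (S - {a}) * zprod x {a} (S - {a}) else 0)"
    using Suc.prems by (simp add: psi_egen_mult)
  also have "\<dots> = (\<Sum>a\<in>S. ?b a)"
    using Suc.prems by (intro sum.cong refl) (simp add: Suc.IH inj_on_diff)
  also have "\<dots> = (if card S = Suc t \<and> (\<forall>a\<in>S. snd a = i) then of_nat (fact (Suc t)) * (\<Prod>a\<in>S. x a ^ r) else 0)"
  proof (cases "card S = Suc t \<and> (\<forall>a\<in>S. snd a = i)")
    case True
    have "(\<Sum>a\<in>S. ?b a) = (\<Sum>a\<in>S. of_nat (fact t) * (\<Prod>a\<in>S. x a ^ r) * (\<Prod>b\<in>S - {a}. 1 + 1 / (x a - x b)))"
    proof (rule sum.cong[OF refl])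
      fix a assume a: "a \<in> S"
      have "zprod x {a} (S - {a}) = (\<Prod>b\<in>S - {a}. 1 + 1 / (x a - x b))"
        unfolding zprod_def using True a by (auto simp: zeta_def cartan_def intro!: prod.cong)
      moreover have "(\<Prod>a\<in>S. x a ^ r) = x a ^ r * (\<Prod>a\<in>S - {a}. x a ^ r)"
        using a Suc.prems by (simp add: prod.remove)
      ultimately show "?b a = of_nat (fact t) * (\<Prod>a\<in>S. x a ^ r) * (\<Prod>b\<in>S - {a}. 1 + 1 / (x a - x b))"
        using True a by (simp add: mult_ac)
    qed
    also have "\<dots> = of_nat (fact t) * (\<Prod>a\<in>S. x a ^ r) * of_nat (card S)"
      unfolding sum_distrib_left[symmetric] sum_prod_one_plus_inverse[OF Suc.prems] ..
    also have "\<dots> = of_nat (fact (Suc t)) * (\<Prod>a\<in>S. x a ^ r)"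
      using True by (simp add: algebra_simps)
    finally show ?thesis using True by simp
  next
    case False
    have "\<not> (snd a = i \<and> card (S - {a}) = t \<and> (\<forall>a\<in>S - {a}. snd a = i))" if a: "a \<in> S" for a
    proof
      assume b: "snd a = i \<and> card (S - {a}) = t \<and> (\<forall>a\<in>S - {a}. snd a = i)"
      then have "card S = Suc t" using a Suc.prems(1) by (metis card_Suc_Diff1)
      moreover have "\<forall>a\<in>S. snd a = i" using b by blast
      ultimately show False using False by blast
    qed
    then show ?thesis using False by (intro trans[OF sum.neutral]) auto
  qed
  finally show ?case .
qed

lemma psi_divpow_egen:
  assumes "finite S" "inj_on x S"
  shows "psi x (divpow (egen i r) t) S = (if card S = t \<and> (\<forall>a\<in>S. snd a = i) then (\<Prod>a\<in>S. x a ^ r) else 0)"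
proof -
  have "fls_const (1 / fact t) * of_nat (fact t) = (1 :: kfld)"
    unfolding fls_of_nat fls_const_mult_const by simp
  then show ?thesis
    unfolding divpow_def psi_scale psi_egen_power[OF assms] by (simp add: mult.assoc[symmetric] del: of_nat_fact)
qed

section \<open>Integrality of the functionals on the integral form\<close>

definition zh :: "complex set" where "zh = {zhalf z m | z m. True}"

lemma zh_add: "a \<in> zh \<Longrightarrow> b \<in> zh \<Longrightarrow> a + b \<in> zh"
proof -
  assume "a \<in> zh" "b \<in> zh"
  then obtain z m z' m' where "a = zhalf z m" "b = zhalf z' m'" by (auto simp: zh_def)
  moreover have "zhalf z m + zhalf z' m' = zhalf (z * 2 ^ m' + z' * 2 ^ m) (m + m')"
    by (simp add: zhalf_def add_divide_distrib power_add)
  ultimately have "a + b = zhalf (z * 2 ^ m' + z' * 2 ^ m) (m + m')" by simp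
  then show ?thesis by (auto simp: zh_def)
qed
lemma zh_mult: "a \<in> zh \<Longrightarrow> b \<in> zh \<Longrightarrow> a * b \<in> zh"
proof -
  assume "a \<in> zh" "b \<in> zh"
  then obtain z m z' m' where "a = zhalf z m" "b = zhalf z' m'" by (auto simp: zh_def)
  then have "a * b = zhalf (z * z') (m + m')" by (simp add: zhalf_def power_add)
  then show ?thesis by (auto simp: zh_def)
qed
lemma zh_of_int: "of_int z \<in> zh"
  unfolding zh_def by (intro CollectI exI[of _ z] exI[of _ 0]) (simp add: zhalf_def)
lemma zh_half_int: "of_int z / 2 \<in> zh"
  unfolding zh_def by (intro CollectI exI[of _ z] exI[of _ 1]) (simp add: zhalf_def)
lemma zh_0: "0 \<in> zh" and zh_1: "1 \<in> zh" using zh_of_int[of 0] zh_of_int[of 1] by auto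
lemma zh_uminus: "a \<in> zh \<Longrightarrow> - a \<in> zh" using zh_mult[OF zh_of_int[of "-1"]] by simp
lemma zh_sum: "(\<And>i. i \<in> A \<Longrightarrow> f i \<in> zh) \<Longrightarrow> sum f A \<in> zh"
  by (induction A rule: infinite_finite_induct) (auto simp: zh_0 zh_add)

definition zint :: "kfld \<Rightarrow> bool" where "zint f \<longleftrightarrow> (\<forall>k. fls_nth f k \<in> zh)"

lemma zint_add: "zint f \<Longrightarrow> zint g \<Longrightarrow> zint (f + g)" by (simp add: zint_def zh_add)
lemma zint_uminus: "zint f \<Longrightarrow> zint (- f)" by (simp add: zint_def zh_uminus)
lemma zint_diff: "zint f \<Longrightarrow> zint g \<Longrightarrow> zint (f - g)" using zint_add[of f "- g"] by (simp add: zint_uminus)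
lemma zint_mult: "zint f \<Longrightarrow> zint g \<Longrightarrow> zint (f * g)"
  by (simp add: zint_def fls_times_nth(1) zh_sum zh_mult)
lemma zint_const: "c \<in> zh \<Longrightarrow> zint (fls_const c)" by (simp add: zint_def zh_0)
lemma zint_1: "zint 1" using zint_const[OF zh_1] by simp
lemma zint_0: "zint 0" by (simp add: zint_def zh_0)
lemma zint_power: "zint f \<Longrightarrow> zint (f ^ t)" by (induction t) (auto simp: zint_1 zint_mult)
lemma zint_prod: "(\<And>i. i \<in> A \<Longrightarrow> zint (f i)) \<Longrightarrow> zint (prod f A)"
  by (induction A rule: infinite_finite_induct) (auto simp: zint_1 zint_mult)
lemma zint_sum: "(\<And>i. i \<in> A \<Longrightarrow> zint (f i)) \<Longrightarrow> zint (sum f A)"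
  by (induction A rule: infinite_finite_induct) (auto simp: zint_0 zint_add)

text \<open>Integrality is asked of \<open>zeta\<close>, not of every
  \<open>1 / (x a - x b)\<close>: for Cartan entry 0 the value is 1 whatever the difference. At the
  points chosen later such a difference can be \<open>k T^t\<close> with \<open>k\<close> not a unit
  of Z[1/2].\<close>

lemma psi_zint:
  assumes P: "inj_on x P" "\<And>a. a \<in> P \<Longrightarrow> zint (x a)" "\<And>a b. a \<in> P \<Longrightarrow> b \<in> P \<Longrightarrow> a \<noteq> b \<Longrightarrow> zint (zeta x a b)"
    and a: "a \<in> Yform_pre n"
  shows "\<exists>f. a = fa_of f \<and> (\<forall>S. finite S \<longrightarrow> S \<subseteq> P \<longrightarrow> zint (psi x f S))"
  using a
proof (induction rule: Yform_pre.induct)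
  case (gen i r t)
  have "zint (psi x (divpow (egen i r) t) S)" if "finite S" "S \<subseteq> P" for S
  proof -
    have "inj_on x S" using P(1) that by (auto intro: inj_on_subset)
    then show ?thesis unfolding psi_divpow_egen[OF that(1) \<open>inj_on x S\<close>]
      using P(2) that by (auto intro!: zint_0 zint_prod zint_power)
  qed
  then show ?case by (intro exI[of _ "divpow (egen i r) t"]) (simp add: fa_divpow_fa_of[symmetric] egen.rep_eq)
next
  case one
  show ?case by (intro exI[of _ 1]) (simp add: one_ncpoly.rep_eq psi_1 zint_0 zint_1)
next
  case (ideal a)
  from psi_yangian_ideal[OF this, of x] obtain f
    where "a = fa_of f" "\<forall>S. finite S \<longrightarrow> inj_on x S \<longrightarrow> psi x f S = 0" by blast
  then show ?case using inj_on_subset[OF P(1)] by (intro exI[of _ f]) (simp add: zint_0)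
next
  case (add a b)
  then obtain f g where "a = fa_of f" "b = fa_of g" "\<forall>S. finite S \<longrightarrow> S \<subseteq> P \<longrightarrow> zint (psi x f S)"
    "\<forall>S. finite S \<longrightarrow> S \<subseteq> P \<longrightarrow> zint (psi x g S)" by blast
  then show ?case by (intro exI[of _ "f + g"]) (simp add: plus_ncpoly.rep_eq psi_add zint_add)
next
  case (mult a b)
  then obtain f g where f: "a = fa_of f" "b = fa_of g" "\<forall>S. finite S \<longrightarrow> S \<subseteq> P \<longrightarrow> zint (psi x f S)"
    "\<forall>S. finite S \<longrightarrow> S \<subseteq> P \<longrightarrow> zint (psi x g S)" by blast
  have "zint (psi x (f * g) S)" if S: "finite S" "S \<subseteq> P" for S
    unfolding psi_mult[OF S(1)]
  proof (intro zint_sum zint_mult)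
    fix A assume A: "A \<in> Pow S"
    show "zint (psi x f A)" using f(3) A S by (auto intro: finite_subset)
    show "zint (psi x g (S - A))" using f(4) S by auto
    show "zint (zprod x A (S - A))" unfolding zprod_def using A S by (intro zint_prod P(3)) auto
  qed
  then show ?case using f by (intro exI[of _ "f * g"]) (simp add: times_ncpoly.rep_eq)
next
  case (smult a z m)
  then obtain f where "a = fa_of f" "\<forall>S. finite S \<longrightarrow> S \<subseteq> P \<longrightarrow> zint (psi x f S)" by blast
  moreover have "zhalf z m \<in> zh" by (auto simp: zh_def)
  ultimately show ?case
    by (intro exI[of _ "scale (zhalf z m) f"]) (simp add: scale.rep_eq psi_scale zint_mult zint_const)
qed

section \<open>Values of the functionals on root vectors\<close>

lemma psi_mult_egen:
  assumes "finite S"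
  shows "psi x (g * egen i r) S = (\<Sum>a\<in>S. if snd a = i then x a ^ r * psi x g (S - {a}) * zprod x (S - {a}) {a} else 0)"
proof -
  have "psi x (g * egen i r) S = (\<Sum>A\<in>(\<lambda>a. S - {a}) ` S. psi x g A * psi x (egen i r) (S - A) * zprod x A (S - A))"
    unfolding psi_mult[OF assms]
  proof (rule sum.mono_neutral_right)
    show "\<forall>A\<in>Pow S - (\<lambda>a. S - {a}) ` S. psi x g A * psi x (egen i r) (S - A) * zprod x A (S - A) = 0"
    proof
      fix A assume A: "A \<in> Pow S - (\<lambda>a. S - {a}) ` S"
      have "S - A \<noteq> {a}" for a
      proof
        assume "S - A = {a}"
        then have "A = S - {a}" "a \<in> S" using A by auto
        then show False using A by auto
      qed
      then show "psi x g A * psi x (egen i r) (S - A) * zprod x A (S - A) = 0" by (simp add: psi_egen)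
    qed
  qed (use assms in auto)
  also have "\<dots> = (\<Sum>a\<in>S. psi x g (S - {a}) * psi x (egen i r) (S - (S - {a})) * zprod x (S - {a}) (S - (S - {a})))"
    by (subst sum.reindex) (auto simp: inj_on_def)
  also have "\<dots> = (\<Sum>a\<in>S. if snd a = i then x a ^ r * psi x g (S - {a}) * zprod x (S - {a}) {a} else 0)"
  proof (rule sum.cong[OF refl])
    fix a assume "a \<in> S"
    then have "S - (S - {a}) = {a}" by auto
    then show "psi x g (S - {a}) * psi x (egen i r) (S - (S - {a})) * zprod x (S - {a}) (S - (S - {a})) =
      (if snd a = i then x a ^ r * psi x g (S - {a}) * zprod x (S - {a}) {a} else 0)"
      by (simp add: psi_egen_single)
  qed
  finally show ?thesis .
qed

definition transv :: "nat \<Rightarrow> nat \<Rightarrow> label set \<Rightarrow> bool" where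
  "transv i j S \<longleftrightarrow> inj_on snd S \<and> snd ` S = {i..j}"

text \<open>Meaningful only when \<open>S\<close> has exactly one point of colour \<open>k\<close>,
  as on a transversal whose colours include \<open>k\<close>.\<close>

definition pt :: "label set \<Rightarrow> nat \<Rightarrow> label" where "pt S k = (THE a. a \<in> S \<and> snd a = k)"

lemma pt_eqI: "inj_on snd S \<Longrightarrow> a \<in> S \<Longrightarrow> snd a = k \<Longrightarrow> pt S k = a"
  unfolding pt_def by (rule the_equality) (auto simp: inj_on_def)

lemma pt_in: "transv i j S \<Longrightarrow> k \<in> {i..j} \<Longrightarrow> pt S k \<in> S \<and> snd (pt S k) = k"
proof -
  assume t: "transv i j S" and "k \<in> {i..j}"
  then have "k \<in> snd ` S" by (simp add: transv_def)
  then obtain a where "a \<in> S" "snd a = k" by blast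
  then show ?thesis using pt_eqI[of S a k] t by (auto simp: transv_def)
qed

lemma transv_mem: "transv i j S \<Longrightarrow> b \<in> S \<Longrightarrow> snd b \<in> {i..j} \<and> pt S (snd b) = b"
  unfolding transv_def by (metis imageI pt_eqI)

lemma zeta_br:
  assumes "x a \<noteq> x b" "cartan (snd a) (snd b) = -1"
  shows "zeta x a b - zeta x b a = - 1 / (x a - x b)"
proof -
  define h where "h = fls_const (1 / 2 :: complex)"
  have h: "2 * h = 1" using fls_const_mult_const[of "2::complex" "1/2"] by (simp add: h_def)
  define w where "w = h / (x a - x b)"
  have w': "h / (x b - x a) = - w" using minus_divide_right[of h "x a - x b"] by (simp add: w_def)
  have "zeta x a b = 1 - w" "zeta x b a = 1 + w"
    using assms(2) w' by (simp_all add: zeta_def h_def[symmetric] w_def[symmetric] cartan_sym[of "snd b"])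
  then have "zeta x a b - zeta x b a = - (2 * w)" by simp
  moreover have "2 * w = (2 * h) / (x a - x b)" by (simp add: w_def)
  ultimately show ?thesis unfolding h by simp
qed

text \<open>Bracketing with a generator at a new point \<open>a\<close> contributes the difference
  of the \<open>zeta\<close> products for the two orders. On a transversal only the point
  \<open>b\<close> of the preceding colour interacts with \<open>a\<close>, and the difference is
  \<open>- 1 / (x b - x a)\<close>; the iterated bracket thus becomes a product over neighbouring
  colours.\<close>

lemma psi_rootv:
  "i \<le> j \<Longrightarrow> finite S \<Longrightarrow> inj_on x S \<Longrightarrow> psi x (rootv ((i, j), r)) S =
    (if transv i j S then x (pt S i) ^ r * (\<Prod>k\<in>{i..<j}. - 1 / (x (pt S k) - x (pt S (Suc k)))) else 0)"
proof (induction j arbitrary: S rule: dec_induct)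
  case base
  show ?case
  proof (cases "\<exists>a. S = {a} \<and> snd a = i")
    case True
    then obtain a where a: "S = {a}" "snd a = i" by blast
    then have "transv i i S" "pt S i = a" by (auto simp: transv_def intro!: pt_eqI)
    then show ?thesis using a by (simp add: rootv_simple psi_egen_single)
  next
    case False
    have "\<not> transv i i S"
    proof
      assume t: "transv i i S"
      have "pt S i \<in> S" "snd (pt S i) = i" using pt_in[OF t, of i] by auto
      moreover have "b = pt S i" if "b \<in> S" for b using transv_mem[OF t that] by auto
      ultimately show False using False by blast
    qed
    then show ?thesis using False by (simp add: rootv_simple psi_egen)
  qed
next
  case (step m)
  let ?A = "rootv ((i, m), r)"
  let ?v = "\<lambda>S. x (pt S i) ^ r * (\<Prod>k\<in>{i..<m}. - 1 / (x (pt S k) - x (pt S (Suc k))))"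
  have "psi x (rootv ((i, Suc m), r)) S = (\<Sum>a\<in>S. if snd a = Suc m then
      psi x ?A (S - {a}) * (zprod x (S - {a}) {a} - zprod x {a} (S - {a})) else 0)"
  proof -
    have "psi x (rootv ((i, Suc m), r)) S = psi x (?A * egen (Suc m) 0) S - psi x (egen (Suc m) 0 * ?A) S"
      using step.hyps by (simp add: rootv_Suc br_def psi_diff)
    also have "\<dots> = (\<Sum>a\<in>S. (if snd a = Suc m then x a ^ 0 * psi x ?A (S - {a}) * zprod x (S - {a}) {a} else 0) -
        (if snd a = Suc m then x a ^ 0 * psi x ?A (S - {a}) * zprod x {a} (S - {a}) else 0))"
      unfolding psi_mult_egen[OF step.prems(1)] psi_egen_mult[OF step.prems(1)] sum_subtractf ..
    also have "\<dots> = (\<Sum>a\<in>S. if snd a = Suc m then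
      psi x ?A (S - {a}) * (zprod x (S - {a}) {a} - zprod x {a} (S - {a})) else 0)"
      by (rule sum.cong[OF refl]) (simp add: right_diff_distrib)
    finally show ?thesis .
  qed
  also have "\<dots> = (\<Sum>a\<in>S. if snd a = Suc m \<and> transv i m (S - {a}) then
      ?v (S - {a}) * (- 1 / (x (pt (S - {a}) m) - x a)) else 0)"
  proof (rule sum.cong[OF refl])
    fix a assume a: "a \<in> S"
    show "(if snd a = Suc m then psi x ?A (S - {a}) * (zprod x (S - {a}) {a} - zprod x {a} (S - {a})) else 0) =
      (if snd a = Suc m \<and> transv i m (S - {a}) then ?v (S - {a}) * (- 1 / (x (pt (S - {a}) m) - x a)) else 0)"
    proof (cases "snd a = Suc m \<and> transv i m (S - {a})")
      case True
      let ?b = "pt (S - {a}) m"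
      have b: "?b \<in> S - {a}" "snd ?b = m" using True pt_in[of i m "S - {a}" m] step(1) by auto
      have z1: "zeta x c a = 1 \<and> zeta x a c = 1" if "c \<in> S - {a} - {?b}" for c
      proof -
        have "snd c \<in> {i..m}" using that True by (auto simp: transv_def)
        moreover have "snd c \<noteq> m" using that True b by (auto simp: transv_def inj_on_def)
        ultimately have "cartan (snd c) (snd a) = 0" using True by (auto simp: cartan_def)
        then show ?thesis by (simp add: zeta_def cartan_sym[of "snd a"])
      qed
      have "zprod x (S - {a}) {a} = zeta x ?b a" "zprod x {a} (S - {a}) = zeta x a ?b"
        using prod.remove[OF _ b(1), of "\<lambda>c. zeta x c a"] prod.remove[OF _ b(1), of "\<lambda>c. zeta x a c"] z1 step.prems(1)
        by (simp_all add: zprod_def)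
      moreover have "zeta x ?b a - zeta x a ?b = - 1 / (x ?b - x a)"
        by (rule zeta_br) (use b a True step.prems(2) in \<open>auto simp: inj_on_def cartan_def\<close>)
      ultimately show ?thesis using True step.IH[of "S - {a}"] step.prems by (simp add: inj_on_diff)
    next
      case False
      then show ?thesis using step.IH[of "S - {a}"] step.prems by (auto simp: inj_on_diff)
    qed
  qed
  also have "\<dots> = (if transv i (Suc m) S then x (pt S i) ^ r * (\<Prod>k\<in>{i..<Suc m}. - 1 / (x (pt S k) - x (pt S (Suc k)))) else 0)"
  proof (cases "transv i (Suc m) S")
    case True
    let ?a = "pt S (Suc m)"
    have a: "?a \<in> S" "snd ?a = Suc m" using pt_in[OF True, of "Suc m"] step(1) by auto
    have inj: "inj_on snd S" using True by (simp add: transv_def)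
    have t: "transv i m (S - {?a})"
      using True a step(1) by (auto simp: transv_def inj_on_image_set_diff[of snd S] inj_on_diff)
    have p: "pt (S - {?a}) k = pt S k" if "k \<in> {i..m}" for k
      using pt_in[OF t that] inj by (intro pt_eqI[symmetric]) auto
    have u: "a' = ?a" if "a' \<in> S" "snd a' = Suc m" for a' using that a inj by (auto simp: inj_on_def)
    have "(\<Sum>a\<in>S. if snd a = Suc m \<and> transv i m (S - {a}) then ?v (S - {a}) * (- 1 / (x (pt (S - {a}) m) - x a)) else 0)
      = (\<Sum>a\<in>S. if a = ?a then ?v (S - {a}) * (- 1 / (x (pt (S - {a}) m) - x a)) else 0)"
    proof (rule sum.cong[OF refl])
      fix a assume "a \<in> S"
      then have "(snd a = Suc m \<and> transv i m (S - {a})) = (a = ?a)" using u[of a] a(2) t by metis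
      then show "(if snd a = Suc m \<and> transv i m (S - {a}) then ?v (S - {a}) * (- 1 / (x (pt (S - {a}) m) - x a)) else 0) =
         (if a = ?a then ?v (S - {a}) * (- 1 / (x (pt (S - {a}) m) - x a)) else 0)" by (simp only:)
    qed
    also have "\<dots> = ?v (S - {?a}) * (- 1 / (x (pt (S - {?a}) m) - x ?a))" by (subst sum.delta) (simp_all only: a(1) step.prems(1) if_True)
    also have "?v (S - {?a}) = ?v S" using p step(1) by (intro arg_cong2[of _ _ _ _ "(*)"] prod.cong) auto
    also have "pt (S - {?a}) m = pt S m" using p step(1) by auto
    finally show ?thesis using True step(1) by (simp add: prod.atLeastLessThan_Suc mult_ac)
  next
    case False
    have "\<not> (snd a = Suc m \<and> transv i m (S - {a}))" if "a \<in> S" for a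
    proof
      assume b: "snd a = Suc m \<and> transv i m (S - {a})"
      define R where "R = S - {a}"
      have R: "inj_on snd R" "snd ` R = {i..m}" "R - {a} = R" using b by (auto simp: transv_def R_def)
      have "transv i (Suc m) (insert a R)"
        using b R step(1) by (simp add: transv_def atLeastAtMostSuc_conv)
      moreover have "insert a R = S" using that by (auto simp: R_def)
      ultimately show False using False by simp
    qed
    then show ?thesis using False by (intro trans[OF sum.neutral]) auto
  qed
  finally show ?case .
qed

section \<open>Leading terms at well-separated points\<close>

text \<open>As the series variable is \<open>1/T\<close>, the index \<open>d\<close> is minus the
  degree in \<open>T\<close>.\<close>

definition lead :: "int \<Rightarrow> complex \<Rightarrow> kfld \<Rightarrow> bool" where
  "lead d c f \<longleftrightarrow> c \<noteq> 0 \<and> fls_nth f d = c \<and> (\<forall>k<d. fls_nth f k = 0)"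

lemma lead_iff: "lead d c f \<longleftrightarrow> f \<noteq> 0 \<and> fls_subdegree f = d \<and> fls_nth f d = c"
proof
  assume "lead d c f"
  then show "f \<noteq> 0 \<and> fls_subdegree f = d \<and> fls_nth f d = c"
    using fls_subdegree_eqI[of f d] by (auto simp: lead_def)
qed (auto simp: lead_def)

lemma lead_mult: "lead d c f \<Longrightarrow> lead e c' g \<Longrightarrow> lead (d + e) (c * c') (f * g)"
  unfolding lead_iff using fls_times_base[of f g] by auto

lemma lead_1: "lead 0 1 1" by (simp add: lead_def)

lemma lead_uminus: "lead d c f \<Longrightarrow> lead d (- c) (- f)" by (simp add: lead_def)

lemma lead_power: "lead d c f \<Longrightarrow> lead (int r * d) (c ^ r) (f ^ r)"
proof (induction r)
  case (Suc r)
  from lead_mult[OF Suc.prems Suc.IH[OF Suc.prems]] show ?case by (simp add: algebra_simps)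
qed (simp add: lead_1)

lemma lead_prod: "(\<And>a. a \<in> A \<Longrightarrow> lead (d a) (c a) (f a)) \<Longrightarrow> lead (sum d A) (prod c A) (prod f A)"
  by (induction A rule: infinite_finite_induct) (auto simp: lead_1 intro!: lead_mult)

lemma lead_inverse:
  assumes "lead d c f" shows "lead (- d) (inverse c) (inverse f)"
proof -
  define g where "g = inverse f"
  have f: "f \<noteq> 0" "c \<noteq> 0" using assms by (auto simp: lead_iff lead_def)
  then have g: "g \<noteq> 0" "f * g = 1" by (auto simp: g_def)
  then have "lead (fls_subdegree g) (fls_nth g (fls_subdegree g)) g" by (simp add: lead_iff)
  from lead_mult[OF assms this] g
  have "lead (d + fls_subdegree g) (c * fls_nth g (fls_subdegree g)) 1" by simp
  then have "d + fls_subdegree g = 0" "c * fls_nth g (fls_subdegree g) = 1" by (auto simp: lead_iff split: if_splits)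
  then have sd: "fls_subdegree g = - d" and "c * fls_nth g (fls_subdegree g) = 1" by auto
  then have "c * fls_nth g (- d) = 1" by (simp only: sd)
  moreover from this have "fls_nth g (- d) = inverse c" using f by (metis inverse_unique)
  ultimately show ?thesis using g sd by (simp add: lead_iff g_def[symmetric])
qed

text \<open>Comparing coefficients in \<open>f g = 1\<close> yields each coefficient of
  \<open>g\<close> from earlier ones, dividing only by the leading coefficient \<open>c\<close>. A
  sign is a unit, so nothing leaves Z[1/2].\<close>

lemma zint_inverse:
  assumes f: "zint f" and l: "lead d c f" and c: "c = 1 \<or> c = -1"
  shows "zint (inverse f)"
proof -
  define g where "g = inverse f"
  have lg: "lead (- d) (inverse c) g" unfolding g_def by (rule lead_inverse[OF l])
  have f0: "f \<noteq> 0" "fls_subdegree f = d" "fls_nth f d = c" "fls_subdegree g = - d"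
    using l lg by (auto simp: lead_iff)
  have fg: "f * g = 1" using f0 by (simp add: g_def)
  have nonneg: "fls_nth g (int m - d) \<in> zh" for m :: nat
  proof (induction m rule: less_induct)
    case (less m)
    have "(if int m = 0 then 1 else 0) = fls_nth (f * g) (int m)" unfolding fg by simp
    also have "\<dots> = (\<Sum>i=d..int m + d. fls_nth f i * fls_nth g (int m - i))"
      unfolding fls_times_nth(2) f0 by simp
    also have "\<dots> = c * fls_nth g (int m - d) + (\<Sum>i\<in>{d..int m + d} - {d}. fls_nth f i * fls_nth g (int m - i))"
      by (subst sum.remove[of _ d]) (auto simp: f0)
    finally have eq: "c * fls_nth g (int m - d) = (if int m = 0 then 1 else 0)
       + - (\<Sum>i\<in>{d..int m + d} - {d}. fls_nth f i * fls_nth g (int m - i))" by (simp add: algebra_simps)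
    have "(\<Sum>i\<in>{d..int m + d} - {d}. fls_nth f i * fls_nth g (int m - i)) \<in> zh"
    proof (intro zh_sum zh_mult)
      fix i assume i: "i \<in> {d..int m + d} - {d}"
      show "fls_nth f i \<in> zh" using f by (simp add: zint_def)
      have "int m - i = int (nat (int m - (i - d))) - d" "nat (int m - (i - d)) < m" using i by auto
      then show "fls_nth g (int m - i) \<in> zh" using less[of "nat (int m - (i - d))"] by metis
    qed
    then have "c * fls_nth g (int m - d) \<in> zh" unfolding eq
      by (intro zh_add zh_uminus) (simp_all add: zh_0 zh_1)
    then show ?case using c zh_uminus[of "- fls_nth g (int m - d)"] by auto
  qed
  have "fls_nth g k \<in> zh" for k
  proof (cases "k < - d")
    case True
    then show ?thesis using lg zh_0 by (simp add: lead_def)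
  next
    case False
    then have "k = int (nat (k + d)) - d" by simp
    then show ?thesis using nonneg[of "nat (k + d)"] by simp
  qed
  then show ?thesis by (simp add: zint_def g_def)
qed

section \<open>Partitions of a point set into transversals\<close>

type_synonym rootel = "(nat \<times> nat) \<times> nat"

abbreviation lo :: "rootel \<Rightarrow> nat" where "lo y \<equiv> fst (fst y)"
abbreviation hi :: "rootel \<Rightarrow> nat" where "hi y \<equiv> snd (fst y)"

abbreviation is_part :: "rootel \<Rightarrow> label set \<Rightarrow> bool" where "is_part y A \<equiv> transv (lo y) (hi y) A"

text \<open>Ordered partitions of \<open>S\<close> whose part at each position is a transversal for
  the root at that position. By \<open>psi_rootv\<close> only these contribute to the value of a
  product of root vectors.\<close>

primrec tparts :: "rootel list \<Rightarrow> label set \<Rightarrow> label set list set" where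
  "tparts [] S = (if S = {} then {[]} else {})"
| "tparts (y # ys) S = (\<Union>A\<in>{A \<in> Pow S. is_part y A}. (#) A ` tparts ys (S - A))"

primrec pdisj :: "'a set list \<Rightarrow> bool" where
  "pdisj [] = True"
| "pdisj (A # As) = (A \<inter> \<Union>(set As) = {} \<and> pdisj As)"

lemma tparts_iff:
  "As \<in> tparts ys S \<longleftrightarrow> list_all2 is_part ys As \<and> \<Union>(set As) = S \<and> pdisj As"
proof (induction ys arbitrary: S As)
  case Nil
  then show ?case by auto
next
  case (Cons y ys)
  show ?case
  proof (cases As)
    case Nil
    then show ?thesis by auto
  next
    case (Cons A As')
    have "As \<in> tparts (y # ys) S \<longleftrightarrow> A \<subseteq> S \<and> is_part y A \<and> As' \<in> tparts ys (S - A)"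
      by (auto simp: Cons)
    also have "\<dots> \<longleftrightarrow> A \<subseteq> S \<and> is_part y A \<and>
      list_all2 is_part ys As' \<and> \<Union>(set As') = S - A \<and> pdisj As'"
      by (simp add: Cons.IH)
    also have "\<dots> \<longleftrightarrow> list_all2 is_part (y # ys) As \<and> \<Union>(set As) = S \<and> pdisj As"
      unfolding Cons by auto
    finally show ?thesis .
  qed
qed

lemma finite_tparts: "finite S \<Longrightarrow> finite (tparts ys S)"
  by (induction ys arbitrary: S) auto

definition rval :: "(label \<Rightarrow> kfld) \<Rightarrow> rootel \<Rightarrow> label set \<Rightarrow> kfld" where
  "rval x y A = x (pt A (lo y)) ^ snd y *
     (\<Prod>k\<in>{lo y..<hi y}. - 1 / (x (pt A k) - x (pt A (Suc k))))"

primrec tterm :: "(label \<Rightarrow> kfld) \<Rightarrow> rootel list \<Rightarrow> label set list \<Rightarrow> kfld" where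
  "tterm x [] As = 1"
| "tterm x (y # ys) As = rval x y (hd As) * zprod x (hd As) (\<Union>(set (tl As))) * tterm x ys (tl As)"

lemma psi_rprod:
  assumes "finite S" "inj_on x S" "\<forall>y\<in>set ys. lo y \<le> hi y"
  shows "psi x (rprod ys) S = (\<Sum>As\<in>tparts ys S. tterm x ys As)"
  using assms
proof (induction ys arbitrary: S)
  case Nil
  then show ?case by (simp add: rprod_def psi_1)
next
  case (Cons y ys)
  let ?T = "{A \<in> Pow S. is_part y A}"
  have fin: "finite ?T" using Cons.prems by simp
  have "psi x (rprod (y # ys)) S = (\<Sum>A\<in>Pow S. psi x (rootv y) A * psi x (rprod ys) (S - A) * zprod x A (S - A))"
    by (simp add: rprod_Cons psi_mult[OF Cons.prems(1)])
  also have "\<dots> = (\<Sum>A\<in>?T. psi x (rootv y) A * psi x (rprod ys) (S - A) * zprod x A (S - A))"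
  proof (rule sum.mono_neutral_right)
    show "\<forall>A\<in>Pow S - ?T. psi x (rootv y) A * psi x (rprod ys) (S - A) * zprod x A (S - A) = 0"
    proof
      fix A assume A: "A \<in> Pow S - ?T"
      then have "psi x (rootv ((lo y, hi y), snd y)) A = 0"
        using Cons.prems by (subst psi_rootv) (auto intro: finite_subset inj_on_subset)
      then show "psi x (rootv y) A * psi x (rprod ys) (S - A) * zprod x A (S - A) = 0" by simp
    qed
  qed (use Cons.prems in auto)
  also have "\<dots> = (\<Sum>A\<in>?T. \<Sum>As\<in>(#) A ` tparts ys (S - A). tterm x (y # ys) As)"
  proof (rule sum.cong[OF refl])
    fix A assume A: "A \<in> ?T"
    have "psi x (rootv ((lo y, hi y), snd y)) A = rval x y A"
      unfolding rval_def using A Cons.prems by (subst psi_rootv) (auto intro: finite_subset inj_on_subset)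
    then have 1: "psi x (rootv y) A = rval x y A" by simp
    have 2: "psi x (rprod ys) (S - A) = (\<Sum>As\<in>tparts ys (S - A). tterm x ys As)"
      using Cons.prems by (intro Cons.IH) (auto simp: inj_on_diff)
    have "(\<Sum>As\<in>(#) A ` tparts ys (S - A). tterm x (y # ys) As) =
       (\<Sum>As\<in>tparts ys (S - A). rval x y A * zprod x A (\<Union>(set As)) * tterm x ys As)"
      by (subst sum.reindex) (auto simp: inj_on_def)
    also have "\<dots> = (\<Sum>As\<in>tparts ys (S - A). rval x y A * zprod x A (S - A) * tterm x ys As)"
      by (rule sum.cong[OF refl]) (simp add: tparts_iff)
    finally show "psi x (rootv y) A * psi x (rprod ys) (S - A) * zprod x A (S - A) =
      (\<Sum>As\<in>(#) A ` tparts ys (S - A). tterm x (y # ys) As)"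
      unfolding 1 2 sum_distrib_left sum_distrib_right by (simp add: mult_ac)
  qed
  also have "\<dots> = (\<Sum>As\<in>tparts (y # ys) S. tterm x (y # ys) As)"
    unfolding tparts.simps
    using fin Cons.prems(1) finite_tparts by (intro sum.UNION_disjoint[symmetric]) auto
  finally show ?case .
qed

section \<open>Widely separated coordinates and the degrees they produce\<close>

locale point_params =
  fixes B Q t :: nat
  assumes B: "B \<ge> 2" and t: "1 \<le> t" "t < Q"
begin

definition wt :: "nat \<Rightarrow> nat" where "wt c = B ^ c"

text \<open>Points with the same tag share the dominant term, and the term \<open>k T^t\<close>
  makes neighbouring colours among them differ by exactly \<open>T^t\<close> up to sign. Points with
  different tags already differ in the dominant term, in degree above \<open>Q\<close>.\<close>

definition xpt :: "label \<Rightarrow> kfld" where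
  "xpt a = fls_X_intpow (- int (Q + wt (fst a))) + fls_const (of_nat (snd a)) * fls_X_intpow (- int t)"

lemma xpt_nth: "fls_nth (xpt a) k = (if k = - int (Q + wt (fst a)) then 1 else 0) + (if k = - int t then of_nat (snd a) else 0)"
  by (auto simp: xpt_def)

lemma xpt_zint: "zint (xpt a)"
proof -
  have "of_nat (snd a) \<in> zh" using zh_of_int[of "int (snd a)"] by simp
  then show ?thesis unfolding zint_def xpt_nth by (auto intro!: zh_add simp: zh_0 zh_1)
qed

lemma lead_xpt: "lead (- int (Q + wt (fst a))) 1 (xpt a)"
  using t by (auto simp: lead_def xpt_nth)

definition dd :: "label \<Rightarrow> label \<Rightarrow> nat" where
  "dd a b = (if fst a = fst b then t else Q + max (wt (fst a)) (wt (fst b)))"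

lemma wt_less: "c < c' \<Longrightarrow> wt c < wt c'"
  unfolding wt_def using B by (intro power_strict_increasing) auto

lemma lead_diff_cross:
  assumes "fst a \<noteq> fst b"
  shows "lead (- int (dd a b)) (if fst b < fst a then 1 else -1) (xpt a - xpt b)"
proof (cases "fst b < fst a")
  case True
  have "wt (fst b) < wt (fst a)" by (rule wt_less[OF True])
  moreover have "max (wt (fst a)) (wt (fst b)) = wt (fst a)" using calculation by simp
  ultimately show ?thesis using True assms t by (auto simp: lead_def xpt_nth dd_def)
next
  case False
  then have l: "wt (fst a) < wt (fst b)" using assms by (intro wt_less) auto
  moreover have "max (wt (fst a)) (wt (fst b)) = wt (fst b)" using l by simp
  ultimately show ?thesis using False assms t by (auto simp: lead_def xpt_nth dd_def)
qed

lemma lead_diff_same: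
  assumes "fst a = fst b" "snd b = Suc (snd a)"
  shows "lead (- int (dd a b)) (-1) (xpt a - xpt b)"
  using assms by (auto simp: lead_def xpt_nth dd_def)

text \<open>Distinct points with equal tag have different colours, and a nonzero Cartan entry leaves
  only neighbouring ones. For other colours the leading coefficient could be any integer.\<close>

lemma lead_diff:
  assumes "a \<noteq> b" "cartan (snd a) (snd b) \<noteq> 0"
  obtains e where "e = 1 \<or> e = -1" "lead (- int (dd a b)) e (xpt a - xpt b)"
proof (cases "fst a = fst b")
  case False
  then show ?thesis using lead_diff_cross[of a b] that by (auto split: if_splits)
next
  case True
  then have "snd a \<noteq> snd b" using assms by (auto simp: prod_eq_iff)
  then consider "snd b = Suc (snd a)" | "snd a = Suc (snd b)" using assms(2) by (auto simp: cartan_def split: if_splits)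
  then show ?thesis
  proof cases
    case 1
    then show ?thesis using that lead_diff_same True by blast
  next
    case 2
    have "lead (- int (dd b a)) (-1) (xpt b - xpt a)" using lead_diff_same[of b a] True 2 by simp
    from lead_uminus[OF this] have "lead (- int (dd a b)) 1 (xpt a - xpt b)" using True by (simp add: dd_def)
    then show ?thesis using that by blast
  qed
qed

lemma dd_pos: "dd a b \<ge> 1" using t by (auto simp: dd_def)

lemma xpt_inj: "inj xpt"
proof (rule injI)
  fix a b assume eq: "xpt a = xpt b"
  have "fst a = fst b"
  proof (rule ccontr)
    assume "fst a \<noteq> fst b"
    from lead_diff_cross[OF this] show False using eq by (simp add: lead_def)
  qed
  moreover have "fls_nth (xpt a) (- int t) = fls_nth (xpt b) (- int t)" using eq by simp
  moreover have "- int t \<noteq> - int (Q + wt (fst c))" for c :: label using t by simp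
  ultimately have "snd a = snd b" by (simp add: xpt_nth)
  with \<open>fst a = fst b\<close> show "a = b" by (simp add: prod_eq_iff)
qed

text \<open>Whenever \<open>1 / (x a - x b)\<close> actually occurs, it is integral and of negative
  degree in \<open>T\<close>. So \<open>zeta\<close> tends to 1 and the cross factors of the shuffle
  product disappear from leading terms.\<close>

lemma zeta_xpt:
  assumes "a \<noteq> b"
  shows "lead 0 1 (zeta xpt a b) \<and> zint (zeta xpt a b)"
proof (cases "cartan (snd a) (snd b) = 0")
  case True
  then show ?thesis by (simp add: zeta_def lead_1 zint_1)
next
  case False
  obtain e where e: "e = 1 \<or> e = -1" "lead (- int (dd a b)) e (xpt a - xpt b)" using lead_diff[OF assms False] .
  define g where "g = inverse (xpt a - xpt b)"
  have g: "lead (int (dd a b)) (inverse e) g" using lead_inverse[OF e(2)] by (simp add: g_def)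
  have z: "zint g" unfolding g_def by (rule zint_inverse[OF zint_diff[OF xpt_zint xpt_zint] e(2,1)])
  have eq: "zeta xpt a b = 1 + fls_const (of_int (cartan (snd a) (snd b)) / 2) * g"
    by (simp only: zeta_def g_def divide_inverse[of "fls_const (of_int (cartan (snd a) (snd b)) / 2)"])
  have "fls_nth g k = 0" if "k \<le> 0" for k using g that dd_pos[of a b] by (auto simp: lead_def)
  then have "lead 0 1 (zeta xpt a b)" unfolding eq by (simp add: lead_def)
  moreover have "zint (zeta xpt a b)" unfolding eq by (intro zint_add zint_1 zint_mult z zint_const zh_half_int)
  ultimately show ?thesis ..
qed

lemma zprod_xpt:
  assumes "A \<inter> C = {}" shows "lead 0 1 (zprod xpt A C)"
proof -
  have "lead (\<Sum>a\<in>A. \<Sum>b\<in>C. 0) (\<Prod>a\<in>A. \<Prod>b\<in>C. 1) (zprod xpt A C)"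
    unfolding zprod_def using assms by (intro lead_prod zeta_xpt[THEN conjunct1]) auto
  then show ?thesis by simp
qed

definition same :: "rootel \<Rightarrow> label set \<Rightarrow> bool" where
  "same y A \<longleftrightarrow> (\<forall>k\<in>{lo y..<hi y}. fst (pt A k) = fst (pt A (Suc k)))"

text \<open>The degree in \<open>T\<close> of \<open>rval xpt y A\<close>: a link between
  neighbouring colours costs \<open>t\<close> inside one chain and more than \<open>Q\<close> when
  it jumps to another.\<close>

definition ecost :: "rootel \<Rightarrow> label set \<Rightarrow> int" where
  "ecost y A = int (snd y) * int (Q + wt (fst (pt A (lo y))))
     - (\<Sum>k\<in>{lo y..<hi y}. int (dd (pt A k) (pt A (Suc k))))"

text \<open>Inside one chain every link contributes \<open>- 1 / (- T^t) = T^(-t)\<close>, so the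
  leading coefficient is 1 and not merely a sign.\<close>

lemma lead_rval:
  assumes A: "is_part y A"
  shows "\<exists>e. lead (- ecost y A) e (rval xpt y A) \<and> (same y A \<longrightarrow> e = 1)"
proof -
  define c where "c k = (if fst (pt A k) = fst (pt A (Suc k)) then 1 else if fst (pt A (Suc k)) < fst (pt A k) then -1 else 1 :: complex)" for k
  have "lead (int (dd (pt A k) (pt A (Suc k)))) (c k) (- 1 / (xpt (pt A k) - xpt (pt A (Suc k))))"
    if k: "k \<in> {lo y..<hi y}" for k
  proof -
    have p: "snd (pt A k) = k" "snd (pt A (Suc k)) = Suc k" using pt_in[OF A] k by auto
    have "lead (- int (dd (pt A k) (pt A (Suc k)))) (- inverse (c k)) (xpt (pt A k) - xpt (pt A (Suc k)))"
    proof (cases "fst (pt A k) = fst (pt A (Suc k))")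
      case True
      then show ?thesis using lead_diff_same[of "pt A k" "pt A (Suc k)"] p by (simp add: c_def)
    next
      case False
      then show ?thesis using lead_diff_cross[OF False] by (simp add: c_def split: if_splits)
    qed
    from lead_uminus[OF lead_inverse[OF this]] show ?thesis by (simp add: divide_inverse)
  qed
  from lead_prod[of "{lo y..<hi y}", OF this]
  have 1: "lead (\<Sum>k\<in>{lo y..<hi y}. int (dd (pt A k) (pt A (Suc k)))) (\<Prod>k\<in>{lo y..<hi y}. c k)
     (\<Prod>k\<in>{lo y..<hi y}. - 1 / (xpt (pt A k) - xpt (pt A (Suc k))))" .
  from lead_mult[OF lead_power[OF lead_xpt[of "pt A (lo y)"], of "snd y"] 1]
  have "lead (- ecost y A) (\<Prod>k\<in>{lo y..<hi y}. c k) (rval xpt y A)"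
    by (simp add: rval_def ecost_def algebra_simps)
  moreover have "same y A \<longrightarrow> (\<Prod>k\<in>{lo y..<hi y}. c k) = 1"
    by (auto simp: same_def c_def intro!: prod.neutral)
  ultimately show ?thesis by blast
qed

definition cost :: "rootel list \<Rightarrow> label set list \<Rightarrow> int" where
  "cost ys As = (\<Sum>i<length ys. ecost (ys ! i) (As ! i))"

lemma lead_tterm:
  assumes "list_all2 is_part ys As" "pdisj As"
  shows "\<exists>e. lead (- cost ys As) e (tterm xpt ys As) \<and> (list_all2 same ys As \<longrightarrow> e = 1)"
  using assms
proof (induction ys As rule: list_all2_induct)
  case Nil
  then show ?case by (auto simp: cost_def lead_1)
next
  case (Cons y ys A As)
  obtain e where e: "lead (- ecost y A) e (rval xpt y A)" "same y A \<longrightarrow> e = 1" using lead_rval[OF Cons(1)] by blast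
  obtain e' where e': "lead (- cost ys As) e' (tterm xpt ys As)" "list_all2 same ys As \<longrightarrow> e' = 1"
    using Cons by auto
  have "lead 0 1 (zprod xpt A (\<Union>(set As)))" using Cons.prems by (intro zprod_xpt) auto
  from lead_mult[OF lead_mult[OF e(1) this] e'(1)]
  have "lead (- ecost y A - cost ys As) (e * e') (tterm xpt (y # ys) (A # As))" by simp
  moreover have "cost (y # ys) (A # As) = ecost y A + cost ys As"
    by (simp add: cost_def sum.lessThan_Suc_shift del: sum.lessThan_Suc)
  ultimately show ?case using e(2) e'(2) by (intro exI[of _ "e * e'"]) auto
qed

text \<open>Every term that reaches degree \<open>N\<close> does so with coefficient 1; nothing
  cancels, and the coefficient is a number of partitions.\<close>

lemma psi_rprod_coeff:
  assumes S: "finite S" and ys: "\<forall>y\<in>set ys. lo y \<le> hi y"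
    and N: "\<And>As. As \<in> tparts ys S \<Longrightarrow> cost ys As < N \<or> cost ys As = N \<and> list_all2 same ys As"
  shows "fls_nth (psi xpt (rprod ys) S) (- N) = of_nat (card {As \<in> tparts ys S. cost ys As = N})"
proof -
  have "fls_nth (psi xpt (rprod ys) S) (- N) = (\<Sum>As\<in>tparts ys S. fls_nth (tterm xpt ys As) (- N))"
    using psi_rprod[OF S inj_on_subset[OF xpt_inj] ys] by (simp add: fls_nth_sum)
  also have "\<dots> = (\<Sum>As\<in>tparts ys S. if cost ys As = N then 1 else 0)"
  proof (rule sum.cong[OF refl])
    fix As assume As: "As \<in> tparts ys S"
    then obtain e where "lead (- cost ys As) e (tterm xpt ys As)" "list_all2 same ys As \<longrightarrow> e = 1"
      using lead_tterm[of ys As] by (auto simp: tparts_iff)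
    then show "fls_nth (tterm xpt ys As) (- N) = (if cost ys As = N then 1 else 0)"
      using N[OF As] by (auto simp: lead_def)
  qed
  also have "\<dots> = of_nat (card {As \<in> tparts ys S. cost ys As = N})"
    using finite_tparts[OF S] by (simp add: sum.If_cases Int_def)
  finally show ?thesis .
qed

end

section \<open>The top coefficient\<close>

lemma base_digits_unique:
  fixes B m :: nat
  assumes "\<forall>c<m. r c < B" "\<forall>c<m. r' c < B" "(\<Sum>c<m. r c * B ^ c) = (\<Sum>c<m. r' c * B ^ c)"
  shows "\<forall>c<m. r c = r' c"
  using assms
proof (induction m arbitrary: r r')
  case (Suc m)
  have split: "(\<Sum>c<Suc m. s c * B ^ c) = s 0 + B * (\<Sum>c<m. s (Suc c) * B ^ c)" for s :: "nat \<Rightarrow> nat"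
    by (simp add: sum.lessThan_Suc_shift sum_distrib_left mult_ac del: sum.lessThan_Suc)
  have eq: "r 0 + B * (\<Sum>c<m. r (Suc c) * B ^ c) = r' 0 + B * (\<Sum>c<m. r' (Suc c) * B ^ c)"
    using Suc.prems(3) unfolding split .
  have lt: "r 0 < B" "r' 0 < B" using Suc.prems by auto
  from arg_cong[OF eq, of "\<lambda>n. n mod B"] lt have 0: "r 0 = r' 0" by simp
  then have "(\<Sum>c<m. r (Suc c) * B ^ c) = (\<Sum>c<m. r' (Suc c) * B ^ c)" using eq lt by simp
  then have "\<forall>c<m. r (Suc c) = r' (Suc c)" using Suc.prems by (intro Suc.IH) auto
  then show ?case using 0 by (metis less_Suc_eq_0_disj)
qed simp

text \<open>Modulo \<open>Q\<close> only the base \<open>B\<close> part of the sum survives, and it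
  is smaller than \<open>Q\<close>; then the digits are determined.\<close>

lemma shifted_digits_unique:
  fixes B m Q :: nat
  assumes r: "\<forall>c<m. r c < B" "\<forall>c<m. r' c < B"
    and eq: "(\<Sum>c<m. r c * (Q + B ^ c)) = (\<Sum>c<m. r' c * (Q + B ^ c))"
    and Q: "(\<Sum>c<m. r c * B ^ c) < Q" "(\<Sum>c<m. r' c * B ^ c) < Q"
  shows "\<forall>c<m. r c = r' c"
proof (rule base_digits_unique[OF r])
  have "(\<Sum>c<m. s c * (Q + B ^ c)) = (\<Sum>c<m. s c * B ^ c) + Q * (\<Sum>c<m. s c)" for s :: "nat \<Rightarrow> nat"
    by (simp add: distrib_left sum.distrib sum_distrib_left mult_ac)
  then have "((\<Sum>c<m. r c * B ^ c) + Q * (\<Sum>c<m. r c)) mod Q = ((\<Sum>c<m. r' c * B ^ c) + Q * (\<Sum>c<m. r' c)) mod Q"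
    using eq by metis
  then show "(\<Sum>c<m. r c * B ^ c) = (\<Sum>c<m. r' c * B ^ c)" using Q by simp
qed

text \<open>The first entry of a listing is any element labelled \<open>v\<close>, and there is one
  more of these than \<open>v\<close> occurs in the rest, which produces the next factorial. The
  superset \<open>U\<close> of labels keeps the index set of the product fixed in the
  induction.\<close>

lemma card_labelled_permutations:
  assumes "finite C" "finite U" "set ys \<subseteq> U" "image_mset f (mset_set C) = mset ys"
  shows "finite {cs. distinct cs \<and> set cs = C \<and> map f cs = ys} \<and>
    card {cs. distinct cs \<and> set cs = C \<and> map f cs = ys} = (\<Prod>u\<in>U. fact (count (mset ys) u))"
  using assms
proof (induction ys arbitrary: C)
  case Nil
  then have "C = {}" by (simp add: mset_set_empty_iff)
  then have "{cs. distinct cs \<and> set cs = C \<and> map f cs = []} = {[]}" by auto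
  then show ?case by simp
next
  case (Cons v ys)
  let ?K = "\<lambda>C ys. {cs. distinct cs \<and> set cs = C \<and> map f cs = ys}"
  let ?D = "{c \<in> C. f c = v}"
  have eq: "?K C (v # ys) = (\<Union>c\<in>?D. (#) c ` ?K (C - {c}) ys)"
  proof (intro equalityI subsetI)
    fix cs assume cs: "cs \<in> ?K C (v # ys)"
    then obtain c cs' where "cs = c # cs'" by (cases cs) auto
    then show "cs \<in> (\<Union>c\<in>?D. (#) c ` ?K (C - {c}) ys)" using cs by auto
  next
    fix cs assume "cs \<in> (\<Union>c\<in>?D. (#) c ` ?K (C - {c}) ys)"
    then obtain c cs' where "c \<in> C" "f c = v" "cs = c # cs'" "distinct cs'" "set cs' = C - {c}" "map f cs' = ys" by blast
    then show "cs \<in> ?K C (v # ys)" by auto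
  qed
  have IH: "finite (?K (C - {c}) ys) \<and> card (?K (C - {c}) ys) = (\<Prod>u\<in>U. fact (count (mset ys) u))" if c: "c \<in> ?D" for c
  proof (rule Cons.IH)
    have "mset_set C = add_mset c (mset_set (C - {c}))" using c by (intro mset_set.remove[OF Cons.prems(1)]) simp
    then show "image_mset f (mset_set (C - {c})) = mset ys" using Cons.prems(4) c by simp
  qed (use Cons.prems in auto)
  have fin: "finite ?D" using Cons.prems by simp
  have "card (?K C (v # ys)) = (\<Sum>c\<in>?D. card ((#) c ` ?K (C - {c}) ys))"
    unfolding eq
  proof (rule card_UN_disjoint[OF fin])
    show "\<forall>c\<in>?D. finite ((#) c ` ?K (C - {c}) ys)" using IH by blast
    show "\<forall>c\<in>?D. \<forall>c'\<in>?D. c \<noteq> c' \<longrightarrow> (#) c ` ?K (C - {c}) ys \<inter> (#) c' ` ?K (C - {c'}) ys = {}" by blast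
  qed
  also have "\<dots> = (\<Sum>c\<in>?D. (\<Prod>u\<in>U. fact (count (mset ys) u)))"
    using IH by (intro sum.cong refl) (subst card_image, simp_all only: inj_on_def list.inject, blast)
  also have "\<dots> = card ?D * (\<Prod>u\<in>U. fact (count (mset ys) u))" by simp
  also have "card ?D = Suc (count (mset ys) v)"
  proof -
    have "card ?D = count (image_mset f (mset_set C)) v"
      using Cons.prems(1) 
      by (auto simp: count_image_mset' count_mset_set' intro!: arg_cong[of _ _ card])
    then show ?thesis using Cons.prems(4) by simp
  qed
  also have "Suc (count (mset ys) v) * (\<Prod>u\<in>U. fact (count (mset ys) u)) = (\<Prod>u\<in>U. fact (count (mset (v # ys)) u))"
  proof -
    have v: "v \<in> U" using Cons.prems by simp
    have "(\<Prod>u\<in>U - {v}. fact (count (mset (v # ys)) u)) = (\<Prod>u\<in>U - {v}. fact (count (mset ys) u) :: nat)"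
      by (rule prod.cong) auto
    then show ?thesis using prod.remove[OF Cons.prems(2) v, of "\<lambda>u. fact (count (mset ys) u) :: nat"]
      prod.remove[OF Cons.prems(2) v, of "\<lambda>u. fact (count (mset (v # ys)) u) :: nat"] by (simp add: algebra_simps)
  qed
  finally have "card (?K C (v # ys)) = (\<Prod>u\<in>U. fact (count (mset (v # ys)) u))" .
  moreover have "finite (?K C (v # ys))" unfolding eq using fin IH by blast
  ultimately show ?case by blast
qed

section \<open>Chains of points and the partitions of maximal degree\<close>

definition rsum :: "rootel list \<Rightarrow> nat" where "rsum ys = sum_list (map snd ys)"
definition msum :: "rootel list \<Rightarrow> nat" where "msum ys = sum_list (map (\<lambda>y. hi y - lo y) ys)"

lemma rsum_nth: "rsum ys = (\<Sum>i<length ys. snd (ys ! i))"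
  by (simp add: rsum_def sum_list_sum_nth atLeast0LessThan)
lemma msum_nth: "msum ys = (\<Sum>i<length ys. hi (ys ! i) - lo (ys ! i))"
  by (simp add: msum_def sum_list_sum_nth atLeast0LessThan)
lemma rsum_mset: "mset ys = mset zs \<Longrightarrow> rsum ys = rsum zs"
  unfolding rsum_def by (simp only: sum_mset_sum_list[symmetric] mset_map)
lemma msum_mset: "mset ys = mset zs \<Longrightarrow> msum ys = msum zs"
  unfolding msum_def by (simp only: sum_mset_sum_list[symmetric] mset_map)

text \<open>The tag is the position in \<open>zs\<close>, not the root, so equal roots get separate
  chains.\<close>

definition chain :: "rootel list \<Rightarrow> nat \<Rightarrow> label set" where
  "chain zs c = {c} \<times> {lo (zs ! c)..hi (zs ! c)}"

definition allpts :: "rootel list \<Rightarrow> label set" where "allpts zs = (\<Union>c<length zs. chain zs c)"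

lemma finite_allpts: "finite (allpts zs)" by (simp add: allpts_def chain_def)

lemma transv_chain: "transv (lo (zs ! c)) (hi (zs ! c)) (chain zs c)"
  by (auto simp: transv_def chain_def inj_on_def)

lemma pt_chain: "k \<in> {lo (zs ! c)..hi (zs ! c)} \<Longrightarrow> pt (chain zs c) k = (c, k)"
  by (rule pt_eqI) (auto simp: chain_def inj_on_def)

lemma pdisj_chains: "distinct cs \<Longrightarrow> pdisj (map (chain zs) cs)"
  by (induction cs) (auto simp: chain_def)

lemma chains_tparts:
  assumes "distinct cs" "set cs = {..<length zs}" "map ((!) zs) cs = ys"
  shows "map (chain zs) cs \<in> tparts ys (allpts zs)"
proof -
  have l: "length ys = length cs" using assms(3) by auto
  have "list_all2 is_part ys (map (chain zs) cs)"
    unfolding list_all2_conv_all_nth using l transv_chain assms(3) by auto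
  moreover have "\<Union>(set (map (chain zs) cs)) = allpts zs" using assms(2) by (simp add: allpts_def)
  ultimately show ?thesis using pdisj_chains[OF assms(1)] by (simp add: tparts_iff)
qed

text \<open>A part has one point more than it has links. Hence the size of \<open>S\<close> ties the
  number of parts to the total number of links.\<close>

lemma card_tparts:
  "As \<in> tparts ys S \<Longrightarrow> finite S \<Longrightarrow> \<forall>y\<in>set ys. lo y \<le> hi y \<Longrightarrow> card S = msum ys + length ys"
proof (induction ys arbitrary: As S)
  case Nil
  then show ?case by (auto simp: msum_def split: if_splits)
next
  case (Cons y ys)
  then obtain A As' where A: "A \<subseteq> S" "is_part y A" "As' \<in> tparts ys (S - A)" by auto
  have "card A = Suc (hi y - lo y)"
    using A(2) Cons.prems(3) card_image[of snd A] by (auto simp: transv_def)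
  moreover have "card (S - A) = msum ys + length ys" using Cons.IH[OF A(3)] Cons.prems by simp
  moreover have "card S = card A + card (S - A)"
    using A(1) Cons.prems(2) by (metis Diff_disjoint Un_Diff_cancel card_Un_disjoint finite_subset finite_Diff sup.absorb2)
  ultimately show ?case by (simp add: msum_def)
qed

lemma card_allpts:
  assumes "\<forall>y\<in>set zs. lo y \<le> hi y"
  shows "card (allpts zs) = msum zs + length zs"
  using chains_tparts[of "[0..<length zs]" zs zs] card_tparts[OF _ finite_allpts assms]
  by (auto simp: map_nth atLeast0LessThan)

context point_params
begin

text \<open>What \<open>ecost\<close> becomes when the part for \<open>y\<close> lies entirely in
  chain \<open>c\<close>.\<close>

definition nval :: "nat \<Rightarrow> rootel \<Rightarrow> int" where
  "nval c y = int (snd y) * int (Q + wt c) - int t * int (hi y - lo y)"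

definition Nv :: "rootel list \<Rightarrow> int" where "Nv zs = (\<Sum>c<length zs. nval c (zs ! c))"

lemma ecost_le: "ecost y A \<le> int (snd y) * int (Q + wt (fst (pt A (lo y))))"
  unfolding ecost_def by (simp add: sum_nonneg)

lemma ecost_not_same:
  assumes "\<not> same y A"
  shows "ecost y A \<le> int (snd y) * int (Q + wt (fst (pt A (lo y)))) - int Q"
proof -
  obtain k where k: "k \<in> {lo y..<hi y}" "fst (pt A k) \<noteq> fst (pt A (Suc k))"
    using assms by (auto simp: same_def)
  have "int Q \<le> int (dd (pt A k) (pt A (Suc k)))" using k by (simp add: dd_def)
  also have "\<dots> \<le> (\<Sum>k\<in>{lo y..<hi y}. int (dd (pt A k) (pt A (Suc k))))"
    by (rule member_le_sum) (use k in auto)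
  finally show ?thesis by (simp add: ecost_def)
qed

lemma same_transv:
  assumes A: "is_part y A" and "same y A" and le: "lo y \<le> hi y"
  shows "A = {fst (pt A (lo y))} \<times> {lo y..hi y}" "ecost y A = nval (fst (pt A (lo y))) y"
proof -
  let ?c = "fst (pt A (lo y))"
  have c: "k \<le> hi y \<longrightarrow> fst (pt A k) = ?c" if "lo y \<le> k" for k
    using that
  proof (induction k rule: dec_induct)
    case (step k)
    then show ?case using assms(2) by (auto simp: same_def)
  qed simp
  show "A = {?c} \<times> {lo y..hi y}"
  proof (intro equalityI subsetI)
    fix a assume "a \<in> A"
    from transv_mem[OF A this] have a: "snd a \<in> {lo y..hi y}" "pt A (snd a) = a" by auto
    then have "fst a = ?c" using c[of "snd a"] by simp
    then show "a \<in> {?c} \<times> {lo y..hi y}" using a(1) by (simp only: mem_Times_iff singleton_iff)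
  next
    fix a assume "a \<in> {?c} \<times> {lo y..hi y}"
    then have a: "fst a = ?c" "snd a \<in> {lo y..hi y}" by auto
    then have "a = pt A (snd a)" using pt_in[OF A a(2)] c[of "snd a"] by (simp add: prod_eq_iff)
    then show "a \<in> A" using pt_in[OF A a(2)] by simp
  qed
  have "(\<Sum>k\<in>{lo y..<hi y}. int (dd (pt A k) (pt A (Suc k)))) = (\<Sum>k\<in>{lo y..<hi y}. int t)"
    using assms(2) by (intro sum.cong refl) (auto simp: same_def dd_def)
  then show "ecost y A = nval ?c y" by (simp add: ecost_def nval_def mult.commute)
qed

lemma Nv_lower: "int (rsum zs) * int Q - int t * int (msum zs) \<le> Nv zs"
proof -
  have "int (rsum zs) * int Q - int t * int (msum zs) =
    (\<Sum>c<length zs. int (snd (zs ! c)) * int Q - int t * int (hi (zs ! c) - lo (zs ! c)))"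
    by (simp only: rsum_nth msum_nth sum_subtractf of_nat_sum sum_distrib_left sum_distrib_right)
  also have "\<dots> \<le> Nv zs" unfolding Nv_def nval_def by (intro sum_mono) (simp add: algebra_simps)
  finally show ?thesis .
qed

lemma nval_upper: "wt c \<le> w \<Longrightarrow> nval c y \<le> int (snd y) * int (Q + w) - int t * int (hi y - lo y)"
  unfolding nval_def by (simp add: mult_left_mono)

lemma sum_nval_upper:
  assumes "\<And>i. i < length ys \<Longrightarrow> wt (f i) \<le> w"
  shows "(\<Sum>i<length ys. nval (f i) (ys ! i)) \<le> int (rsum ys) * int Q + int (rsum ys) * int w - int t * int (msum ys)"
proof -
  have "(\<Sum>i<length ys. nval (f i) (ys ! i)) \<le>
    (\<Sum>i<length ys. int (snd (ys ! i)) * int (Q + w) - int t * int (hi (ys ! i) - lo (ys ! i)))"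
    using assms by (intro sum_mono nval_upper) auto
  also have "\<dots> = int (rsum ys) * int (Q + w) - int t * int (msum ys)"
    by (simp only: rsum_nth msum_nth sum_subtractf of_nat_sum sum_distrib_left sum_distrib_right)
  finally show ?thesis by (simp add: algebra_simps)
qed

lemma wt_mono: "c \<le> c' \<Longrightarrow> wt c \<le> wt c'"
  using wt_less[of c c'] by (cases "c = c'") auto

text \<open>Three scales compete. \<open>Q\<close> dominates, so the total loop index decides first
  and a part that leaves its chain is too expensive. Next comes \<open>t\<close>: at equal loop
  index fewer links give higher degree. Last come the weights \<open>B^c\<close>, whose digits
  record which loop index sits on which chain. Maximality of \<open>Nv zs\<close> enters twice:
  against \<open>ys\<close> itself, and against the rearrangement of \<open>ys\<close> along the
  chains.\<close>

lemma tparts_cost: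
  assumes zs: "\<forall>y\<in>set zs. lo y \<le> hi y" and ys: "\<forall>y\<in>set ys. lo y \<le> hi y"
    and R: "rsum ys \<le> Rm" "rsum zs \<le> Rm" and M: "msum ys \<le> Mm" "msum zs \<le> Mm" and L: "length zs \<le> L"
    and RB: "Rm < B" and tb: "Rm * wt L < t" and Qb: "Rm * wt L + t * Mm < Q"
    and mx: "\<And>zs'. mset zs' = mset ys \<Longrightarrow> Nv zs' \<le> Nv zs"
    and As: "As \<in> tparts ys (allpts zs)"
  shows "cost ys As < Nv zs \<or> cost ys As = Nv zs \<and> list_all2 same ys As \<and>
    (\<exists>cs. distinct cs \<and> set cs = {..<length zs} \<and> As = map (chain zs) cs \<and> map ((!) zs) cs = ys)"
proof -
  define m where "m = length ys"
  define w where "w = wt L"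
  define cc where "cc i = fst (pt (As ! i) (lo (ys ! i)))" for i
  have lA: "length As = m" and tr: "\<And>i. i < m \<Longrightarrow> transv (lo (ys ! i)) (hi (ys ! i)) (As ! i)"
    and un: "\<Union>(set As) = allpts zs"
    using As by (auto simp: tparts_iff list_all2_conv_all_nth m_def)
  have pq: "lo (ys ! i) \<le> hi (ys ! i)" if "i < m" for i using ys that by (simp add: m_def)
  have sub: "As ! i \<subseteq> allpts zs" if "i < m" for i using un lA that by auto
  have cc: "cc i < length zs" if i: "i < m" for i
  proof -
    have "pt (As ! i) (lo (ys ! i)) \<in> As ! i" using pt_in[OF tr[OF i]] pq[OF i] by auto
    then have "pt (As ! i) (lo (ys ! i)) \<in> allpts zs" using sub[OF i] by blast
    then show ?thesis unfolding cc_def allpts_def chain_def by auto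
  qed
  have wc: "wt (cc i) \<le> w" if "i < m" for i using cc[OF that] L by (auto simp: w_def intro: wt_mono)
  have Rw: "rsum ys * w \<le> Rm * w" "rsum zs * w \<le> Rm * w" "t * msum ys \<le> t * Mm" "t * msum zs \<le> t * Mm"
    using R M by (auto intro: mult_right_mono)
  have Rwi: "int (rsum ys) * int w + int t * int (msum ys) < int Q" "int (rsum ys) * int w + int t * int (msum zs) < int Q"
     "int (rsum zs) * int w + int t * int (msum ys) < int Q" "int (rsum zs) * int w < int t"
    using Rw tb Qb unfolding w_def[symmetric] of_nat_mult[symmetric] of_nat_add[symmetric] of_nat_less_iff by linarith+
  \<comment> \<open>The list \<open>ys\<close> is one of its own rearrangements, hence a competitor
    of \<open>zs\<close>.\<close>
  have low: "int (rsum ys) * int Q - int t * int (msum ys) \<le> Nv zs"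
    using Nv_lower[of ys] mx[of ys] by simp
  show ?thesis
  proof (cases "\<forall>i<m. same (ys ! i) (As ! i)")
    case False
    then obtain i0 where i0: "i0 < m" "\<not> same (ys ! i0) (As ! i0)" by blast
    have "cost ys As \<le> (\<Sum>i<m. int (snd (ys ! i)) * int (Q + w) - (if i = i0 then int Q else 0))"
      unfolding cost_def m_def[symmetric]
    proof (rule sum_mono)
      fix i assume i: "i \<in> {..<m}"
      have b: "int (snd (ys ! i)) * int (Q + wt (cc i)) \<le> int (snd (ys ! i)) * int (Q + w)"
        using wc[of i] i by (intro mult_left_mono) auto
      show "ecost (ys ! i) (As ! i) \<le> int (snd (ys ! i)) * int (Q + w) - (if i = i0 then int Q else 0)"
        using b ecost_le[of "ys ! i" "As ! i"] ecost_not_same[of "ys ! i" "As ! i"] i0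
        unfolding cc_def by (cases "i = i0") auto
    qed
    also have "\<dots> = int (rsum ys) * int (Q + w) - int Q"
      using i0(1) by (simp add: sum_subtractf rsum_nth sum_distrib_right m_def)
    finally have "cost ys As < Nv zs" using low Rwi(1) by (simp add: distrib_left)
    then show ?thesis ..
  next
    case True
    have A: "As ! i = {cc i} \<times> {lo (ys ! i)..hi (ys ! i)}" if "i < m" for i
      unfolding cc_def using same_transv(1)[OF tr[OF that] _ pq[OF that]] True that by simp
    have cost: "cost ys As = (\<Sum>i<m. nval (cc i) (ys ! i))"
      unfolding cost_def m_def[symmetric] cc_def
      using same_transv(2)[OF tr _ pq] True by (intro sum.cong) auto
    have cover: "\<exists>i<m. cc i = c" if c: "c < length zs" for c
    proof -
      have "(c, lo (zs ! c)) \<in> allpts zs" using c zs by (auto simp: allpts_def chain_def)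
      then obtain i where "i < m" "(c, lo (zs ! c)) \<in> As ! i"
        unfolding un[symmetric] using lA by (metis UnionE in_set_conv_nth)
      then show ?thesis using A by auto
    qed
    then have im: "cc ` {..<m} = {..<length zs}" using cc by fastforce
    then have lz: "length zs \<le> m" using card_image_le[of "{..<m}" cc] by simp
    \<comment> \<open>Parts may subdivide chains; counting points shows that each additional part
      means one link fewer.\<close>
    have cd: "msum ys + m = msum zs + length zs"
      using card_tparts[OF As finite_allpts ys] card_allpts[OF zs] by (simp add: m_def)
    show ?thesis
    proof (cases "length zs = m")
      case False
      then have mm: "msum ys < msum zs" using lz cd by linarith
      have up: "cost ys As \<le> int (rsum ys) * int Q + int (rsum ys) * int w - int t * int (msum ys)"
        unfolding cost m_def by (rule sum_nval_upper) (use wc m_def in auto)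
      have upz: "Nv zs \<le> int (rsum zs) * int Q + int (rsum zs) * int w - int t * int (msum zs)"
        unfolding Nv_def by (rule sum_nval_upper) (use L in \<open>auto simp: w_def intro: wt_mono\<close>)
      have lowz: "int (rsum zs) * int Q - int t * int (msum zs) \<le> Nv zs" by (rule Nv_lower)
      have tm: "int t * int (msum ys) + int t \<le> int t * int (msum zs)"
        using mult_left_mono[of "int (msum ys) + 1" "int (msum zs)" "int t"] mm by (simp add: distrib_left)
      \<comment> \<open>Only the first case can occur. In the other two the lower bound for
        \<open>Nv zs\<close> coming from \<open>ys\<close> exceeds the upper bound
        \<open>upz\<close>, against the maximality of \<open>zs\<close>.\<close>
      consider "rsum ys < rsum zs" | "rsum ys = rsum zs" | "rsum zs < rsum ys" by linarith
      then have "cost ys As < Nv zs"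
      proof cases
        case 1
        then have "(int (rsum ys) + 1) * int Q \<le> int (rsum zs) * int Q" by (intro mult_right_mono) auto
        then have "int (rsum ys) * int Q + int Q \<le> int (rsum zs) * int Q" by (simp add: distrib_right)
        moreover have "0 \<le> int t * int (msum ys)" by simp
        ultimately show ?thesis using up lowz Rwi(2) by linarith
      next
        case 2
        then have "int (rsum ys) * int Q = int (rsum zs) * int Q" by simp
        then show ?thesis using low upz tm Rwi(4) by linarith
      next
        case 3
        then have "(int (rsum zs) + 1) * int Q \<le> int (rsum ys) * int Q" by (intro mult_right_mono) auto
        then have "int (rsum zs) * int Q + int Q \<le> int (rsum ys) * int Q" by (simp add: distrib_right)
        moreover have "0 \<le> int t * int (msum zs)" by simp
        ultimately show ?thesis using low upz Rwi(3) by linarith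
      qed
      then show ?thesis ..
    next
      case lm: True
      \<comment> \<open>With as many parts as chains, \<open>cc\<close> is a bijection. Each part
        then fills its chain, and listing \<open>ys\<close> by chains gives a rearrangement to which
        maximality applies.\<close>
      have inj: "inj_on cc {..<m}" using im lm by (intro eq_card_imp_inj_on) auto
      define cs where "cs = map cc [0..<m]"
      have cs: "distinct cs" "set cs = {..<length zs}" "length cs = m"
        using inj im by (auto simp: cs_def distinct_map atLeast0LessThan)
      have Ac: "As ! i = chain zs (cc i)" if i: "i < m" for i
      proof (intro equalityI subsetI)
        fix a assume a: "a \<in> As ! i"
        then have "a \<in> allpts zs" "fst a = cc i" using sub[OF i] A[OF i] by auto
        then show "a \<in> chain zs (cc i)" by (auto simp: allpts_def chain_def)
      next
        fix a assume a: "a \<in> chain zs (cc i)"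
        then have "a \<in> allpts zs" "fst a = cc i" using cc[OF i] by (auto simp: allpts_def chain_def)
        then obtain j where j: "j < m" "a \<in> As ! j" unfolding un[symmetric] using lA by (metis UnionE in_set_conv_nth)
        then have "cc j = cc i" using A[OF j(1)] \<open>fst a = cc i\<close> by auto
        then have "j = i" using inj i j by (auto simp: inj_on_def)
        then show "a \<in> As ! i" using j by simp
      qed
      have fe: "fst (ys ! i) = fst (zs ! cc i)" if i: "i < m" for i
      proof -
        have "{lo (ys ! i)..hi (ys ! i)} = {lo (zs ! cc i)..hi (zs ! cc i)}"
          using arg_cong[OF trans[OF A[OF i, symmetric] Ac[OF i, unfolded chain_def]], of "image snd"] by simp
        then show ?thesis using pq[OF i] by (simp add: prod_eq_iff)
      qed
      define g where "g c = ys ! (inv_into {..<m} cc c)" for c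
      have g: "g (cc i) = ys ! i" if "i < m" for i using inj that by (simp add: g_def)
      have gcs: "map g cs = ys" by (rule nth_equalityI) (auto simp: cs_def g m_def)
      define zs' where "zs' = map g [0..<m]"
      have "mset cs = mset [0..<m]" 
        using set_eq_iff_mset_eq_distinct[OF cs(1), of "[0..<m]"] cs(2) lm by (simp add: atLeast0LessThan)
      then have "mset zs' = mset ys" unfolding zs'_def gcs[symmetric] by (simp only: mset_map)
      then have le: "Nv zs' \<le> Nv zs" by (rule mx)
      have "cost ys As = (\<Sum>i<m. nval (cc i) (g (cc i)))" unfolding cost by (rule sum.cong) (auto simp: g)
      also have "\<dots> = (\<Sum>c<m. nval c (g c))" using sum.reindex[OF inj, of "\<lambda>c. nval c (g c)"] im lm by simp
      also have "\<dots> = Nv zs'" by (simp add: Nv_def zs'_def)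
      finally have cz: "cost ys As = Nv zs'" .
      show ?thesis
      proof (cases "Nv zs' = Nv zs")
        case False
        then show ?thesis using cz le by simp
      next
        case eq: True
        have fg: "fst (g c) = fst (zs ! c)" if c: "c < m" for c
        proof -
          obtain i where "i < m" "cc i = c" using cover c lm by auto
          then show ?thesis using fe g by metis
        qed
        have "(\<Sum>c<m. nval c (g c)) = (\<Sum>c<m. nval c (zs ! c))" using eq lm by (simp add: Nv_def zs'_def)
        \<comment> \<open>The link costs agree because the roots do; only the loop indices remain in
          the equation, and their digits decide.\<close>
        then have "(\<Sum>c<m. int (snd (g c)) * int (Q + wt c)) = (\<Sum>c<m. int (snd (zs ! c)) * int (Q + wt c))"
          unfolding nval_def sum_subtractf using fg by simp
        then have "int (\<Sum>c<m. snd (g c) * (Q + wt c)) = int (\<Sum>c<m. snd (zs ! c) * (Q + wt c))" by simp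
        then have se: "(\<Sum>c<m. snd (g c) * (Q + B ^ c)) = (\<Sum>c<m. snd (zs ! c) * (Q + B ^ c))"
          unfolding wt_def by (simp only: of_nat_eq_iff)
        have rz': "rsum zs' = rsum ys" by (rule rsum_mset) fact
        have small: "(\<Sum>c<m. snd (u ! c) * B ^ c) < Q" "\<forall>c<m. snd (u ! c) < B" if u: "length u = m" "rsum u \<le> Rm" for u
        proof -
          have "(\<Sum>c<m. snd (u ! c) * B ^ c) \<le> (\<Sum>c<m. snd (u ! c) * w)"
            using L lm by (intro sum_mono mult_left_mono) (auto simp: w_def wt_def[symmetric] intro: wt_mono)
          also have "\<dots> = rsum u * w" by (simp add: rsum_nth u(1) sum_distrib_right)
          also have "\<dots> \<le> Rm * w" using u(2) by simp
          also have "\<dots> < Q" using Qb by (simp add: w_def)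
          finally show "(\<Sum>c<m. snd (u ! c) * B ^ c) < Q" .
          show "\<forall>c<m. snd (u ! c) < B"
          proof (intro allI impI)
            fix c assume "c < m"
            then have "snd (u ! c) \<le> rsum u" unfolding rsum_nth u(1) by (intro member_le_sum) auto
            then show "snd (u ! c) < B" using u(2) RB by simp
          qed
        qed
        have z'nth: "zs' ! c = g c" if "c < m" for c using that by (simp add: zs'_def)
        have lz': "length zs' = m" by (simp add: zs'_def)
        have se': "(\<Sum>c<m. snd (zs' ! c) * (Q + B ^ c)) = (\<Sum>c<m. snd (zs ! c) * (Q + B ^ c))"
          unfolding se[symmetric] by (rule sum.cong) (auto simp: z'nth)
        have "\<forall>c<m. snd (zs' ! c) = snd (zs ! c)"
          by (rule shifted_digits_unique[OF _ _ se']) (use small[OF lz'] small[OF lm] rz' R in auto)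
        then have "g c = zs ! c" if "c < m" for c using that fg[OF that] z'nth[OF that] by (simp add: prod_eq_iff)
        then have "map ((!) zs) cs = map g cs" using cs lm by auto
        then have f1: "map ((!) zs) cs = ys" using gcs by simp
        have f2: "As = map (chain zs) cs" by (rule nth_equalityI) (auto simp: lA cs_def Ac)
        have f3: "list_all2 same ys As" using True lA by (simp add: list_all2_conv_all_nth m_def)
        show ?thesis
          by (intro disjI2 conjI exI[of _ cs] f1 f2 f3 cs(1,2)) (simp only: cz eq)
      qed
    qed
  qed
qed

lemma chains_cost:
  assumes zs: "\<forall>y\<in>set zs. lo y \<le> hi y"
    and cs: "distinct cs" "set cs = {..<length zs}" "map ((!) zs) cs = ys"
  shows "cost ys (map (chain zs) cs) = Nv zs"
proof -
  have l: "length ys = length cs" using cs(3) by auto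
  have e: "ecost (ys ! i) (chain zs (cs ! i)) = nval (cs ! i) (zs ! (cs ! i))" if i: "i < length cs" for i
  proof -
    have y: "ys ! i = zs ! (cs ! i)" using cs(3) i by auto
    have c: "cs ! i < length zs" using cs(2) i by (metis lessThan_iff nth_mem)
    have p: "lo (zs ! (cs ! i)) \<le> hi (zs ! (cs ! i))" using zs c by auto
    have "same (zs ! (cs ! i)) (chain zs (cs ! i))" by (auto simp: same_def pt_chain)
    from same_transv(2)[OF transv_chain this p] show ?thesis unfolding y using p by (simp add: pt_chain)
  qed
  have "cost ys (map (chain zs) cs) = (\<Sum>i<length cs. nval (cs ! i) (zs ! (cs ! i)))"
    unfolding cost_def l using e by (intro sum.cong) auto
  also have "\<dots> = (\<Sum>c\<in>set cs. nval c (zs ! c))"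
    using sum.reindex_bij_betw[OF bij_betw_nth[OF cs(1) refl refl], of "\<lambda>c. nval c (zs ! c)"] by simp
  finally show ?thesis by (simp add: cs(2) Nv_def)
qed

text \<open>By \<open>tparts_cost\<close> the partitions of top degree come from the assignments of
  chains to positions of \<open>ys\<close> that respect roots and loop indices. Distinct assignments
  give distinct partitions, since chains are nonempty and their points carry the tag.\<close>

theorem psi_rprod_top_coeff:
  assumes zs: "\<forall>y\<in>set zs. lo y \<le> hi y" and ys: "\<forall>y\<in>set ys. lo y \<le> hi y"
    and b: "rsum ys \<le> Rm" "rsum zs \<le> Rm" "msum ys \<le> Mm" "msum zs \<le> Mm" "length zs \<le> L"
      "Rm < B" "Rm * wt L < t" "Rm * wt L + t * Mm < Q"
    and mx: "\<And>zs'. mset zs' = mset ys \<Longrightarrow> Nv zs' \<le> Nv zs"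
  shows "fls_nth (psi xpt (rprod ys) (allpts zs)) (- Nv zs) =
    of_nat (card {cs. distinct cs \<and> set cs = {..<length zs} \<and> map ((!) zs) cs = ys})"
proof -
  let ?K = "{cs. distinct cs \<and> set cs = {..<length zs} \<and> map ((!) zs) cs = ys}"
  note tc = tparts_cost[OF zs ys b mx]
  have "fls_nth (psi xpt (rprod ys) (allpts zs)) (- Nv zs) = of_nat (card {As \<in> tparts ys (allpts zs). cost ys As = Nv zs})"
    by (rule psi_rprod_coeff[OF finite_allpts ys]) (use tc in blast)
  also have "{As \<in> tparts ys (allpts zs). cost ys As = Nv zs} = map (chain zs) ` ?K"
  proof (intro equalityI subsetI)
    fix As assume "As \<in> {As \<in> tparts ys (allpts zs). cost ys As = Nv zs}"
    then show "As \<in> map (chain zs) ` ?K" using tc[of As] by auto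
  next
    fix As assume "As \<in> map (chain zs) ` ?K"
    then show "As \<in> {As \<in> tparts ys (allpts zs). cost ys As = Nv zs}"
      using chains_tparts[of _ zs ys] chains_cost[OF zs, of _ ys] by auto
  qed
  also have "card (map (chain zs) ` ?K) = card ?K"
  proof (rule card_image, rule inj_onI)
    fix cs cs' assume c: "cs \<in> ?K" "cs' \<in> ?K" "map (chain zs) cs = map (chain zs) cs'"
    have "inj_on (chain zs) {..<length zs}"
    proof (rule inj_onI)
      fix u v assume u: "u \<in> {..<length zs}" "v \<in> {..<length zs}" "chain zs u = chain zs v"
      then have "(u, lo (zs ! u)) \<in> chain zs v" using zs unfolding u(3)[symmetric] by (simp add: chain_def)
      then show "u = v" by (simp add: chain_def)
    qed
    then show "cs = cs'" using c by (intro map_inj_on[OF c(3)]) auto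
  qed
  finally show ?thesis .
qed

end

section \<open>Linear independence\<close>

text \<open>The ring map from Z[1/2] to the field. A representation \<open>z / 2^m\<close> is not
  unique, hence the \<open>THE\<close>; it is well defined when 2 is nonzero in the field, and
  outside Z[1/2] it means nothing.\<close>

definition zred :: "complex \<Rightarrow> 'k::field" where
  "zred c = (THE y. \<exists>z m. c = zhalf z m \<and> y = zhalf_k z m)"

lemma zhalf_k_cong:
  assumes "zhalf z m = zhalf z' m'" "(2::'k::field) \<noteq> 0"
  shows "(zhalf_k z m :: 'k) = zhalf_k z' m'"
proof -
  have "complex_of_int (z * 2 ^ m') = of_int (z' * 2 ^ m)"
    using assms(1) by (simp add: zhalf_def field_simps)
  then have "z * 2 ^ m' = z' * 2 ^ m" by (simp only: of_int_eq_iff)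
  then have "(of_int (z * 2 ^ m') :: 'k) = of_int (z' * 2 ^ m)" by simp
  then show ?thesis using assms(2) by (simp add: zhalf_k_def field_simps)
qed

lemma zred_zhalf:
  assumes "(2::'k::field) \<noteq> 0" shows "(zred (zhalf z m) :: 'k) = zhalf_k z m"
  unfolding zred_def
proof (rule the_equality)
  fix y :: 'k
  assume "\<exists>z' m'. zhalf z m = zhalf z' m' \<and> y = zhalf_k z' m'"
  then obtain z' m' where e: "zhalf z m = zhalf z' m'" "y = zhalf_k z' m'" by blast
  show "y = zhalf_k z m" unfolding e(2) by (rule zhalf_k_cong[OF e(1)[symmetric] assms])
qed blast

lemma zred_add:
  assumes "(2::'k::field) \<noteq> 0" "a \<in> zh" "b \<in> zh" shows "(zred (a + b) :: 'k) = zred a + zred b"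
proof -
  obtain z m z' m' where ab: "a = zhalf z m" "b = zhalf z' m'" using assms by (auto simp: zh_def)
  have "zhalf z m + zhalf z' m' = zhalf (z * 2 ^ m' + z' * 2 ^ m) (m + m')"
    by (simp add: zhalf_def add_divide_distrib power_add)
  then show ?thesis using assms(1)
    by (simp add: ab zred_zhalf[OF assms(1)]) (simp add: zhalf_k_def add_divide_distrib power_add)
qed

lemma zred_mult:
  assumes "(2::'k::field) \<noteq> 0" "a \<in> zh" shows "(zred (zhalf z m * a) :: 'k) = zhalf_k z m * zred a"
proof -
  obtain z' m' where ab: "a = zhalf z' m'" using assms by (auto simp: zh_def)
  have "zhalf z m * zhalf z' m' = zhalf (z * z') (m + m')"
    by (simp add: zhalf_def power_add)
  then show ?thesis
    by (simp add: ab zred_zhalf[OF assms(1)]) (simp add: zhalf_k_def power_add)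
qed

lemma zred_of_nat: "(2::'k::field) \<noteq> 0 \<Longrightarrow> (zred (of_nat m) :: 'k) = of_nat m"
  using zred_zhalf[of "int m" 0, where 'k='k] by (simp add: zhalf_def zhalf_k_def)

definition pairing :: "('a \<Rightarrow> 'k::field) \<Rightarrow> ('a \<Rightarrow> 'k) \<Rightarrow> 'k" where
  "pairing g u = (\<Sum>a\<in>{a. u a \<noteq> 0}. u a * g a)"

lemma pairing_superset: "finite W \<Longrightarrow> {a. u a \<noteq> 0} \<subseteq> W \<Longrightarrow> pairing g u = (\<Sum>a\<in>W. u a * g a)"
  unfolding pairing_def by (rule sum.mono_neutral_left) auto

lemma fin_supp_add: "fin_supp u \<Longrightarrow> fin_supp v \<Longrightarrow> fin_supp (\<lambda>x. u x + v x :: 'k::field)"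
  unfolding fin_supp_def by (rule finite_subset[of _ "{x. u x \<noteq> 0} \<union> {x. v x \<noteq> 0}"]) auto

lemma fin_supp_smult: "fin_supp u \<Longrightarrow> fin_supp (\<lambda>x. c * u x :: 'k::field)"
  unfolding fin_supp_def by (rule finite_subset[of _ "{x. u x \<noteq> 0}"]) auto

lemma pairing_add:
  assumes "fin_supp u" "fin_supp v"
  shows "pairing g (\<lambda>x. u x + v x) = pairing g u + pairing g v"
proof -
  let ?W = "{x. u x \<noteq> 0} \<union> {x. v x \<noteq> 0}"
  have W: "finite ?W" using assms by (simp add: fin_supp_def)
  have "pairing g (\<lambda>x. u x + v x) = (\<Sum>a\<in>?W. (u a + v a) * g a)" by (rule pairing_superset[OF W]) auto
  moreover have "pairing g u = (\<Sum>a\<in>?W. u a * g a)" by (rule pairing_superset[OF W]) auto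
  moreover have "pairing g v = (\<Sum>a\<in>?W. v a * g a)" by (rule pairing_superset[OF W]) auto
  ultimately show ?thesis by (simp add: distrib_right sum.distrib)
qed

lemma pairing_smult:
  assumes "fin_supp u" shows "pairing g (\<lambda>x. c * u x) = c * pairing g u"
proof -
  have "pairing g (\<lambda>x. c * u x) = (\<Sum>a\<in>{x. u x \<noteq> 0}. (c * u a) * g a)"
    using assms by (intro pairing_superset) (auto simp: fin_supp_def)
  then show ?thesis by (simp add: pairing_def sum_distrib_left mult.assoc)
qed

lemma fin_supp_delta: "fin_supp (delta a :: fa \<Rightarrow> 'k::field)"
  unfolding fin_supp_def delta_def by (rule finite_subset[of _ "{a}"]) auto

lemma pairing_delta: "pairing g (delta a) = g a"
proof -
  have "pairing g (delta a) = (\<Sum>b\<in>{a}. delta a b * g b)" by (rule pairing_superset) (auto simp: delta_def)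
  then show ?thesis by (simp add: delta_def)
qed

lemma pairing_sum:
  assumes "finite H"
  shows "fin_supp (\<lambda>x. \<Sum>h\<in>H. c h * delta (f h) x :: 'k::field) \<and>
    pairing g (\<lambda>x. \<Sum>h\<in>H. c h * delta (f h) x) = (\<Sum>h\<in>H. c h * g (f h))"
  using assms
proof (induction H rule: finite_induct)
  case empty
  then show ?case by (simp add: fin_supp_def pairing_def)
next
  case (insert h H)
  then show ?case
    by (simp add: pairing_add pairing_smult pairing_delta fin_supp_add fin_supp_smult fin_supp_delta)
qed

text \<open>The universal property of the tensor product: a function on the integral form that is
  constant on classes, additive and compatible with scalars from Z[1/2] extends to a linear form
  killing all relations. Finite support is carried along because the additivity of
  \<open>pairing\<close> rests on it.\<close>

lemma tensor_rels_pairing: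
  fixes g :: "fa \<Rightarrow> 'k::field"
  assumes "u \<in> tensor_rels n"
    and ideal: "\<And>a b. a \<in> Yform_pre n \<Longrightarrow> b \<in> Yform_pre n \<Longrightarrow> fa_diff a b \<in> yangian_ideal n \<Longrightarrow> g a = g b"
    and add: "\<And>a b. a \<in> Yform_pre n \<Longrightarrow> b \<in> Yform_pre n \<Longrightarrow> g (fa_add a b) = g a + g b"
    and scal: "\<And>a z m. a \<in> Yform_pre n \<Longrightarrow> g (fa_smult (zhalf z m) a) = zhalf_k z m * g a"
  shows "fin_supp u \<and> pairing g u = 0"
proof -
  have D: "fin_supp (\<lambda>x. u x - c * delta b x) \<and> pairing g (\<lambda>x. u x - c * delta b x) = pairing g u - c * g b"
    if "fin_supp u" for u :: "fa \<Rightarrow> 'k" and c b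
    using fin_supp_add[OF that fin_supp_smult[OF fin_supp_delta[of b], of "- c"]]
      pairing_add[OF that fin_supp_smult[OF fin_supp_delta[of b], of "- c"], of g]
      pairing_smult[OF fin_supp_delta[of b], of g "- c"]
    by (simp add: pairing_delta)
  note D1 = D[where c = 1, simplified]
  show ?thesis using assms(1)
  proof (induction rule: tensor_rels.induct)
    case (ideal a b)
    then show ?case using D1[OF fin_supp_delta[of a], of b] assms(2) by (simp add: pairing_delta)
  next
    case (additive a b)
    have f: "fin_supp (\<lambda>x. delta (fa_add a b) x - delta a x :: 'k)"
      and p: "pairing g (\<lambda>x. delta (fa_add a b) x - delta a x) = g (fa_add a b) - g a"
      using D1[OF fin_supp_delta[of "fa_add a b"], of a] by (simp_all add: pairing_delta)
    show ?case using D1[OF f, of b] p add[OF additive] by simp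
  next
    case (scalar a z m)
    then show ?case using D[OF fin_supp_delta[of "fa_smult (zhalf z m) a"], of "zhalf_k z m" a] scal by (simp add: pairing_delta)
  next
    case zero
    then show ?case by (simp add: fin_supp_def pairing_def)
  next
    case (add u v)
    then show ?case by (simp add: fin_supp_add pairing_add)
  next
    case (smult u c)
    then show ?case by (simp add: fin_supp_smult pairing_smult)
  qed
qed

text \<open>Only monomials with nonzero coefficient enter the choice of the points, so it is enough
  to contradict one of these coefficients, that of the maximal \<open>h0\<close>. No induction over
  the relation is needed.\<close>

theorem E_mon_independent:
  fixes c :: "(rootel \<Rightarrow> nat) \<Rightarrow> 'k::field"
  assumes p: "prime p" "p > 2" "CHAR('k) = p"
    and H: "finite H" "\<forall>h\<in>H. admissible_h n p h"
    and T: "(\<lambda>x. \<Sum>h\<in>H. c h * delta (E_mon h) x) \<in> tensor_rels n"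
  shows "\<forall>h\<in>H. c h = 0"
proof (rule ccontr)
  assume neg: "\<not> (\<forall>h\<in>H. c h = 0)"
  define H' where "H' = {h \<in> H. c h \<noteq> 0}"
  have H': "finite H'" "H' \<noteq> {}" using H neg by (auto simp: H'_def)
  have two: "(2::'k) \<noteq> 0"
  proof -
    have "\<not> p dvd 2" using p(2) by (auto dest: dvd_imp_le)
    then have "(of_nat 2 :: 'k) \<noteq> 0" by (simp only: of_nat_eq_0_iff_char_dvd p(3) not_False_eq_True)
    then show ?thesis by simp
  qed
  have adm: "finite {x. h x \<noteq> 0}" "\<forall>x. h x \<noteq> 0 \<longrightarrow> fst x \<in> pos_roots n" "\<forall>x. h x < p" if "h \<in> H'" for h
    using that H(2) unfolding H'_def admissible_h_def by auto
  have valid: "\<forall>y\<in>set (hlist h). lo y \<le> hi y" if "h \<in> H'" for h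
  proof
    fix y assume "y \<in> set (hlist h)"
    then have "fst y \<in> pos_roots n" using adm[OF that] set_hlist by blast
    then show "lo y \<le> hi y" by (auto simp: pos_roots_def)
  qed
  define Rm where "Rm = Max (rsum ` hlist ` H')"
  define Mm where "Mm = Max (msum ` hlist ` H')"
  define L where "L = Max (length ` hlist ` H')"
  have bnd: "rsum (hlist h) \<le> Rm" "msum (hlist h) \<le> Mm" "length (hlist h) \<le> L" if "h \<in> H'" for h
    unfolding Rm_def Mm_def L_def using H' that by (auto intro!: Max_ge)
  \<comment> \<open>\<open>B\<close> exceeds every loop index, so these are digits, and is at least
    2, so the weights increase. \<open>t\<close> beats all weighted loop indices, \<open>Q\<close>
    beats these and all links together, and its extra summand \<open>t\<close> ensures
    \<open>t < Q\<close>.\<close>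
  define B where "B = Rm + 2"
  define t where "t = Rm * B ^ L + 1"
  define Q where "Q = Rm * B ^ L + t * Mm + t + 1"
  interpret point_params B Q t by unfold_locales (auto simp: B_def t_def Q_def)
  have "Rm * B ^ L < t" "Rm * B ^ L + t * Mm < Q" by (simp_all add: t_def Q_def)
  then have par: "Rm < B" "Rm * wt L < t" "Rm * wt L + t * Mm < Q" unfolding wt_def by (simp_all add: B_def)
  \<comment> \<open>All orderings of all monomials that occur. An ordering with the largest
    \<open>Nv\<close> satisfies the maximality hypothesis for every \<open>h\<close> in
    \<open>H'\<close> simultaneously.\<close>
  define LL where "LL = (\<Union>h\<in>H'. {zs. mset zs = mset (hlist h)})"
  have "finite {zs. mset zs = mset ys}" for ys :: "rootel list"
  proof (rule finite_subset)
    show "{zs. mset zs = mset ys} \<subseteq> {zs. set zs \<subseteq> set ys \<and> length zs = length ys}"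
      by (auto dest: mset_eq_setD mset_eq_length)
  qed (simp add: finite_lists_length_eq)
  then have finLL: "finite LL" using H' by (simp add: LL_def)
  have neLL: "LL \<noteq> {}" using H' by (auto simp: LL_def)
  have "Max (Nv ` LL) \<in> Nv ` LL" using finLL neLL by (intro Max_in) auto
  then obtain zs where zs: "zs \<in> LL" "Nv zs = Max (Nv ` LL)" by auto
  then have mx: "Nv zs' \<le> Nv zs" if "zs' \<in> LL" for zs' using that finLL by auto
  obtain h0 where h0: "h0 \<in> H'" "mset zs = mset (hlist h0)" using zs(1) by (auto simp: LL_def)
  have sz: "set zs = set (hlist h0)" using h0(2) by (metis set_mset_mset)
  have vz: "\<forall>y\<in>set zs. lo y \<le> hi y" unfolding sz by (rule valid[OF h0(1)])
  have bz: "rsum zs \<le> Rm" "msum zs \<le> Mm" "length zs \<le> L"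
    using bnd[OF h0(1)] rsum_mset[OF h0(2)] msum_mset[OF h0(2)] arg_cong[OF h0(2), of size] by auto
  define K where "K h = card {cs. distinct cs \<and> set cs = {..<length zs} \<and> map ((!) zs) cs = hlist h}" for h
  have coeff: "fls_nth (psi xpt (rprod (hlist h)) (allpts zs)) (- Nv zs) = of_nat (K h)" if h: "h \<in> H'" for h
    unfolding K_def
    by (rule psi_rprod_top_coeff[OF vz valid[OF h] bnd(1)[OF h] bz(1) bnd(2)[OF h] bz(2,3) par])
      (use mx h in \<open>auto simp: LL_def\<close>)
  have mz: "image_mset ((!) zs) (mset_set {..<length zs}) = mset zs"
  proof -
    have "mset (map ((!) zs) [0..<length zs]) = mset zs" by (simp only: map_nth)
    then show ?thesis by (simp add: mset_map atLeast0LessThan)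
  qed
  \<comment> \<open>A matching would make \<open>hlist h\<close> a rearrangement of
    \<open>zs\<close>, hence of \<open>hlist h0\<close>, and the multiplicities determine
    \<open>h\<close>.\<close>
  have K0: "K h = 0" if h: "h \<in> H'" "h \<noteq> h0" for h
  proof -
    have "map ((!) zs) cs \<noteq> hlist h" if cs: "distinct cs" "set cs = {..<length zs}" for cs
    proof
      assume "map ((!) zs) cs = hlist h"
      then have "mset (hlist h) = image_mset ((!) zs) (mset cs)" by (metis mset_map)
      also have "mset cs = mset_set {..<length zs}" using cs by (metis mset_set_set)
      finally have "mset (hlist h) = mset (hlist h0)" using mz h0(2) by simp
      then have "count (mset (hlist h)) = count (mset (hlist h0))" by (rule arg_cong)
      then show False using h(2) unfolding count_hlist[OF adm(1)[OF h(1)]] count_hlist[OF adm(1)[OF h0(1)]] by (rule notE[rotated])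
    qed
    then have "{cs. distinct cs \<and> set cs = {..<length zs} \<and> map ((!) zs) cs = hlist h} = {}" by blast
    then show ?thesis by (simp only: K_def card.empty)
  qed
  have "K h0 = (\<Prod>u\<in>set (hlist h0). fact (count (mset (hlist h0)) u))"
    unfolding K_def
    by (rule card_labelled_permutations[THEN conjunct2]) (use mz h0(2) in auto)
  then have "K h0 = (\<Prod>u\<in>set (hlist h0). fact (h0 u))" unfolding count_hlist[OF adm(1)[OF h0(1)]] .
  moreover have "\<not> p dvd (\<Prod>u\<in>U. fact (h0 u))" if "finite U" for U :: "rootel set"
    using that
  proof (induction U rule: finite_induct)
    case (insert u U)
    then show ?case using p(1) adm(3)[OF h0(1), THEN spec, of u] by (simp add: prime_dvd_mult_iff prime_dvd_fact_iff not_le)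
  qed (use p(1) in \<open>auto simp: prime_nat_iff\<close>)
  ultimately have "\<not> p dvd K h0" by (metis finite_set)
  then have Kp: "(of_nat (K h0) :: 'k) \<noteq> 0" by (simp only: of_nat_eq_0_iff_char_dvd p(3) not_False_eq_True)
  \<comment> \<open>The top coefficient as a functional on raw functions. \<open>Ncpoly\<close> is
    meaningful only on finite supports, which \<open>Yf\<close> guarantees on the integral
    form.\<close>
  define l where "l a = fls_nth (psi xpt (Ncpoly a) (allpts zs)) (- Nv zs)" for a
  define g where "g a = (zred (l a) :: 'k)" for a
  have inj: "inj_on xpt P" for P using xpt_inj by (rule inj_on_subset) simp
  have Yf: "\<exists>f. a = fa_of f \<and> l a = fls_nth (psi xpt f (allpts zs)) (- Nv zs) \<and> l a \<in> zh" if a: "a \<in> Yform_pre n" for a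
  proof -
    from psi_zint[OF inj[of UNIV] xpt_zint _ a] zeta_xpt
    obtain f where f: "a = fa_of f" "\<forall>S. finite S \<longrightarrow> S \<subseteq> UNIV \<longrightarrow> zint (psi xpt f S)" by blast
    have "l a = fls_nth (psi xpt f (allpts zs)) (- Nv zs)" by (simp add: l_def f(1) fa_of_inverse)
    then show ?thesis using f finite_allpts[of zs] by (auto simp: zint_def)
  qed
  have lfa: "l (fa_of f) = fls_nth (psi xpt f (allpts zs)) (- Nv zs)" for f by (simp add: l_def fa_of_inverse)
  have "fin_supp (\<lambda>x. \<Sum>h\<in>H. c h * delta (E_mon h) x) \<and> pairing g (\<lambda>x. \<Sum>h\<in>H. c h * delta (E_mon h) x) = 0"
  proof (rule tensor_rels_pairing[OF T])
    fix a b assume ab: "a \<in> Yform_pre n" "b \<in> Yform_pre n" "fa_diff a b \<in> yangian_ideal n"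
    from Yf[OF ab(1)] Yf[OF ab(2)] obtain f f' where f: "a = fa_of f" "b = fa_of f'" by blast
    have "f - f' \<in> yideal n" using ab(3) by (simp add: f yideal_def minus_ncpoly.rep_eq)
    from psi_yideal[OF this finite_allpts[of zs] inj] show "g a = g b" by (simp add: g_def lfa f psi_diff)
  next
    fix a b assume ab: "a \<in> Yform_pre n" "b \<in> Yform_pre n"
    from Yf[OF ab(1)] Yf[OF ab(2)] obtain f f' where f: "a = fa_of f" "b = fa_of f'" and z: "l a \<in> zh" "l b \<in> zh" by blast
    have "l (fa_add a b) = l a + l b" using lfa[of "f + f'"] by (simp add: f lfa plus_ncpoly.rep_eq psi_add)
    then show "g (fa_add a b) = g a + g b" using zred_add[OF two z] by (simp add: g_def)
  next
    fix a z m assume a: "a \<in> Yform_pre n"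
    from Yf[OF a] obtain f where f: "a = fa_of f" and z: "l a \<in> zh" by blast
    have "l (fa_smult (zhalf z m) a) = zhalf z m * l a" using lfa[of "scale (zhalf z m) f"] by (simp add: f lfa scale.rep_eq psi_scale)
    then show "g (fa_smult (zhalf z m) a) = zhalf_k z m * g a" using zred_mult[OF two z] by (simp add: g_def)
  qed
  then have "(\<Sum>h\<in>H. c h * g (E_mon h)) = 0" using pairing_sum[OF H(1), of c E_mon g] by simp
  moreover have "(\<Sum>h\<in>H. c h * g (E_mon h)) = (\<Sum>h\<in>H'. c h * g (E_mon h))"
    by (rule sum.mono_neutral_right) (auto simp: H'_def H(1))
  moreover have "\<dots> = (\<Sum>h\<in>H'. if h = h0 then c h * of_nat (K h0) else 0)"
  proof (rule sum.cong[OF refl])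
    fix h assume h: "h \<in> H'"
    have "g (E_mon h) = of_nat (K h)"
      unfolding g_def E_mon_rprod lfa coeff[OF h] by (rule zred_of_nat[OF two])
    then show "c h * g (E_mon h) = (if h = h0 then c h * of_nat (K h0) else 0)" using K0[OF h] by auto
  qed
  moreover have "\<dots> = c h0 * of_nat (K h0)" using H' h0(1) by simp
  ultimately have "c h0 * of_nat (K h0) = 0" by simp
  then show False using Kp h0(1) by (simp add: H'_def)
qed

theorem theorem3p7:
  fixes p n :: nat
  assumes "prime p" and "p > 2" and "CHAR('k::alg_closed_field) = p" and "n \<ge> 2"
  shows
    "(\<forall>h. admissible_h n p h \<longrightarrow>
        (\<exists>s\<in>(small_span n p :: (fa \<Rightarrow> 'k) set).
            (\<lambda>x. delta (E_mon h) x - s x) \<in> (tensor_rels n :: (fa \<Rightarrow> 'k) set)))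
   \<and> (\<forall>H (c :: ((nat \<times> nat) \<times> nat \<Rightarrow> nat) \<Rightarrow> 'k).
        finite H \<longrightarrow> (\<forall>h\<in>H. admissible_h n p h) \<longrightarrow>
        (\<lambda>x. \<Sum>h\<in>H. c h * delta (E_mon h) x) \<in> tensor_rels n \<longrightarrow> (\<forall>h\<in>H. c h = 0))
   \<and> (\<forall>s\<in>(small_span n p :: (fa \<Rightarrow> 'k) set).
        \<exists>H (c :: ((nat \<times> nat) \<times> nat \<Rightarrow> nat) \<Rightarrow> 'k).
          finite H \<and> (\<forall>h\<in>H. admissible_h n p h) \<and>
          (\<lambda>x. s x - (\<Sum>h\<in>H. c h * delta (E_mon h) x)) \<in> tensor_rels n)"
proof (intro conjI)
  show "\<forall>h. admissible_h n p h \<longrightarrow>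
        (\<exists>s\<in>(small_span n p :: (fa \<Rightarrow> 'k) set).
            (\<lambda>x. delta (E_mon h) x - s x) \<in> (tensor_rels n :: (fa \<Rightarrow> 'k) set))"
  proof (intro allI impI)
    fix h assume "admissible_h n p h"
    then have "E_mon h \<in> small_monomials n p" using assms(2) by (intro E_mon_small_monomial) auto
    then have "(delta (E_mon h) :: fa \<Rightarrow> 'k) \<in> small_span n p"
      unfolding small_span_def by (intro CollectI exI[of _ "{E_mon h}"] exI[of _ "\<lambda>_. 1"]) auto
    then show "\<exists>s\<in>(small_span n p :: (fa \<Rightarrow> 'k) set). (\<lambda>x. delta (E_mon h) x - s x) \<in> tensor_rels n"
      using tensor_rels.zero by (intro bexI[of _ "delta (E_mon h)"]) auto
  qed
qed (use E_mon_independent[OF assms(1-3)] in blast,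
    use small_span_espan[OF _ assms(3,1)] in \<open>simp add: espan_def\<close>)

end
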